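(* ZFC proves that $\mathrm{HNT}_{\aleph_1}$ is an inner model of ZF (a transitive class containing all ordinals which satisfies all axioms of ZF) such that $\mathrm{HOD}\subseteq\mathrm{HNT}_{\aleph_1}$.
   Context: $\mathrm{NT}_{\aleph_1}=\bigcup_{\zeta>\omega}\{a\in V_\zeta:\ \text{there is a formula }\phi(x)\text{ of set theory without parameters with } a\in\phi(V_\zeta)\text{ and }\phi(V_\zeta)\text{ countable}\}$, where $V_\zeta=\{x:\mathrm{rank}(x)<\zeta\}$ and $\phi(V_\zeta)=\{x\in V_\zeta:(V_\zeta,\in)\models\phi(x)\}$; equivalently, $\mathrm{NT}_{\aleph_1}$ is the class of sets belonging to some countable ordinal definable set. $\mathrm{HNT}_{\aleph_1}=\{x:\mathrm{TC}(\{x\})\subseteq\mathrm{NT}_{\aleph_1}\}$ is the class of hereditarily such sets ($\mathrm{TC}$ = transitive closure). $\mathrm{HOD}$ is the class of hereditarily ordinal definable sets. *)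

theory Defs
  imports Main
begin

section \<open>First-order set theory\<close>

text \<open>
  Formulas are in de Bruijn notation: inside \<open>\<^bold>\<forall> p\<close> the index 0 is the bound variable and
  index \<open>n + 1\<close> is what \<open>n\<close> is outside.  There are no function symbols, so the only terms
  are variables and substitution is renaming.
\<close>

datatype fm =
    Fls  ("\<^bold>\<bottom>")
  | Mem nat nat  (infix "\<^bold>\<in>" 50)
  | Equ nat nat  (infix "\<^bold>=" 50)
  | Imp fm fm  (infixr "\<^bold>\<longrightarrow>" 25)
  | Forall fm  ("\<^bold>\<forall> _" [70] 70)

definition Neg :: "fm \<Rightarrow> fm"  ("\<^bold>\<not> _" [70] 70)
  where "\<^bold>\<not> p = (p \<^bold>\<longrightarrow> \<^bold>\<bottom>)"

definition Conj :: "fm \<Rightarrow> fm \<Rightarrow> fm"  (infixr "\<^bold>\<and>" 35)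
  where "(p \<^bold>\<and> q) = \<^bold>\<not> (p \<^bold>\<longrightarrow> \<^bold>\<not> q)"

definition Disj :: "fm \<Rightarrow> fm \<Rightarrow> fm"  (infixr "\<^bold>\<or>" 30)
  where "(p \<^bold>\<or> q) = (\<^bold>\<not> p \<^bold>\<longrightarrow> q)"

definition Iff :: "fm \<Rightarrow> fm \<Rightarrow> fm"  (infix "\<^bold>\<longleftrightarrow>" 25)
  where "(p \<^bold>\<longleftrightarrow> q) = ((p \<^bold>\<longrightarrow> q) \<^bold>\<and> (q \<^bold>\<longrightarrow> p))"

definition Exists :: "fm \<Rightarrow> fm"  ("\<^bold>\<exists> _" [70] 70)
  where "\<^bold>\<exists> p = \<^bold>\<not> \<^bold>\<forall> \<^bold>\<not> p"

text \<open>In a bounded quantifier the bound \<open>x\<close> is an index of the surrounding context.\<close>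

definition BAll :: "nat \<Rightarrow> fm \<Rightarrow> fm"
  where "BAll x p = \<^bold>\<forall> (0 \<^bold>\<in> x+1 \<^bold>\<longrightarrow> p)"

definition BEx :: "nat \<Rightarrow> fm \<Rightarrow> fm"
  where "BEx x p = \<^bold>\<exists> (0 \<^bold>\<in> x+1 \<^bold>\<and> p)"

primrec ren :: "(nat \<Rightarrow> nat) \<Rightarrow> fm \<Rightarrow> fm" where
  "ren r \<^bold>\<bottom> = \<^bold>\<bottom>"
| "ren r (i \<^bold>\<in> j) = (r i \<^bold>\<in> r j)"
| "ren r (i \<^bold>= j) = (r i \<^bold>= r j)"
| "ren r (p \<^bold>\<longrightarrow> q) = (ren r p \<^bold>\<longrightarrow> ren r q)"
| "ren r (\<^bold>\<forall> p) = \<^bold>\<forall> (ren (case_nat 0 (\<lambda>n. r n + 1)) p)"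

definition inst :: "nat \<Rightarrow> fm \<Rightarrow> fm"
  where "inst t p = ren (case_nat t (\<lambda>n. n)) p"

primrec fv :: "fm \<Rightarrow> nat set" where
  "fv \<^bold>\<bottom> = {}"
| "fv (i \<^bold>\<in> j) = {i, j}"
| "fv (i \<^bold>= j) = {i, j}"
| "fv (p \<^bold>\<longrightarrow> q) = fv p \<union> fv q"
| "fv (\<^bold>\<forall> p) = {n. n + 1 \<in> fv p}"

definition universal_closures :: "fm \<Rightarrow> fm set"
  where "universal_closures p = {(Forall ^^ n) p | n. fv ((Forall ^^ n) p) = {}}"

text \<open>Natural deduction for classical first-order logic with equality.\<close>

inductive proves :: "fm set \<Rightarrow> fm \<Rightarrow> bool"  (infix "\<turnstile>" 20) where
  Assm: "p \<in> \<Gamma> \<Longrightarrow> \<Gamma> \<turnstile> p"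
| ImpI: "insert p \<Gamma> \<turnstile> q \<Longrightarrow> \<Gamma> \<turnstile> p \<^bold>\<longrightarrow> q"
| ImpE: "\<Gamma> \<turnstile> p \<^bold>\<longrightarrow> q \<Longrightarrow> \<Gamma> \<turnstile> p \<Longrightarrow> \<Gamma> \<turnstile> q"
| Contr: "insert (\<^bold>\<not> p) \<Gamma> \<turnstile> \<^bold>\<bottom> \<Longrightarrow> \<Gamma> \<turnstile> p"
| AllI: "ren (\<lambda>n. n + 1) ` \<Gamma> \<turnstile> p \<Longrightarrow> \<Gamma> \<turnstile> \<^bold>\<forall> p"
| AllE: "\<Gamma> \<turnstile> \<^bold>\<forall> p \<Longrightarrow> \<Gamma> \<turnstile> inst t p"
| EqI: "\<Gamma> \<turnstile> i \<^bold>= i"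
| EqE: "\<Gamma> \<turnstile> i \<^bold>= j \<Longrightarrow> \<Gamma> \<turnstile> inst i p \<Longrightarrow> \<Gamma> \<turnstile> inst j p"

text \<open>
  A class is given by a formula with one free variable, as a function of the index of that
  variable.  \<open>relativize C p\<close> is the relativization of \<open>p\<close> to the class \<open>C\<close>.
\<close>

primrec relativize :: "(nat \<Rightarrow> fm) \<Rightarrow> fm \<Rightarrow> fm" where
  "relativize C \<^bold>\<bottom> = \<^bold>\<bottom>"
| "relativize C (i \<^bold>\<in> j) = (i \<^bold>\<in> j)"
| "relativize C (i \<^bold>= j) = (i \<^bold>= j)"
| "relativize C (p \<^bold>\<longrightarrow> q) = (relativize C p \<^bold>\<longrightarrow> relativize C q)"
| "relativize C (\<^bold>\<forall> p) = \<^bold>\<forall> (C 0 \<^bold>\<longrightarrow> relativize C p)"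


section \<open>Basic set-theoretic formulas\<close>

definition sub_fm :: "nat \<Rightarrow> nat \<Rightarrow> fm"
  where "sub_fm x y = BAll x (0 \<^bold>\<in> y+1)"

definition empty_fm :: "nat \<Rightarrow> fm"
  where "empty_fm x = \<^bold>\<forall> \<^bold>\<not> (0 \<^bold>\<in> x+1)"

text \<open>\<open>z = {x, y}\<close>, \<open>z = (x, y)\<close> (Kuratowski), \<open>y = x \<union> {x}\<close>\<close>

definition upair_fm :: "nat \<Rightarrow> nat \<Rightarrow> nat \<Rightarrow> fm"
  where "upair_fm z x y = \<^bold>\<forall> (0 \<^bold>\<in> z+1 \<^bold>\<longleftrightarrow> 0 \<^bold>= x+1 \<^bold>\<or> 0 \<^bold>= y+1)"

definition opair_fm :: "nat \<Rightarrow> nat \<Rightarrow> nat \<Rightarrow> fm"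
  where "opair_fm z x y =
    \<^bold>\<exists> \<^bold>\<exists> (upair_fm 1 (x+2) (x+2) \<^bold>\<and> upair_fm 0 (x+2) (y+2) \<^bold>\<and> upair_fm (z+2) 1 0)"

definition succ_fm :: "nat \<Rightarrow> nat \<Rightarrow> fm"
  where "succ_fm y x = \<^bold>\<forall> (0 \<^bold>\<in> y+1 \<^bold>\<longleftrightarrow> 0 \<^bold>\<in> x+1 \<^bold>\<or> 0 \<^bold>= x+1)"

text \<open>\<open>(x, y) \<in> r\<close>\<close>

definition inrel_fm :: "nat \<Rightarrow> nat \<Rightarrow> nat \<Rightarrow> fm"
  where "inrel_fm r x y = BEx r (opair_fm 0 (x+1) (y+1))"

text \<open>\<open>f\<close> is a function with domain \<open>A\<close>; \<open>f : A \<rightarrow> B\<close>\<close>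

definition function_on_fm :: "nat \<Rightarrow> nat \<Rightarrow> fm"
  where "function_on_fm f A =
    (BAll f (BEx (A+1) (\<^bold>\<exists> opair_fm 2 1 0)) \<^bold>\<and>
     BAll A (\<^bold>\<exists> \<^bold>\<forall> (inrel_fm (f+3) 2 0 \<^bold>\<longleftrightarrow> 0 \<^bold>= 1)))"

definition function_fm :: "nat \<Rightarrow> nat \<Rightarrow> nat \<Rightarrow> fm"
  where "function_fm f A B =
    (function_on_fm f A \<^bold>\<and> BAll A (BEx (B+1) (inrel_fm (f+2) 1 0)))"

definition inductive_fm :: "nat \<Rightarrow> fm"
  where "inductive_fm S =
    (BEx S (empty_fm 0) \<^bold>\<and> BAll S (BEx (S+1) (succ_fm 0 1)))"

definition omega_fm :: "nat \<Rightarrow> fm"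
  where "omega_fm w = (inductive_fm w \<^bold>\<and> \<^bold>\<forall> (inductive_fm 0 \<^bold>\<longrightarrow> sub_fm (w+1) 0))"

definition transitive_fm :: "nat \<Rightarrow> fm"
  where "transitive_fm x = BAll x (sub_fm 0 (x+1))"

definition ordinal_fm :: "nat \<Rightarrow> fm"
  where "ordinal_fm x = (transitive_fm x \<^bold>\<and> BAll x (transitive_fm 0))"

definition countable_fm :: "nat \<Rightarrow> fm"
  where "countable_fm X =
    \<^bold>\<exists> \<^bold>\<exists> (omega_fm 1 \<^bold>\<and> function_fm 0 (X+2) 1 \<^bold>\<and>
      BAll (X+2) (BAll (X+3) (\<^bold>\<forall> (inrel_fm 3 2 0 \<^bold>\<and> inrel_fm 3 1 0 \<^bold>\<longrightarrow> 2 \<^bold>= 1))))"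

text \<open>\<open>T\<close> is the transitive closure of \<open>X\<close>, i.e. the least transitive superset of \<open>X\<close>\<close>

definition tc_fm :: "nat \<Rightarrow> nat \<Rightarrow> fm"
  where "tc_fm T X =
    (transitive_fm T \<^bold>\<and> sub_fm X T \<^bold>\<and>
     \<^bold>\<forall> (transitive_fm 0 \<^bold>\<and> sub_fm (X+1) 0 \<^bold>\<longrightarrow> sub_fm (T+1) 0))"

text \<open>\<open>TC({x})\<close> is included in the class \<open>C\<close>\<close>

definition hereditarily_fm :: "(nat \<Rightarrow> fm) \<Rightarrow> nat \<Rightarrow> fm"
  where "hereditarily_fm C x =
    \<^bold>\<exists> \<^bold>\<exists> (upair_fm 1 (x+2) (x+2) \<^bold>\<and> tc_fm 0 1 \<^bold>\<and> BAll 0 (C 0))"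

text \<open>
  \<open>rank(x) = b\<close>, witnessed by the rank function \<open>f\<close> on a transitive set \<open>T\<close> containing \<open>x\<close>:
  \<open>f(y) = \<Union> {f(z) + 1 | z \<in> y}\<close> for all \<open>y \<in> T\<close>.
\<close>

definition rank_fm :: "nat \<Rightarrow> nat \<Rightarrow> fm"
  where "rank_fm x b =
    \<^bold>\<exists> \<^bold>\<exists> (transitive_fm 1 \<^bold>\<and> x+2 \<^bold>\<in> 1 \<^bold>\<and> function_on_fm 0 1 \<^bold>\<and>
      BAll 1 (\<^bold>\<forall> (inrel_fm 2 1 0 \<^bold>\<longrightarrow>
        \<^bold>\<forall> (0 \<^bold>\<in> 1 \<^bold>\<longleftrightarrow> BEx 2 (\<^bold>\<exists> (inrel_fm 5 1 0 \<^bold>\<and> (2 \<^bold>\<in> 0 \<^bold>\<or> 2 \<^bold>= 0)))))) \<^bold>\<and>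
      inrel_fm 0 (x+2) (b+2))"

text \<open>\<open>V = V\<^sub>\<zeta>\<close> for an ordinal \<open>z = \<zeta>\<close>\<close>

definition Vset_fm :: "nat \<Rightarrow> nat \<Rightarrow> fm"
  where "Vset_fm V z = \<^bold>\<forall> (0 \<^bold>\<in> V+1 \<^bold>\<longleftrightarrow> BEx (z+1) (rank_fm 1 0))"


section \<open>The axioms of ZFC\<close>

definition extensionality_ax :: fm
  where "extensionality_ax = \<^bold>\<forall> \<^bold>\<forall> (\<^bold>\<forall> (0 \<^bold>\<in> 2 \<^bold>\<longleftrightarrow> 0 \<^bold>\<in> 1) \<^bold>\<longrightarrow> 1 \<^bold>= 0)"

definition pairing_ax :: fm
  where "pairing_ax = \<^bold>\<forall> \<^bold>\<forall> \<^bold>\<exists> upair_fm 0 2 1"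

definition union_ax :: fm
  where "union_ax = \<^bold>\<forall> \<^bold>\<exists> \<^bold>\<forall> (0 \<^bold>\<in> 1 \<^bold>\<longleftrightarrow> BEx 2 (1 \<^bold>\<in> 0))"

definition power_set_ax :: fm
  where "power_set_ax = \<^bold>\<forall> \<^bold>\<exists> \<^bold>\<forall> (0 \<^bold>\<in> 1 \<^bold>\<longleftrightarrow> sub_fm 0 2)"

definition infinity_ax :: fm
  where "infinity_ax = \<^bold>\<exists> inductive_fm 0"

definition regularity_ax :: fm
  where "regularity_ax = \<^bold>\<forall> (\<^bold>\<exists> (0 \<^bold>\<in> 1) \<^bold>\<longrightarrow> BEx 0 (\<^bold>\<not> BEx 0 (0 \<^bold>\<in> 2)))"

definition choice_ax :: fm
  where "choice_ax =
    \<^bold>\<forall> (BAll 0 (\<^bold>\<not> empty_fm 0) \<^bold>\<longrightarrow>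
       \<^bold>\<exists> (function_on_fm 0 1 \<^bold>\<and> BAll 1 (BEx 0 (inrel_fm 2 1 0))))"

text \<open>
  Separation for \<open>p(x, ...)\<close>, where \<open>x\<close> has index 0 in \<open>p\<close> and the parameters have the indices
  from 1 on: for all \<open>a\<close> there is \<open>{x \<in> a. p(x, ...)}\<close>.
\<close>

definition separation_fm :: "fm \<Rightarrow> fm"
  where "separation_fm p =
    \<^bold>\<forall> \<^bold>\<exists> \<^bold>\<forall> (0 \<^bold>\<in> 1 \<^bold>\<longleftrightarrow> 0 \<^bold>\<in> 2 \<^bold>\<and> ren (case_nat 0 (\<lambda>k. k+3)) p)"

text \<open>
  Replacement for \<open>p(x, y, ...)\<close>, where \<open>x\<close> and \<open>y\<close> have the indices 0 and 1 in \<open>p\<close> and the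
  parameters have the indices from 2 on: if \<open>p\<close> is functional, then for all \<open>a\<close> there is
  \<open>{y. \<exists>x \<in> a. p(x, y, ...)}\<close>.
\<close>

definition replacement_fm :: "fm \<Rightarrow> fm"
  where "replacement_fm p =
    (\<^bold>\<forall> \<^bold>\<forall> \<^bold>\<forall> (ren (case_nat 2 (case_nat 1 (\<lambda>k. k+3))) p \<^bold>\<and>
             ren (case_nat 2 (case_nat 0 (\<lambda>k. k+3))) p \<^bold>\<longrightarrow> 1 \<^bold>= 0) \<^bold>\<longrightarrow>
     \<^bold>\<forall> \<^bold>\<exists> \<^bold>\<forall> (0 \<^bold>\<in> 1 \<^bold>\<longleftrightarrow> BEx 2 (ren (case_nat 0 (case_nat 1 (\<lambda>k. k+4))) p)))"

definition ZF :: "fm set"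
  where "ZF =
    {extensionality_ax, pairing_ax, union_ax, power_set_ax, infinity_ax, regularity_ax} \<union>
    (\<Union>p. universal_closures (separation_fm p)) \<union>
    (\<Union>p. universal_closures (replacement_fm p))"

definition ZFC :: "fm set"
  where "ZFC = insert choice_ax ZF"


section \<open>Formulas and satisfaction inside set theory\<close>

text \<open>\<open>x\<close> is the natural number \<open>k\<close>\<close>

primrec numeral_fm :: "nat \<Rightarrow> nat \<Rightarrow> fm" where
  "numeral_fm 0 x = empty_fm x"
| "numeral_fm (Suc k) x = \<^bold>\<exists> (numeral_fm k 0 \<^bold>\<and> succ_fm (x+1) 0)"

text \<open>\<open>c = (k, u)\<close> and \<open>c = (k, (u, v))\<close> for a number \<open>k\<close>\<close>

definition tag_fm :: "nat \<Rightarrow> nat \<Rightarrow> nat \<Rightarrow> fm"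
  where "tag_fm k c u = \<^bold>\<exists> (numeral_fm k 0 \<^bold>\<and> opair_fm (c+1) 0 (u+1))"

definition tag2_fm :: "nat \<Rightarrow> nat \<Rightarrow> nat \<Rightarrow> nat \<Rightarrow> fm"
  where "tag2_fm k c u v = \<^bold>\<exists> (opair_fm 0 (u+1) (v+1) \<^bold>\<and> tag_fm k (c+1) 0)"

text \<open>
  Formulas inside set theory are sets built as follows, in the context of the variables
  \<open>v\<^sub>0, ..., v\<^bsub>n-1\<^esub>\<close>:
    \<^item> \<open>v\<^sub>i \<in> v\<^sub>j\<close> is \<open>(0, (i, j))\<close> and \<open>v\<^sub>i = v\<^sub>j\<close> is \<open>(1, (i, j))\<close>, where \<open>i, j < n\<close>;
    \<^item> \<open>\<not> (\<phi> \<and> \<psi>)\<close> is \<open>(2, (\<phi>, \<psi>))\<close>;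
    \<^item> \<open>\<forall>v\<^sub>n. \<phi>\<close> is \<open>(3, \<phi>)\<close>, where \<open>\<phi>\<close> is a formula in the context \<open>v\<^sub>0, ..., v\<^sub>n\<close>.

  Thus a quantifier always binds the next variable (de Bruijn levels, in contrast to the
  indices used in \<^typ>\<open>fm\<close>), and the formulas in the context \<open>n\<close> are precisely those whose
  free variables are among \<open>v\<^sub>0, ..., v\<^bsub>n-1\<^esub>\<close>.

  \<open>formula_fm w n c\<close>, where \<open>w = \<omega>\<close>, says that \<open>c\<close> is a formula in the context \<open>n\<close>: the pair
  \<open>(n, c)\<close> belongs to every relation \<open>F\<close> closed under these rules.
\<close>

definition formula_closed_fm :: "nat \<Rightarrow> nat \<Rightarrow> fm"
  where "formula_closed_fm w F =
    BAll w
     (BAll 0 (BAll 1 (\<^bold>\<forall> (tag2_fm 0 0 2 1 \<^bold>\<or> tag2_fm 1 0 2 1 \<^bold>\<longrightarrow> inrel_fm (F+4) 3 0))) \<^bold>\<and>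
      \<^bold>\<forall> \<^bold>\<forall> \<^bold>\<forall> (inrel_fm (F+4) 3 2 \<^bold>\<and> inrel_fm (F+4) 3 1 \<^bold>\<and> tag2_fm 2 0 2 1 \<^bold>\<longrightarrow>
               inrel_fm (F+4) 3 0) \<^bold>\<and>
      \<^bold>\<forall> \<^bold>\<forall> \<^bold>\<forall> (succ_fm 2 3 \<^bold>\<and> inrel_fm (F+4) 2 1 \<^bold>\<and> tag_fm 3 0 1 \<^bold>\<longrightarrow> inrel_fm (F+4) 3 0))"

definition formula_fm :: "nat \<Rightarrow> nat \<Rightarrow> nat \<Rightarrow> fm"
  where "formula_fm w n c =
    (n \<^bold>\<in> w \<^bold>\<and> \<^bold>\<forall> (formula_closed_fm (w+1) 0 \<^bold>\<longrightarrow> inrel_fm 0 (n+1) (c+1)))"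

text \<open>\<open>t = s \<union> {(n, x)}\<close>, i.e. the sequence \<open>s\<close> of length \<open>n\<close> is extended by \<open>x\<close>\<close>

definition snoc_fm :: "nat \<Rightarrow> nat \<Rightarrow> nat \<Rightarrow> nat \<Rightarrow> fm"
  where "snoc_fm t s n x = \<^bold>\<forall> (0 \<^bold>\<in> t+1 \<^bold>\<longleftrightarrow> 0 \<^bold>\<in> s+1 \<^bold>\<or> opair_fm 0 (n+1) (x+1))"

text \<open>
  \<open>S\<close> is a satisfaction relation for the structure \<open>(A, \<in>)\<close>, where \<open>w = \<omega>\<close>: the Tarski clauses
  hold for \<open>(\<phi>, s) \<in> S\<close>, for all \<open>n\<close>, all \<open>s : n \<rightarrow> A\<close> and all formulas \<open>\<phi>\<close> in the context
  \<open>n\<close>.  They determine \<open>S\<close> on such pairs.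
\<close>

definition sat_relation_fm :: "nat \<Rightarrow> nat \<Rightarrow> nat \<Rightarrow> fm"
  where "sat_relation_fm w A S =
    BAll w (\<^bold>\<forall> (function_fm 0 1 (A+2) \<^bold>\<longrightarrow>
      BAll 1 (BAll 2 (\<^bold>\<forall> (tag2_fm 0 0 2 1 \<^bold>\<longrightarrow>
        (inrel_fm (S+5) 0 3 \<^bold>\<longleftrightarrow> \<^bold>\<exists> \<^bold>\<exists> (inrel_fm 5 4 1 \<^bold>\<and> inrel_fm 5 3 0 \<^bold>\<and> 1 \<^bold>\<in> 0))))) \<^bold>\<and>
      BAll 1 (BAll 2 (\<^bold>\<forall> (tag2_fm 1 0 2 1 \<^bold>\<longrightarrow>
        (inrel_fm (S+5) 0 3 \<^bold>\<longleftrightarrow> \<^bold>\<exists> \<^bold>\<exists> (inrel_fm 5 4 1 \<^bold>\<and> inrel_fm 5 3 0 \<^bold>\<and> 1 \<^bold>= 0))))) \<^bold>\<and>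
      \<^bold>\<forall> \<^bold>\<forall> \<^bold>\<forall> (formula_fm (w+5) 4 2 \<^bold>\<and> formula_fm (w+5) 4 1 \<^bold>\<and> tag2_fm 2 0 2 1 \<^bold>\<longrightarrow>
        (inrel_fm (S+5) 0 3 \<^bold>\<longleftrightarrow> \<^bold>\<not> (inrel_fm (S+5) 2 3 \<^bold>\<and> inrel_fm (S+5) 1 3))) \<^bold>\<and>
      \<^bold>\<forall> \<^bold>\<forall> \<^bold>\<forall> (succ_fm 2 4 \<^bold>\<and> formula_fm (w+5) 2 1 \<^bold>\<and> tag_fm 3 0 1 \<^bold>\<longrightarrow>
        (inrel_fm (S+5) 0 3 \<^bold>\<longleftrightarrow>
          BAll (A+5) (\<^bold>\<exists> (snoc_fm 0 5 6 1 \<^bold>\<and> inrel_fm (S+7) 3 0))))))"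

text \<open>\<open>(A, \<in>) \<Turnstile> c[s]\<close>\<close>

definition sat_fm :: "nat \<Rightarrow> nat \<Rightarrow> nat \<Rightarrow> nat \<Rightarrow> fm"
  where "sat_fm w A c s =
    \<^bold>\<exists> (sat_relation_fm (w+1) (A+1) 0 \<^bold>\<and> inrel_fm 0 (c+1) (s+1))"


section \<open>The classes \<open>HOD\<close> and \<open>HNT\<^bsub>\<aleph>1\<^esub>\<close>\<close>

text \<open>\<open>X = \<phi>(A) = {x \<in> A. (A, \<in>) \<Turnstile> \<phi>(x)}\<close> for a formula \<open>\<phi> = c\<close> in the context \<open>v\<^sub>0\<close>\<close>

definition defined_set_fm :: "nat \<Rightarrow> nat \<Rightarrow> nat \<Rightarrow> nat \<Rightarrow> fm"
  where "defined_set_fm w A c X =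
    \<^bold>\<forall> (0 \<^bold>\<in> X+1 \<^bold>\<longleftrightarrow> 0 \<^bold>\<in> A+1 \<^bold>\<and>
       \<^bold>\<exists> \<^bold>\<exists> (empty_fm 1 \<^bold>\<and> snoc_fm 0 1 1 2 \<^bold>\<and> sat_fm (w+3) (A+3) (c+3) 0))"

text \<open>
  The quantified variables of the next formula are, from the outside, \<open>w = \<omega>\<close>, \<open>\<zeta>\<close>, \<open>V\<^sub>\<zeta>\<close>, the
  number 1, \<open>\<phi>\<close>, and \<open>\<phi>(V\<^sub>\<zeta>)\<close>.
\<close>

definition NT_fm :: "nat \<Rightarrow> fm"
  where "NT_fm a =
    \<^bold>\<exists> \<^bold>\<exists> \<^bold>\<exists> \<^bold>\<exists> \<^bold>\<exists> \<^bold>\<exists>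
      (omega_fm 5 \<^bold>\<and> ordinal_fm 4 \<^bold>\<and> 5 \<^bold>\<in> 4 \<^bold>\<and> Vset_fm 3 4 \<^bold>\<and> a+6 \<^bold>\<in> 3 \<^bold>\<and>
       numeral_fm 1 2 \<^bold>\<and> formula_fm 5 2 1 \<^bold>\<and> defined_set_fm 5 3 1 0 \<^bold>\<and>
       a+6 \<^bold>\<in> 0 \<^bold>\<and> countable_fm 0)"

definition HNT_fm :: "nat \<Rightarrow> fm"
  where "HNT_fm = hereditarily_fm NT_fm"

text \<open>
  \<open>a\<close> is ordinal definable: there are an ordinal \<open>\<zeta>\<close>, a finite sequence \<open>s : n \<rightarrow> \<zeta>\<close> of ordinals
  and a formula \<open>\<phi>\<close> in \<open>n + 1\<close> free variables such that \<open>a\<close> is the unique \<open>x \<in> V\<^sub>\<zeta>\<close> with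
  \<open>V\<^sub>\<zeta> \<Turnstile> \<phi>(s, x)\<close>.  The quantified variables are, from the outside, \<open>w = \<omega>\<close>, \<open>\<zeta>\<close>, \<open>V\<^sub>\<zeta>\<close>, \<open>n\<close>,
  \<open>n + 1\<close>, \<open>\<phi>\<close>, and \<open>s\<close>.
\<close>

definition OD_fm :: "nat \<Rightarrow> fm"
  where "OD_fm a =
    \<^bold>\<exists> \<^bold>\<exists> \<^bold>\<exists> \<^bold>\<exists> \<^bold>\<exists> \<^bold>\<exists> \<^bold>\<exists>
      (omega_fm 6 \<^bold>\<and> ordinal_fm 5 \<^bold>\<and> Vset_fm 4 5 \<^bold>\<and> a+7 \<^bold>\<in> 4 \<^bold>\<and>
       3 \<^bold>\<in> 6 \<^bold>\<and> succ_fm 2 3 \<^bold>\<and> formula_fm 6 2 1 \<^bold>\<and> function_fm 0 3 5 \<^bold>\<and>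
       BAll 4 (\<^bold>\<exists> (snoc_fm 0 2 5 1 \<^bold>\<and> sat_fm 8 6 3 0) \<^bold>\<longleftrightarrow> 0 \<^bold>= a+8))"

definition HOD_fm :: "nat \<Rightarrow> fm"
  where "HOD_fm = hereditarily_fm OD_fm"


section \<open>Inner models\<close>

text \<open>
  \<open>T\<close> proves that the class \<open>C\<close> is an inner model of \<open>U\<close>; that \<open>C\<close> satisfies \<open>U\<close> is a scheme,
  with one sentence for every axiom of \<open>U\<close>.
\<close>

definition proves_inner_model :: "fm set \<Rightarrow> (nat \<Rightarrow> fm) \<Rightarrow> fm set \<Rightarrow> bool"
  where "proves_inner_model T C U \<longleftrightarrow>
    (T \<turnstile> \<^bold>\<forall> (C 0 \<^bold>\<longrightarrow> BAll 0 (C 0))) \<and>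
    (T \<turnstile> \<^bold>\<forall> (ordinal_fm 0 \<^bold>\<longrightarrow> C 0)) \<and>
    (\<forall>p\<in>U. T \<turnstile> relativize C p)"

definition subclass_fm :: "(nat \<Rightarrow> fm) \<Rightarrow> (nat \<Rightarrow> fm) \<Rightarrow> fm"
  where "subclass_fm C D = \<^bold>\<forall> (C 0 \<^bold>\<longrightarrow> D 0)"

end

theory Submission
  imports Defs "HOL-Library.Countable_Set"
begin

text \<open>
  By completeness it suffices to argue in an arbitrary model of ZFC.  If \<open>\<psi>(x, \<alpha>)\<close> defines a
  countable set that is not included in \<open>NT\<close> for some ordinal \<open>\<alpha>\<close>, then for the least such
  \<open>\<alpha>\<close> the set is definable without parameters, hence by reflection definable without
  parameters in some \<open>V\<^sub>\<zeta>\<close>, a contradiction.  On the other hand, the union \<open>N\<^sub>\<zeta>\<close> of all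
  countable \<open>\<phi>(V\<^sub>\<zeta>)\<close> is countable, as there are only countably many \<open>\<phi>\<close>, and it is
  definable from \<open>\<zeta>\<close>.  Therefore the image of \<open>N\<^sub>\<zeta> \<times> N\<^sub>\<xi>\<close> under a function that is
  definable without parameters is included in \<open>NT\<close>, i.e. \<open>NT\<close> is closed under all such
  functions.  The axioms of ZF in \<open>HNT\<close> are instances of this closure.  For
  \<open>HOD \<subseteq> HNT\<close>, the finite sequence of ordinal parameters is replaced by the
  lexicographically least one that defines a set outside of \<open>NT\<close>.
\<close>

section \<open>Completeness\<close>

subsection \<open>Renaming and provability\<close>

text \<open>The models in question may be ill-founded, with nonstandard natural numbers. The
  internal formulas over which \<open>NT\<close> ranges may then include nonstandard ones, and
  induction, recursion and comprehension inside a model are available only for definable predicates;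
  this is why side conditions \<open>dfp\<close> and \<open>dfun\<close> accompany so many lemmas.
  Two kinds of definability are kept apart: with arbitrary parameters it yields sets of the model,
  without parameters it yields members of \<open>NT\<close>. Reflection is proved for one formula of
  type \<open>fm\<close> at a time and reaches the internal level through the codes
  \<open>cd\<close> of such formulas. The obstacle to closure is that a member of \<open>NT\<close>
  need not be definable from ordinals: it merely belongs to a countable set that is, and such a set
  need not have a definable enumeration. Arguments therefore cannot be named one by one; whole
  countable sets of possible arguments are mapped at once. For the same reason choice matters,
  although it is not among the axioms verified in \<open>HNT\<close>: it makes a countable union of
  countable sets countable.\<close>

primrec fm_encode :: "fm \<Rightarrow> nat" where
  "fm_encode \<^bold>\<bottom> = prod_encode (0, 0)"
| "fm_encode (i \<^bold>\<in> j) = prod_encode (1, prod_encode (i, j))"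
| "fm_encode (i \<^bold>= j) = prod_encode (2, prod_encode (i, j))"
| "fm_encode (p \<^bold>\<longrightarrow> q) = prod_encode (3, prod_encode (fm_encode p, fm_encode q))"
| "fm_encode (\<^bold>\<forall> p) = prod_encode (4, fm_encode p)"

lemma fm_encode_eq: "fm_encode p = fm_encode q ==> p = q"
proof (induction p arbitrary: q)
  case Fls
  then show ?case by (cases q) auto
next
  case (Mem i j)
  then show ?case by (cases q) auto
next
  case (Equ i j)
  then show ?case by (cases q) auto
next
  case (Imp p1 p2)
  then show ?case by (cases q) auto
next
  case (Forall p)
  then show ?case by (cases q) auto
qed

text \<open>Countability lets the Henkin construction treat one formula per stage, as
  \<open>from_nat n\<close>.\<close>

instance fm :: countable
  by (rule countable_classI[of fm_encode]) (rule fm_encode_eq)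

lemma ren_cong: "(\<And>i. i \<in> fv p ==> f i = g i) ==> ren f p = ren g p"
proof (induction p arbitrary: f g)
  case (Imp p q)
  show ?case using Imp.IH(1)[of f g] Imp.IH(2)[of f g] Imp.prems by simp
next
  case (Forall p)
  have "ren (case_nat 0 (%n. f n + 1)) p = ren (case_nat 0 (%n. g n + 1)) p"
    by (rule Forall.IH) (use Forall.prems in \<open>auto split: nat.splits\<close>)
  then show ?case by simp
qed simp_all

lemma ren_ren: "ren f (ren g p) = ren (%i. f (g i)) p"
proof (induction p arbitrary: f g)
  case (Forall p)
  have "(%i. case_nat 0 (%n. f n + 1) (case_nat 0 (%n. g n + 1) i)) = case_nat 0 (%n. f (g n) + 1)"
    by (rule ext) (simp split: nat.split)
  then show ?case by (simp only: ren.simps Forall)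
qed simp_all

lemma ren_id: "(\<And>i. f i = i) ==> ren f p = p"
proof (induction p arbitrary: f)
  case (Forall p)
  have "ren (case_nat 0 (%n. f n + 1)) p = p"
    by (rule Forall.IH) (simp add: Forall.prems split: nat.split)
  then show ?case by simp
next
  case (Imp p q)
  show ?case using Imp.IH(1)[of f] Imp.IH(2)[of f] Imp.prems by simp
qed simp_all

lemma ren_sentence:
  assumes "fv p = {}"
  shows "ren f p = p"
proof -
  have "ren f p = ren (%i. i) p" by (rule ren_cong) (simp add: assms)
  then show ?thesis by (simp add: ren_id)
qed

lemma finite_fv: "finite (fv p)"
proof (induction p)
  case (Forall p)
  have "fv (\<^bold>\<forall> p) = Suc -` fv p" by auto
  then show ?case using Forall by (simp add: finite_vimageI)
qed auto

lemma ren_inst: "ren f (inst t p) = inst (f t) (ren (case_nat 0 (%n. f n + 1)) p)"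
proof -
  have "f (case_nat t (%n. n) i) = case_nat (f t) (%n. n) (case_nat 0 (%n. f n + 1) i)" for i
    by (cases i) auto
  then show ?thesis unfolding inst_def ren_ren by (intro ren_cong)
qed

text \<open>Holds for every \<open>f\<close>, injective or not: renaming commutes with
  instantiation, and the renaming lifted under a binder commutes with the shift in
  \<open>AllI\<close>. It serves to turn a fresh variable into the index of a bound one.\<close>

lemma proves_ren: "\<Gamma> \<turnstile> p ==> ren f ` \<Gamma> \<turnstile> ren f p"
proof (induction arbitrary: f rule: proves.induct)
  case (Assm p \<Gamma>)
  then show ?case by (simp add: proves.Assm)
next
  case (ImpI p \<Gamma> q)
  show ?case using ImpI.IH[of f] by (simp add: proves.ImpI)
next
  case (ImpE \<Gamma> p q)
  show ?case by (rule proves.ImpE[OF ImpE.IH(1)[of f, unfolded ren.simps] ImpE.IH(2)])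
next
  case (Contr p \<Gamma>)
  show ?case by (rule proves.Contr) (use Contr.IH[of f] in \<open>simp add: Neg_def\<close>)
next
  case (AllI \<Gamma> p)
  have "ren (case_nat 0 (%n. f n + 1)) ` ren (%n. n + 1) ` \<Gamma> = ren (%n. n + 1) ` ren f ` \<Gamma>"
    unfolding image_image ren_ren by simp
  from AllI.IH[of "case_nat 0 (%n. f n + 1)", unfolded this]
  show ?case unfolding ren.simps by (rule proves.AllI)
next
  case (AllE \<Gamma> p t)
  show ?case unfolding ren_inst by (rule proves.AllE[OF AllE.IH[of f, unfolded ren.simps]])
next
  case (EqI \<Gamma> i)
  show ?case by (simp add: proves.EqI)
next
  case (EqE \<Gamma> i j p)
  show ?case unfolding ren_inst
    by (rule proves.EqE[OF EqE.IH(1)[of f, unfolded ren.simps] EqE.IH(2)[of f, unfolded ren_inst]])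
qed

lemma proves_weaken: "\<Gamma> \<turnstile> p ==> \<Gamma> \<subseteq> \<Delta> ==> \<Delta> \<turnstile> p"
proof (induction arbitrary: \<Delta> rule: proves.induct)
  case (ImpI p \<Gamma> q)
  show ?case by (rule proves.ImpI, rule ImpI.IH, rule insert_mono, rule ImpI.prems)
next
  case (Contr p \<Gamma>)
  show ?case by (rule proves.Contr, rule Contr.IH, rule insert_mono, rule Contr.prems)
next
  case (AllI \<Gamma> p)
  show ?case by (rule proves.AllI, rule AllI.IH, rule image_mono, rule AllI.prems)
next
  case (ImpE \<Gamma> p q)
  show ?case by (rule proves.ImpE[OF ImpE.IH]) (rule ImpE.prems)+
next
  case (EqE \<Gamma> i j p)
  show ?case by (rule proves.EqE[OF EqE.IH]) (rule EqE.prems)+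
qed (auto intro: proves.intros)

lemma proves_finite: "\<Gamma> \<turnstile> p ==> EX \<Delta>. finite \<Delta> & \<Delta> \<subseteq> \<Gamma> & (\<Delta> \<turnstile> p)"
proof (induction rule: proves.induct)
  case (Assm p \<Gamma>)
  then show ?case by (intro exI[of _ "{p}"]) (auto intro: proves.Assm)
next
  case (ImpI p \<Gamma> q)
  then obtain \<Delta> where d: "finite \<Delta>" "\<Delta> \<subseteq> insert p \<Gamma>" "\<Delta> \<turnstile> q" by auto
  have "\<Delta> - {p} \<turnstile> p \<^bold>\<longrightarrow> q"
    by (rule proves.ImpI, rule proves_weaken[OF d(3)]) auto
  then show ?case using d(1,2) by (intro exI[of _ "\<Delta> - {p}"]) auto
next
  case (ImpE \<Gamma> p q)
  then obtain \<Delta> \<Delta>' where d: "finite \<Delta>" "\<Delta> \<subseteq> \<Gamma>" "\<Delta> \<turnstile> p \<^bold>\<longrightarrow> q"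
    "finite \<Delta>'" "\<Delta>' \<subseteq> \<Gamma>" "\<Delta>' \<turnstile> p" by auto
  have "\<Delta> \<union> \<Delta>' \<turnstile> q"
    by (rule proves.ImpE[OF proves_weaken[OF d(3)] proves_weaken[OF d(6)]]) auto
  then show ?case using d by (intro exI[of _ "\<Delta> \<union> \<Delta>'"]) auto
next
  case (Contr p \<Gamma>)
  then obtain \<Delta> where d: "finite \<Delta>" "\<Delta> \<subseteq> insert (\<^bold>\<not> p) \<Gamma>" "\<Delta> \<turnstile> \<^bold>\<bottom>" by auto
  have "\<Delta> - {\<^bold>\<not> p} \<turnstile> p"
    by (rule proves.Contr, rule proves_weaken[OF d(3)]) auto
  then show ?case using d(1,2) by (intro exI[of _ "\<Delta> - {\<^bold>\<not> p}"]) auto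
next
  case (AllI \<Gamma> p)
  then obtain \<Delta> where d: "finite \<Delta>" "\<Delta> \<subseteq> ren (%n. n + 1) ` \<Gamma>" "\<Delta> \<turnstile> p" by auto
  obtain \<Delta>' where "\<Delta>' \<subseteq> \<Gamma>" "finite \<Delta>'" "\<Delta> = ren (%n. n + 1) ` \<Delta>'"
    using finite_subset_image[OF d(1,2)] by metis
  then show ?case using d(3) proves.AllI by blast
next
  case (AllE \<Gamma> p t)
  then show ?case by (meson proves.AllE)
next
  case (EqI \<Gamma> i)
  show ?case by (intro exI[of _ "{}"]) (auto intro: proves.EqI)
next
  case (EqE \<Gamma> i j p)
  then obtain \<Delta> \<Delta>' where d: "finite \<Delta>" "\<Delta> \<subseteq> \<Gamma>" "\<Delta> \<turnstile> i \<^bold>= j"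
    "finite \<Delta>'" "\<Delta>' \<subseteq> \<Gamma>" "\<Delta>' \<turnstile> inst i p" by auto
  have "\<Delta> \<union> \<Delta>' \<turnstile> inst j p"
    by (rule proves.EqE[OF proves_weaken[OF d(3)] proves_weaken[OF d(6)]]) auto
  then show ?case using d by (intro exI[of _ "\<Delta> \<union> \<Delta>'"]) auto
qed

lemma proves_cut: "insert p \<Gamma> \<turnstile> q ==> \<Gamma> \<turnstile> p ==> \<Gamma> \<turnstile> q"
  by (rule proves.ImpE[OF proves.ImpI])

section \<open>Consistent sets of formulas\<close>

definition consistent :: "fm set \<Rightarrow> bool"
  where "consistent \<Gamma> \<longleftrightarrow> \<not> (\<Gamma> \<turnstile> \<^bold>\<bottom>)"

lemma consistent_mono: "consistent \<Delta> ==> \<Gamma> \<subseteq> \<Delta> ==> consistent \<Gamma>"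
  unfolding consistent_def using proves_weaken[of \<Gamma> "\<^bold>\<bottom>" \<Delta>] by metis

text \<open>A proof of \<open>inst t p\<close> with \<open>t\<close> fresh proves the universal
  statement: the renaming that sends \<open>t\<close> to 0 and shifts every other variable maps
  \<open>inst t p\<close> back to \<open>p\<close> and acts on \<Gamma> as the plain shift, so
  \<open>AllI\<close> applies.\<close>

lemma consistent_witness:
  assumes con: "consistent \<Gamma>" and all: "\<^bold>\<not> \<^bold>\<forall> p \<in> \<Gamma>" and fresh: "\<And>q. q \<in> \<Gamma> ==> t \<notin> fv q"
  shows "consistent (insert (\<^bold>\<not> inst t p) \<Gamma>)"
proof (rule ccontr)
  assume "\<not> ?thesis"
  then have t: "\<Gamma> \<turnstile> inst t p"
    unfolding consistent_def not_not by (rule proves.Contr)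
  define f where "f = (%n. if n = t then 0 else n + 1)"
  have tp: "Suc t \<notin> fv p" using fresh[OF all] by (auto simp: Neg_def)
  have "ren f (inst t p) = ren (%i. i) p"
    unfolding inst_def ren_ren f_def by (rule ren_cong) (use tp in \<open>auto split: nat.splits\<close>)
  then have "ren f (inst t p) = p" by (simp add: ren_id)
  moreover have "ren f ` \<Gamma> = ren (%n. n + 1) ` \<Gamma>"
    by (rule image_cong[OF refl], rule ren_cong) (use fresh in \<open>auto simp: f_def\<close>)
  ultimately have "ren (%n. n + 1) ` \<Gamma> \<turnstile> p" using proves_ren[OF t, of f] by (simp only:)
  then have "\<Gamma> \<turnstile> \<^bold>\<forall> p" by (rule proves.AllI)
  moreover have "\<Gamma> \<turnstile> \<^bold>\<not> \<^bold>\<forall> p" using all by (rule proves.Assm)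
  ultimately show False using con proves.ImpE[of \<Gamma> "\<^bold>\<forall> p" "\<^bold>\<bottom>"] unfolding consistent_def Neg_def by (simp only: simp_thms)
qed

subsection \<open>Satisfaction\<close>

text \<open>
  Equality is interpreted by an arbitrary relation \<open>Q\<close> at first, since the structure obtained
  from the Henkin construction must still be divided by provable equality.
\<close>

primrec holdsQ :: "('a \<Rightarrow> 'a \<Rightarrow> bool) \<Rightarrow> ('a \<Rightarrow> 'a \<Rightarrow> bool) \<Rightarrow> (nat \<Rightarrow> 'a) \<Rightarrow> fm \<Rightarrow> bool" where
  "holdsQ Q E e \<^bold>\<bottom> = False"
| "holdsQ Q E e (i \<^bold>\<in> j) = E (e i) (e j)"
| "holdsQ Q E e (i \<^bold>= j) = Q (e i) (e j)"
| "holdsQ Q E e (p \<^bold>\<longrightarrow> q) = (holdsQ Q E e p --> holdsQ Q E e q)"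
| "holdsQ Q E e (\<^bold>\<forall> p) = (ALL x. holdsQ Q E (case_nat x e) p)"

lemma holdsQ_quotient:
  fixes g :: "'a \<Rightarrow> 'b"
  assumes "surj g" "\<And>x y. Q' (g x) (g y) \<longleftrightarrow> Q x y" "\<And>x y. E' (g x) (g y) \<longleftrightarrow> E x y"
  shows "holdsQ Q' E' (%i. g (e i)) p \<longleftrightarrow> holdsQ Q E e p"
proof (induction p arbitrary: e)
  case (Forall p)
  have "(case_nat (g x) (%i. g (e i))) = (%i. g (case_nat x e i))" for x
    by (auto split: nat.splits)
  then have "holdsQ Q' E' (case_nat (g x) (%i. g (e i))) p \<longleftrightarrow> holdsQ Q E (case_nat x e) p" for x
    using Forall by simp
  then show ?case using \<open>surj g\<close> by (simp, metis surjD)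
qed (use assms in auto)

subsection \<open>The Henkin construction\<close>

text \<open>
  A theory of sentences contains no variables, so that the variables themselves can serve as
  the Henkin constants.
\<close>

locale henkin =
  fixes \<Gamma> :: "fm set" and q0 :: fm
  assumes sentences: "p \<in> \<Gamma> ==> fv p = {}"
    and con0: "consistent (insert q0 \<Gamma>)"
begin

definition fresh :: "fm set \<Rightarrow> nat"
  where "fresh \<Delta> = (SOME t. \<forall>q\<in>\<Delta>. t \<notin> fv q)"

lemma fresh: "finite \<Delta> ==> q \<in> \<Delta> ==> fresh \<Delta> \<notin> fv q"
proof -
  assume "finite \<Delta>" "q \<in> \<Delta>"
  then have "finite (\<Union>q\<in>\<Delta>. fv q)" using finite_fv by auto
  then obtain t where "t \<notin> (\<Union>q\<in>\<Delta>. fv q)" using ex_new_if_finite infinite_UNIV_nat by blast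
  then have "EX t. \<forall>q\<in>\<Delta>. t \<notin> fv q" by auto
  then have "\<forall>q\<in>\<Delta>. fresh \<Delta> \<notin> fv q" unfolding fresh_def by (rule someI_ex)
  then show ?thesis using \<open>q \<in> \<Delta>\<close> by blast
qed

definition witness :: "fm \<Rightarrow> fm set \<Rightarrow> fm set"
  where "witness p \<Delta> = {\<^bold>\<not> inst (fresh (insert p \<Delta>)) r | r. p = \<^bold>\<not> \<^bold>\<forall> r}"

text \<open>A formula that would be inconsistent is simply skipped. Its negation is then derivable
  from the limit \<open>H\<close>, hence a member of \<open>H\<close> by
  \<open>H_closed\<close>.\<close>

primrec chain :: "nat \<Rightarrow> fm set" where
  "chain 0 = {q0}"
| "chain (Suc n) = (let p = from_nat n in
     if consistent (insert p (chain n \<union> \<Gamma>)) then insert p (chain n) \<union> witness p (chain n)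
     else chain n)"

lemma witness_cases:
  obtains "witness p \<Delta> = {}" "\<nexists>r. p = \<^bold>\<not> \<^bold>\<forall> r"
  | r where "p = \<^bold>\<not> \<^bold>\<forall> r" "witness p \<Delta> = {\<^bold>\<not> inst (fresh (insert p \<Delta>)) r}"
  unfolding witness_def by (auto simp: Neg_def)

lemma finite_chain: "finite (chain n)"
proof (induction n)
  case (Suc n)
  have "finite (witness p \<Delta>)" for p \<Delta> by (rule witness_cases[of p \<Delta>]) auto
  then show ?case using Suc by (simp add: Let_def)
qed simp

lemma consistent_chain: "consistent (chain n \<union> \<Gamma>)"
proof (induction n)
  case 0
  then show ?case using con0 by simp
next
  case (Suc n)
  define p :: fm where "p = from_nat n"
  show ?case
  proof (cases "consistent (insert p (chain n \<union> \<Gamma>))")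
    case True
    show ?thesis
    proof (rule witness_cases[of p "chain n"])
      assume "witness p (chain n) = {}"
      then show ?thesis using True by (simp add: p_def[symmetric])
    next
      fix r assume r: "p = \<^bold>\<not> \<^bold>\<forall> r" "witness p (chain n) = {\<^bold>\<not> inst (fresh (insert p (chain n))) r}"
      have "fresh (insert p (chain n)) \<notin> fv q" if "q \<in> insert p (chain n \<union> \<Gamma>)" for q
        using that fresh[of "insert p (chain n)" q] finite_chain sentences by auto
      from consistent_witness[OF True _ this, of r] r(1)
      have "consistent (insert (\<^bold>\<not> inst (fresh (insert p (chain n))) r) (insert p (chain n \<union> \<Gamma>)))"
        by auto
      then show ?thesis using True r by (simp add: p_def[symmetric] Let_def)
    qed
  next
    case False
    then show ?thesis using Suc by (simp add: p_def[symmetric])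
  qed
qed

definition H :: "fm set"
  where "H = (\<Union>n. chain n) \<union> \<Gamma>"

lemma chain_mono: "m \<le> n ==> chain m \<subseteq> chain n"
proof (rule lift_Suc_mono_le[of chain])
  show "chain n \<subseteq> chain (Suc n)" for n unfolding chain.simps Let_def by auto
qed

lemma consistent_H: "consistent H"
proof (rule ccontr)
  assume "\<not> consistent H"
  then obtain \<Delta> where \<Delta>: "finite \<Delta>" "\<Delta> \<subseteq> H" "\<Delta> \<turnstile> \<^bold>\<bottom>"
    unfolding consistent_def using proves_finite by blast
  have "EX n. \<Delta> \<subseteq> chain n \<union> \<Gamma>" using \<Delta>(1,2)
  proof (induction \<Delta>)
    case (insert p \<Delta>)
    then obtain n m where "\<Delta> \<subseteq> chain n \<union> \<Gamma>" "p \<in> chain m \<union> \<Gamma>" unfolding H_def by auto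
    then have "insert p \<Delta> \<subseteq> chain (max m n) \<union> \<Gamma>"
      using chain_mono[of m "max m n"] chain_mono[of n "max m n"] by auto
    then show ?case by blast
  qed auto
  then obtain n where "\<Delta> \<subseteq> chain n \<union> \<Gamma>" ..
  from proves_weaken[OF \<Delta>(3) this] show False using consistent_chain unfolding consistent_def by simp
qed

text \<open>Consistency with all of \<open>H\<close> implies consistency with stage
  \<open>to_nat p\<close>, so \<open>p\<close> was accepted there together with its witness.\<close>

lemma H_step:
  assumes "consistent (insert p H)"
  shows "p \<in> H" "EX \<Delta>. witness p \<Delta> \<subseteq> H"
proof -
  let ?n = "to_nat p"
  have "insert p (chain ?n \<union> \<Gamma>) \<subseteq> insert p H" unfolding H_def by blast
  with assms have "consistent (insert p (chain ?n \<union> \<Gamma>))" by (rule consistent_mono)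
  then have "chain (Suc ?n) = insert p (chain ?n) \<union> witness p (chain ?n)" by (simp add: Let_def)
  moreover have "chain (Suc ?n) \<subseteq> H" unfolding H_def by (rule le_supI1) (rule UN_upper, rule UNIV_I)
  ultimately have "insert p (chain ?n) \<union> witness p (chain ?n) \<subseteq> H" by (simp only:)
  then show "p \<in> H" "EX \<Delta>. witness p \<Delta> \<subseteq> H" by auto
qed

lemma H_closed:
  assumes "H \<turnstile> p"
  shows "p \<in> H"
proof (rule H_step(1), unfold consistent_def, rule notI)
  assume "insert p H \<turnstile> \<^bold>\<bottom>"
  then have "H \<turnstile> \<^bold>\<bottom>" using assms by (rule proves_cut)
  then show False using consistent_H by (simp add: consistent_def)
qed

lemma H_fls: "\<^bold>\<bottom> \<notin> H"
  using consistent_H proves.Assm[of "\<^bold>\<bottom>" H] unfolding consistent_def by auto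

lemma H_mp: "(p \<^bold>\<longrightarrow> q) \<in> H ==> p \<in> H ==> q \<in> H"
  by (rule H_closed, rule proves.ImpE[OF proves.Assm proves.Assm])

lemma H_impI: "(insert p H \<turnstile> q) ==> (p \<^bold>\<longrightarrow> q) \<in> H"
  by (rule H_closed, rule proves.ImpI)

lemma H_neg: "\<^bold>\<not> p \<in> H \<longleftrightarrow> p \<notin> H"
proof
  show "p \<notin> H" if "\<^bold>\<not> p \<in> H"
    using that H_mp[of p "\<^bold>\<bottom>"] H_fls unfolding Neg_def by auto
  show "\<^bold>\<not> p \<in> H" if "p \<notin> H"
    using that H_step[of p] H_impI[of p "\<^bold>\<bottom>"] unfolding consistent_def Neg_def by auto
qed

lemma H_imp: "(p \<^bold>\<longrightarrow> q) \<in> H \<longleftrightarrow> (p \<in> H --> q \<in> H)"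
proof
  show "p \<in> H --> q \<in> H" if "(p \<^bold>\<longrightarrow> q) \<in> H"
    using that H_mp by simp
  show "(p \<^bold>\<longrightarrow> q) \<in> H" if "p \<in> H --> q \<in> H"
  proof (cases "p \<in> H")
    case True
    with that have "q \<in> insert p H" by simp
    then show ?thesis by (intro H_impI proves.Assm)
  next
    case False
    then have n: "\<^bold>\<not> p \<in> insert (\<^bold>\<not> q) (insert p H)" using H_neg by simp
    have "insert (\<^bold>\<not> q) (insert p H) \<turnstile> \<^bold>\<bottom>"
      by (rule proves.ImpE[OF proves.Assm[OF n[unfolded Neg_def[of p]]] proves.Assm]) simp
    then show ?thesis by (rule H_impI[OF proves.Contr])
  qed
qed

lemma H_all: "\<^bold>\<forall> p \<in> H \<longleftrightarrow> (ALL t. inst t p \<in> H)"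
proof
  show "ALL t. inst t p \<in> H" if "\<^bold>\<forall> p \<in> H"
    using H_closed[OF proves.AllE[OF proves.Assm[OF that]]] by simp
  show "\<^bold>\<forall> p \<in> H" if a: "ALL t. inst t p \<in> H"
  proof (rule ccontr)
    assume "\<^bold>\<forall> p \<notin> H"
    then have n: "\<^bold>\<not> \<^bold>\<forall> p \<in> H" using H_neg by blast
    then have "consistent (insert (\<^bold>\<not> \<^bold>\<forall> p) H)" using consistent_H by (simp add: insert_absorb)
    then obtain \<Delta> where "witness (\<^bold>\<not> \<^bold>\<forall> p) \<Delta> \<subseteq> H" using H_step by blast
    then have "\<^bold>\<not> inst (fresh (insert (\<^bold>\<not> \<^bold>\<forall> p) \<Delta>)) p \<in> H" unfolding witness_def by auto
    then show False using a H_neg by blast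
  qed
qed

text \<open>The truth lemma. The elements are variables, so an assignment is itself a renaming, and
  satisfaction becomes membership of the renamed formula.\<close>

lemma holdsQ_H: "holdsQ (%i j. (i \<^bold>= j) \<in> H) (%i j. (i \<^bold>\<in> j) \<in> H) e p \<longleftrightarrow> ren e p \<in> H"
proof (induction p arbitrary: e)
  case (Forall p)
  have "inst t (ren (case_nat 0 (%n. e n + 1)) p) = ren (case_nat t e) p" for t
    unfolding inst_def ren_ren by (rule ren_cong) (auto split: nat.splits)
  then show ?case by (simp only: holdsQ.simps ren.simps H_all Forall)
next
  case (Imp p q)
  then show ?case by (simp only: holdsQ.simps ren.simps H_imp)
qed (use H_fls in simp_all)

definition cls :: "nat \<Rightarrow> nat set"
  where "cls i = {j. (i \<^bold>= j) \<in> H}"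

lemma H_eq_subst: "(i \<^bold>= j) \<in> H ==> inst i p \<in> H ==> inst j p \<in> H"
  by (rule H_closed, rule proves.EqE[OF proves.Assm proves.Assm])

lemma H_refl: "(i \<^bold>= i) \<in> H"
  by (rule H_closed, rule proves.EqI)

lemma H_sym: "(i \<^bold>= j) \<in> H ==> (j \<^bold>= i) \<in> H"
  using H_eq_subst[of i j "0 \<^bold>= Suc i"] H_refl by (auto simp: inst_def)

lemma H_trans: "(i \<^bold>= j) \<in> H ==> (j \<^bold>= k) \<in> H ==> (i \<^bold>= k) \<in> H"
  using H_eq_subst[of j k "Suc i \<^bold>= 0"] by (auto simp: inst_def)

lemma H_mem1: "(i \<^bold>= j) \<in> H ==> (i \<^bold>\<in> k) \<in> H ==> (j \<^bold>\<in> k) \<in> H"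
  using H_eq_subst[of i j "0 \<^bold>\<in> Suc k"] by (auto simp: inst_def)

lemma H_mem2: "(i \<^bold>= j) \<in> H ==> (k \<^bold>\<in> i) \<in> H ==> (k \<^bold>\<in> j) \<in> H"
  using H_eq_subst[of i j "Suc k \<^bold>\<in> 0"] by (auto simp: inst_def)

lemma cls_eq: "cls i = cls j \<longleftrightarrow> (i \<^bold>= j) \<in> H"
proof
  show "(i \<^bold>= j) \<in> H" if "cls i = cls j"
    using that H_refl[of j] unfolding cls_def by (metis mem_Collect_eq)
  show "cls i = cls j" if "(i \<^bold>= j) \<in> H"
    using H_trans[OF that] H_trans[OF H_sym[OF that]] unfolding cls_def by (intro Collect_cong iffI)
qed

text \<open>Forming singletons is injective on the classes and never yields the class of an empty
  set, so the quotient is Dedekind-infinite.\<close>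

lemma infinite_cls:
  assumes ext: "extensionality_ax \<in> \<Gamma>" and pair: "pairing_ax \<in> \<Gamma>" and inf: "infinity_ax \<in> \<Gamma>"
  shows "infinite (range cls)"
proof -
  have ax: "holdsQ (%i j. (i \<^bold>= j) \<in> H) (%i j. (i \<^bold>\<in> j) \<in> H) e p" if "p \<in> \<Gamma>" for p e
    using that sentences[OF that] unfolding holdsQ_H by (simp add: ren_sentence H_def)
  define sing where "sing i s \<longleftrightarrow> (ALL z. (z \<^bold>\<in> s) \<in> H \<longleftrightarrow> (z \<^bold>= i) \<in> H)" for i s
  have "EX s. sing i s" for i
  proof -
    have "ALL x y. EX s. ALL z. ((z \<^bold>\<in> s) \<in> H --> (z \<^bold>= x) \<in> H \<or> (z \<^bold>= y) \<in> H) &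
        ((z \<^bold>= x) \<notin> H & (z \<^bold>= y) \<notin> H \<or> (z \<^bold>\<in> s) \<in> H)"
      using ax[OF pair, of "%_. 0"] unfolding pairing_ax_def upair_fm_def
      by (simp add: Exists_def Neg_def Iff_def Conj_def Disj_def eval_nat_numeral)
    from this[rule_format, of i i] show ?thesis unfolding sing_def by auto
  qed
  then obtain s where s: "\<And>i. sing i (s i)" by metis
  obtain o0 where o0: "\<And>z. (z \<^bold>\<in> o0) \<notin> H"
    using ax[OF inf, of "%_. 0"] unfolding infinity_ax_def inductive_fm_def BEx_def empty_fm_def
    by (auto simp: Exists_def Neg_def Conj_def)
  have inj_s: "cls i = cls j" if "cls (s i) = cls (s j)" for i j
  proof -
    have "(i \<^bold>\<in> s i) \<in> H" using s[of i] H_refl[of i] unfolding sing_def by simp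
    with that[unfolded cls_eq] have "(i \<^bold>\<in> s j) \<in> H" by (rule H_mem2)
    then show ?thesis using s[of j] unfolding sing_def cls_eq by simp
  qed
  have not_o0: "cls o0 \<noteq> cls (s j)" for j
  proof
    assume "cls o0 = cls (s j)"
    then have "(s j \<^bold>= o0) \<in> H" unfolding cls_eq by (rule H_sym)
    moreover have "(j \<^bold>\<in> s j) \<in> H" using s[of j] H_refl[of j] unfolding sing_def by simp
    ultimately have "(j \<^bold>\<in> o0) \<in> H" by (rule H_mem2)
    then show False using o0 by simp
  qed
  \<comment> \<open>Chosen representatives make \<open>S\<close> a function of classes, whether or
    not \<open>s\<close> respects provable equality.\<close>
  define r where "r x = (SOME i. cls i = x)" for x
  have r: "cls (r (cls i)) = cls i" for i unfolding r_def by (rule someI) simp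
  define S where "S x = cls (s (r x))" for x
  have "inj_on S (range cls)"
  proof (rule inj_onI)
    fix x y assume xy: "x \<in> range cls" "y \<in> range cls" "S x = S y"
    then obtain i j where "x = cls i" "y = cls j" by auto
    then show "x = y" using inj_s[of "r x" "r y"] xy(3) r unfolding S_def by simp
  qed
  moreover have "S ` range cls \<subseteq> range cls" unfolding S_def by auto
  moreover have "S ` range cls \<noteq> range cls"
  proof -
    have "cls o0 \<notin> S ` range cls" unfolding S_def using not_o0 by auto
    then show ?thesis by auto
  qed
  ultimately show ?thesis using endo_inj_surj[of "range cls" S] by metis
qed

text \<open>The countable quotient is moved along a bijection onto \<open>nat\<close>, so that the
  validity hypothesis of \<open>completeness\<close> can be stated for structures over a single
  fixed type.\<close>

lemma model_over_nat:
  assumes "infinite (range cls)"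
  obtains E :: "nat \<Rightarrow> nat \<Rightarrow> bool" and g
  where "\<And>e p. holdsQ (=) E (%i. g (e i)) p \<longleftrightarrow> ren e p \<in> H"
proof -
  define g where "g i = to_nat_on (range cls) (cls i)" for i
  have bij: "bij_betw (to_nat_on (range cls)) (range cls) UNIV"
    using assms by (intro to_nat_on_infinite) auto
  then have surj: "surj g" unfolding g_def bij_betw_def by (simp add: image_image)
  have eq: "g i = g j \<longleftrightarrow> (i \<^bold>= j) \<in> H" for i j
    using bij unfolding g_def bij_betw_def inj_on_def cls_eq[symmetric] by auto
  define E where "E x y \<longleftrightarrow> (EX i j. x = g i & y = g j & (i \<^bold>\<in> j) \<in> H)" for x y
  have "E (g i) (g j) \<longleftrightarrow> (i \<^bold>\<in> j) \<in> H" for i j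
  proof
    show "E (g i) (g j)" if "(i \<^bold>\<in> j) \<in> H" using that unfolding E_def by auto
    show "(i \<^bold>\<in> j) \<in> H" if "E (g i) (g j)"
    proof -
      have "EX k l. (i \<^bold>= k) \<in> H & (j \<^bold>= l) \<in> H & (k \<^bold>\<in> l) \<in> H"
        using that unfolding E_def eq .
      then obtain k l where "(i \<^bold>= k) \<in> H" "(j \<^bold>= l) \<in> H" "(k \<^bold>\<in> l) \<in> H" by (elim exE conjE)
      then show ?thesis using H_mem1[OF H_sym] H_mem2[OF H_sym] by metis
    qed
  qed
  from holdsQ_quotient[where g = g and Q' = "(=)" and Q = "%i j. (i \<^bold>= j) \<in> H" and
        E' = E and E = "%i j. (i \<^bold>\<in> j) \<in> H", OF surj eq this]
  have "holdsQ (=) E (%i. g (e i)) p \<longleftrightarrow> ren e p \<in> H" for e p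
    unfolding holdsQ_H by blast
  then show thesis by (rule that)
qed

end

section \<open>Satisfaction in a structure and relative to a class\<close>

primrec holds :: "('a \<Rightarrow> 'a \<Rightarrow> bool) \<Rightarrow> (nat \<Rightarrow> 'a) \<Rightarrow> fm \<Rightarrow> bool" where
  "holds E e \<^bold>\<bottom> = False"
| "holds E e (i \<^bold>\<in> j) = E (e i) (e j)"
| "holds E e (i \<^bold>= j) = (e i = e j)"
| "holds E e (p \<^bold>\<longrightarrow> q) = (holds E e p --> holds E e q)"
| "holds E e (\<^bold>\<forall> p) = (ALL x. holds E (case_nat x e) p)"

lemma holdsQ_eq: "holdsQ (=) E e p \<longleftrightarrow> holds E e p"
  by (induction p arbitrary: e) auto

text \<open>Serves two purposes: with \<open>D\<close> membership in a level \<open>V z\<close> it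
  is the external counterpart of internal satisfaction, and with \<open>D\<close> the class
  \<open>HNT\<close> it is the meaning of \<open>relativize\<close>.\<close>

primrec holdsR :: "('a \<Rightarrow> bool) \<Rightarrow> ('a \<Rightarrow> 'a \<Rightarrow> bool) \<Rightarrow> (nat \<Rightarrow> 'a) \<Rightarrow> fm \<Rightarrow> bool" where
  "holdsR D E e \<^bold>\<bottom> = False"
| "holdsR D E e (i \<^bold>\<in> j) = E (e i) (e j)"
| "holdsR D E e (i \<^bold>= j) = (e i = e j)"
| "holdsR D E e (p \<^bold>\<longrightarrow> q) = (holdsR D E e p --> holdsR D E e q)"
| "holdsR D E e (\<^bold>\<forall> p) = (ALL x. D x --> holdsR D E (case_nat x e) p)"

lemma holdsR_cong: "(\<And>i. i \<in> fv p ==> e i = e' i) ==> holdsR D E e p = holdsR D E e' p"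
proof (induction p arbitrary: e e')
  case (Forall p)
  have "holdsR D E (case_nat x e) p = holdsR D E (case_nat x e') p" for x
    by (rule Forall.IH) (use Forall.prems in \<open>auto split: nat.splits\<close>)
  then show ?case by simp
next
  case (Imp p q)
  show ?case using Imp.IH(1)[of e e'] Imp.IH(2)[of e e'] Imp.prems by simp
qed simp_all

lemma holdsR_ren: "holdsR D E e (ren r p) = holdsR D E (%i. e (r i)) p"
proof (induction p arbitrary: e r)
  case (Forall p)
  have "(%i. (case_nat x e) (case_nat 0 (%n. r n + 1) i)) = case_nat x (%i. e (r i))" for x
    by (rule ext) (simp split: nat.split)
  then show ?case by (simp only: ren.simps holdsR.simps Forall)
qed simp_all

lemma holdsR_connectives [simp]:
  "holdsR D E e (\<^bold>\<not> p) = (\<not> holdsR D E e p)"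
  "holdsR D E e (p \<^bold>\<and> q) = (holdsR D E e p & holdsR D E e q)"
  "holdsR D E e (p \<^bold>\<or> q) = (holdsR D E e p \<or> holdsR D E e q)"
  "holdsR D E e (p \<^bold>\<longleftrightarrow> q) = (holdsR D E e p = holdsR D E e q)"
  "holdsR D E e (\<^bold>\<exists> p) = (EX x. D x & holdsR D E (case_nat x e) p)"
  "holdsR D E e (BAll i p) = (ALL x. D x --> E x (e i) --> holdsR D E (case_nat x e) p)"
  "holdsR D E e (BEx i p) = (EX x. D x & E x (e i) & holdsR D E (case_nat x e) p)"
  by (auto simp: Neg_def Conj_def Disj_def Iff_def Exists_def BAll_def BEx_def)

lemma holds_holdsR: "holds E e p = holdsR (%_. True) E e p"
  by (induction p arbitrary: e) simp_all

lemma holds_cong: "(\<And>i. i \<in> fv p ==> e i = e' i) ==> holds E e p = holds E e' p"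
  unfolding holds_holdsR by (rule holdsR_cong)

lemma holds_ren: "holds E e (ren r p) = holds E (%i. e (r i)) p"
  unfolding holds_holdsR by (rule holdsR_ren)

lemma holds_connectives [simp]:
  "holds E e (\<^bold>\<not> p) = (\<not> holds E e p)"
  "holds E e (p \<^bold>\<and> q) = (holds E e p & holds E e q)"
  "holds E e (p \<^bold>\<or> q) = (holds E e p \<or> holds E e q)"
  "holds E e (p \<^bold>\<longleftrightarrow> q) = (holds E e p = holds E e q)"
  "holds E e (\<^bold>\<exists> p) = (EX x. holds E (case_nat x e) p)"
  "holds E e (BAll i p) = (ALL x. E x (e i) --> holds E (case_nat x e) p)"
  "holds E e (BEx i p) = (EX x. E x (e i) & holds E (case_nat x e) p)"
  unfolding holds_holdsR by simp_all

theorem completeness: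
  assumes sentences: "\<And>p. p \<in> \<Gamma> ==> fv p = {}"
    and ax: "{extensionality_ax, pairing_ax, infinity_ax} \<subseteq> \<Gamma>"
    and valid: "\<And>(E :: nat \<Rightarrow> nat \<Rightarrow> bool) e. (\<And>p e. p \<in> \<Gamma> ==> holds E e p) ==> holds E e q"
  shows "\<Gamma> \<turnstile> q"
proof (rule ccontr)
  assume n: "\<not> (\<Gamma> \<turnstile> q)"
  have "consistent (insert (\<^bold>\<not> q) \<Gamma>)"
    unfolding consistent_def by (rule notI, rule notE[OF n], rule proves.Contr)
  then interpret henkin \<Gamma> "\<^bold>\<not> q" using sentences by unfold_locales
  have "infinite (range cls)" using ax by (intro infinite_cls) auto
  then obtain E :: "nat \<Rightarrow> nat \<Rightarrow> bool" and g where
    E: "\<And>e p. holdsQ (=) E (%i. g (e i)) p \<longleftrightarrow> ren e p \<in> H" by (rule model_over_nat) blast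
  have g: "holds E g p \<longleftrightarrow> p \<in> H" for p
    using E[of "%i. i" p] by (simp add: holdsQ_eq ren_id)
  have "holds E e p" if "p \<in> \<Gamma>" for e p
    using that g[of p] holds_cong[of p e g E] sentences[OF that] by (simp add: H_def)
  then have "holds E g q" by (rule valid)
  then have "q \<in> H" by (simp add: g)
  moreover have "\<^bold>\<not> q \<in> chain 0" by simp
  then have "\<^bold>\<not> q \<in> H" unfolding H_def by blast
  ultimately show False using H_neg by blast
qed

section \<open>Models of ZFC\<close>

abbreviation push :: "'a \<Rightarrow> (nat \<Rightarrow> 'a) \<Rightarrow> nat \<Rightarrow> 'a"  (infixr "##" 65)
  where "x ## e \<equiv> case_nat x e"

lemma push_shift: "e 0 ## (%n. e (Suc n)) = e"
  by (rule ext) (simp split: nat.split)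

lemma fv_Foralls: "fv ((Forall ^^ n) p) = {i. i + n \<in> fv p}"
proof (induction n)
  case (Suc n)
  then show ?case by (simp add: Suc_eq_plus1[symmetric])
qed simp

lemma ex_universal_closure: "EX n. (Forall ^^ n) p \<in> universal_closures p"
proof -
  obtain m where m: "\<And>i. i \<in> fv p ==> i < m"
    using finite_fv[of p] by (metis finite_nat_set_iff_bounded)
  have "fv ((Forall ^^ m) p) = {}" unfolding fv_Foralls using m by force
  then show ?thesis unfolding universal_closures_def by blast
qed

lemma holds_Foralls: "(\<And>e. holds E e ((Forall ^^ n) p)) ==> holds E e p"
proof (induction n arbitrary: e)
  case (Suc n)
  have "holds E e ((Forall ^^ n) p)" for e
    using Suc.prems[of "%n. e (Suc n)"] push_shift[of e] by (simp, metis)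
  then show ?case by (rule Suc.IH)
qed simp

locale zfc_model =
  fixes E :: "'a \<Rightarrow> 'a \<Rightarrow> bool"  (infix "\<E>" 50)
  assumes model: "p \<in> ZFC ==> holds E e p"
begin

lemma extensional: "(\<And>z. z \<E> x \<longleftrightarrow> z \<E> y) ==> x = y"
proof -
  have "holds E e extensionality_ax" for e by (rule model) (simp add: ZFC_def ZF_def)
  then show "(\<And>z. z \<E> x \<longleftrightarrow> z \<E> y) ==> x = y"
    unfolding extensionality_ax_def by (simp add: numeral_eq_Suc)
qed

lemma ax_pairing: "EX z. ALL w. w \<E> z \<longleftrightarrow> w = x \<or> w = y"
proof -
  have "holds E e pairing_ax" for e by (rule model) (simp add: ZFC_def ZF_def)
  then show ?thesis unfolding pairing_ax_def upair_fm_def by (simp add: numeral_eq_Suc)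
qed

lemma ax_union: "EX z. ALL w. w \<E> z \<longleftrightarrow> (EX y. y \<E> x & w \<E> y)"
proof -
  have "holds E e union_ax" for e by (rule model) (simp add: ZFC_def ZF_def)
  then show ?thesis unfolding union_ax_def by (simp add: numeral_eq_Suc)
qed

lemma ax_power: "EX z. ALL w. w \<E> z \<longleftrightarrow> (ALL y. y \<E> w --> y \<E> x)"
proof -
  have "holds E e power_set_ax" for e by (rule model) (simp add: ZFC_def ZF_def)
  then show ?thesis unfolding power_set_ax_def sub_fm_def by (simp add: numeral_eq_Suc)
qed

lemma ax_infinity: "EX w. (EX z. z \<E> w & (ALL x. \<not> x \<E> z)) &
    (ALL y. y \<E> w --> (EX s. s \<E> w & (ALL v. v \<E> s \<longleftrightarrow> v \<E> y \<or> v = y)))"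
proof -
  have "holds E e infinity_ax" for e by (rule model) (simp add: ZFC_def ZF_def)
  then show ?thesis unfolding infinity_ax_def inductive_fm_def empty_fm_def succ_fm_def
    by (simp add: numeral_eq_Suc)
qed

lemma ax_regularity: "y \<E> x ==> EX y. y \<E> x & (ALL z. z \<E> y --> \<not> z \<E> x)"
proof -
  have "holds E e regularity_ax" for e by (rule model) (simp add: ZFC_def ZF_def)
  then show "y \<E> x ==> ?thesis" unfolding regularity_ax_def by (simp add: numeral_eq_Suc) metis
qed

lemma ax_separation: "EX b. ALL x. x \<E> b \<longleftrightarrow> x \<E> a & holds E (x ## e) p"
proof -
  obtain n where "(Forall ^^ n) (separation_fm p) \<in> universal_closures (separation_fm p)"
    using ex_universal_closure by blast
  then have "(Forall ^^ n) (separation_fm p) \<in> ZFC" unfolding ZFC_def ZF_def by blast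
  then have "holds E e (separation_fm p)" by (rule holds_Foralls[OF model])
  moreover have "holds E (x ## b ## a ## e) (ren (case_nat 0 (%k. k + 3)) p) = holds E (x ## e) p" for x b a
    unfolding holds_ren
    by (rule arg_cong[where f = "%e. holds E e p"], rule ext) (simp add: numeral_eq_Suc split: nat.split)
  ultimately show ?thesis unfolding separation_fm_def by simp
qed

lemma ax_replacement:
  assumes "\<And>x y z. holds E (x ## y ## e) p ==> holds E (x ## z ## e) p ==> y = z"
  shows "EX b. ALL y. y \<E> b \<longleftrightarrow> (EX x. x \<E> a & holds E (x ## y ## e) p)"
proof -
  obtain n where "(Forall ^^ n) (replacement_fm p) \<in> universal_closures (replacement_fm p)"
    using ex_universal_closure by blast
  then have "(Forall ^^ n) (replacement_fm p) \<in> ZFC" unfolding ZFC_def ZF_def by blast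
  then have "holds E e (replacement_fm p)" by (rule holds_Foralls[OF model])
  moreover have "holds E (z ## y ## x ## e) (ren (case_nat 2 (case_nat 1 (%k. k + 3))) p) = holds E (x ## y ## e) p"
    "holds E (z ## y ## x ## e) (ren (case_nat 2 (case_nat 0 (%k. k + 3))) p) = holds E (x ## z ## e) p"
    "holds E (x ## y ## b ## a ## e) (ren (case_nat 0 (case_nat 1 (%k. k + 4))) p) = holds E (x ## y ## e) p"
    for x y z b a
    unfolding holds_ren
    by (rule arg_cong[where f = "%e. holds E e p"], rule ext, simp add: numeral_eq_Suc split: nat.split)+
  ultimately have "(ALL x y z. holds E (x ## y ## e) p & holds E (x ## z ## e) p --> y = z) -->
      (ALL a. EX b. ALL y. y \<E> b \<longleftrightarrow> (EX x. x \<E> a & holds E (x ## y ## e) p))"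
    unfolding replacement_fm_def by simp
  then show ?thesis using assms by blast
qed

subsection \<open>Definability\<close>

text \<open>
  \<open>dfp P R\<close> says that the relation \<open>R\<close> between the values of the variables is definable with
  parameters from \<open>P\<close>; \<open>P\<close> is either \<open>UNIV\<close> (as needed for Separation and Replacement) or
  \<open>{}\<close> (as needed for ordinal definability).  Definability is closed under shifting the
  environment, so that the rules for binders can be applied by unification.
\<close>

definition tm :: "'a set \<Rightarrow> ((nat \<Rightarrow> 'a) \<Rightarrow> 'a) \<Rightarrow> bool"
  where "tm P t \<longleftrightarrow> (EX i. t = (%e. e i)) \<or> (\<exists>c\<in>P. t = (%_. c))"

definition dfp :: "'a set \<Rightarrow> ((nat \<Rightarrow> 'a) \<Rightarrow> bool) \<Rightarrow> bool"
  where "dfp P R \<longleftrightarrow> (EX p T. (ALL i. tm P (T i)) & (ALL e. R e = holds E (%i. T i e) p))"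

text \<open>The language has no function symbols, so a function is definable through its graph. The
  value takes index 0 and the other variables move up by one, as under a quantifier.\<close>

definition dfun :: "'a set \<Rightarrow> ((nat \<Rightarrow> 'a) \<Rightarrow> 'a) \<Rightarrow> bool"
  where "dfun P t \<longleftrightarrow> dfp P (%e. e 0 = t (%n. e (Suc n)))"

lemma tm_var: "tm P (%e. e i)"
  unfolding tm_def by blast

lemma tm_const: "c \<in> P ==> tm P (%_. c)"
  unfolding tm_def by blast

lemma tm_ren: "tm P t ==> tm P (%e. t (%i. e (f i)))"
  unfolding tm_def by auto

lemma dfpI: "(\<And>i. tm P (T i)) ==> (\<And>e. R e = holds E (%i. T i e) p) ==> dfp P R"
  unfolding dfp_def by (intro exI[of _ p] exI[of _ T]) simp

lemma dfp_mem_tm: "tm P t ==> tm P u ==> dfp P (%e. t e \<E> u e)"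
  by (rule dfpI[of P "%i. if i = 0 then t else u" _ "0 \<^bold>\<in> 1"]) auto

lemma dfp_eq_tm: "tm P t ==> tm P u ==> dfp P (%e. t e = u e)"
  by (rule dfpI[of P "%i. if i = 0 then t else u" _ "0 \<^bold>= 1"]) auto

lemma dfp_False: "dfp P (%e. False)"
  by (rule dfpI[of P "%i e. e i" _ "\<^bold>\<bottom>"]) (auto intro: tm_var)

text \<open>The variables of the two formulas are kept apart by interleaving their environments at
  even and odd indices.\<close>

lemma dfp_imp:
  assumes "dfp P R" "dfp P S"
  shows "dfp P (%e. R e --> S e)"
proof -
  obtain p T q U where T: "\<And>i. tm P (T i)" "\<And>e. R e = holds E (%i. T i e) p"
    and U: "\<And>i. tm P (U i)" "\<And>e. S e = holds E (%i. U i e) q"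
    using assms unfolding dfp_def by auto
  show ?thesis
    by (rule dfpI[of P "%i. if even i then T (i div 2) else U (i div 2)" _
          "ren (%i. 2 * i) p \<^bold>\<longrightarrow> ren (%i. 2 * i + 1) q"]) (simp_all add: T U holds_ren)
qed

lemma dfp_ren:
  assumes "dfp P R"
  shows "dfp P (%e. R (%i. e (f i)))"
proof -
  obtain p T where T: "\<And>i. tm P (T i)" "\<And>e. R e = holds E (%i. T i e) p"
    using assms unfolding dfp_def by auto
  show ?thesis
    by (rule dfpI[of P "%i e. T i (%i. e (f i))" _ p]) (simp_all add: T tm_ren)
qed

text \<open>All indices whose term is the variable about to be bound are merged into index 0. The
  remaining terms do not look at position 0, so \<open>undefined\<close> may be placed
  there.\<close>

lemma dfp_all:
  assumes "dfp P (%e. R (%n. e (Suc n)) (e 0))"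
  shows "dfp P (%e. ALL x. R e x)"
proof -
  obtain p T where T: "\<And>i. tm P (T i)" "\<And>e. R (%n. e (Suc n)) (e 0) = holds E (%i. T i e) p"
    using assms unfolding dfp_def by auto
  define r where "r i = (if T i = (%e. e 0) then 0 else Suc i)" for i
  define U where "U i = (if T i = (%e. e 0) then (%e. e 0) else (%e. T i (undefined ## e)))" for i
  have U: "tm P (U i)" for i
  proof (cases "T i = (%e. e 0)")
    case False
    show ?thesis using T(1)[of i] unfolding tm_def
    proof (elim disjE exE bexE)
      fix j assume "T i = (%e. e j)"
      then show "(EX j. U i = (%e. e j)) \<or> (\<exists>c\<in>P. U i = (%_. c))"
        using False unfolding U_def by (cases j) auto
    qed (use False in \<open>auto simp: U_def\<close>)
  qed (auto simp: U_def tm_var)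
  have "R e x = holds E (x ## (%i. U i e)) (ren r p)" for e x
  proof -
    have "T i (x ## e) = (x ## (%i. U i e)) (r i)" for i
    proof (cases "T i = (%e. e 0)")
      case False
      show ?thesis using T(1)[of i] unfolding tm_def
      proof (elim disjE exE bexE)
        fix j assume "T i = (%e. e j)"
        then show ?thesis using False unfolding U_def r_def by (cases j) auto
      qed (use False in \<open>auto simp: U_def r_def\<close>)
    qed (auto simp: U_def r_def)
    then show ?thesis using T(2)[of "x ## e"] by (simp add: holds_ren)
  qed
  then show ?thesis using U by (intro dfpI[of P U _ "\<^bold>\<forall> (ren r p)"]) simp_all
qed

text \<open>Brings a definable relation into the shape of the axiom schemes: two displayed variables
  in front of one fixed list of parameters.\<close>

lemma dfp_param2:
  assumes "dfp UNIV R"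
  obtains p e where "\<And>x y. R (x ## y ## d) = holds E (x ## y ## e) p"
proof -
  obtain p T where T: "\<And>i. tm UNIV (T i)" "\<And>e. R e = holds E (%i. T i e) p"
    using assms unfolding dfp_def by auto
  define r where "r i = (if T i = (%e. e 0) then 0 else if T i = (%e. e 1) then 1 else i + 2)" for i
  define e where "e i = T i (undefined ## undefined ## d)" for i
  have "T i (x ## y ## d) = (x ## y ## e) (r i)" for i x y
    using T(1)[of i] unfolding tm_def
  proof (elim disjE exE bexE)
    fix j assume j: "T i = (%e. e j)"
    consider "T i = (%e. e 0)" | "T i = (%e. e 1)" "T i \<noteq> (%e. e 0)"
      | "T i \<noteq> (%e. e 0)" "T i \<noteq> (%e. e 1)" by blast
    then show ?thesis
    proof cases
      case 3
      then obtain k where "j = Suc (Suc k)" using j by (cases j; cases "j - 1") auto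
      then show ?thesis using j 3 unfolding r_def e_def by simp
    qed (simp_all add: r_def)
  next
    fix c :: 'a assume c: "T i = (%_. c)"
    consider "T i = (%e. e 0)" | "T i = (%e. e 1)" "T i \<noteq> (%e. e 0)"
      | "T i \<noteq> (%e. e 0)" "T i \<noteq> (%e. e 1)" by blast
    then show ?thesis
    proof cases
      case 3
      then show ?thesis using c unfolding r_def e_def by simp
    qed (simp_all add: r_def)
  qed
  then show thesis using that[of e "ren r p"] T(2) by (simp add: holds_ren)
qed

lemma dfp_empty:
  assumes "dfp {} R"
  obtains p where "\<And>e. R e = holds E e p"
proof -
  obtain p T where T: "\<And>i. tm {} (T i)" "\<And>e. R e = holds E (%i. T i e) p"
    using assms unfolding dfp_def by auto
  have "EX f. ALL i. T i = (%e. e (f i))" using T(1) unfolding tm_def by (intro choice) auto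
  then obtain f where "\<And>i. T i = (%e. e (f i))" by blast
  then have "R e = holds E e (ren f p)" for e using T(2) by (simp add: holds_ren)
  then show thesis by (rule that)
qed

section \<open>Closure rules for definability\<close>

named_theorems dintros

lemma dfp_not: "dfp P R ==> dfp P (%e. \<not> R e)"
  using dfp_imp[OF _ dfp_False, of P R] by simp

lemma dfp_conj: "dfp P R ==> dfp P S ==> dfp P (%e. R e & S e)"
  using dfp_not[OF dfp_imp[OF _ dfp_not, of P R S]] by simp

lemma dfp_disj: "dfp P R ==> dfp P S ==> dfp P (%e. R e \<or> S e)"
  using dfp_imp[OF dfp_not, of P R S] by (simp add: disj_imp)

lemma dfp_iff: "dfp P R ==> dfp P S ==> dfp P (%e. R e = S e)"
  using dfp_conj[OF dfp_imp dfp_imp, of P R S S R] by (simp add: iff_conv_conj_imp)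

lemma dfp_ex: "dfp P (%e. R (%n. e (Suc n)) (e 0)) ==> dfp P (%e. EX x. R e x)"
  using dfp_not[OF dfp_all[OF dfp_not], of P R] by simp

lemma dfp_weaken: "dfp {} R ==> dfp P R"
  unfolding dfp_def tm_def by blast

lemma dfun_weaken: "dfun {} t ==> dfun P t"
  unfolding dfun_def by (rule dfp_weaken)

lemma dfun_var: "dfun P (%e. e i)"
  unfolding dfun_def by (intro dfp_eq_tm tm_var)

lemma dfun_const: "c \<in> P ==> dfun P (%_. c)"
  unfolding dfun_def by (intro dfp_eq_tm tm_var tm_const)

lemma dfun_ren: "dfun P t ==> dfun P (%e. t (%i. e (f i)))"
  using dfp_ren[of P "%e. e 0 = t (%n. e (Suc n))" "case_nat 0 (%n. Suc (f n))"]
  unfolding dfun_def by simp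

text \<open>The value \<open>t e\<close> is introduced by quantifying over \<open>x\<close> with
  \<open>x = t e\<close>. This reduces atomic formulas in definable terms to atomic formulas in
  variables.\<close>

lemma dfp_let: "dfp P (%e. R (%n. e (Suc n)) (e 0)) ==> dfun P t ==> dfp P (%e. R e (t e))"
  using dfp_all[of P "%e x. x = t e --> R e x", OF dfp_imp] unfolding dfun_def by simp

lemma dfp_mem: "dfun P t ==> dfun P u ==> dfp P (%e. t e \<E> u e)"
  by (rule dfp_let[of P "%e x. x \<E> u e"], rule dfp_let[of P "%e x. e 0 \<E> x"])
    (auto intro: dfp_mem_tm tm_var dfun_ren)

lemma dfp_eq: "dfun P t ==> dfun P u ==> dfp P (%e. t e = u e)"
  by (rule dfp_let[of P "%e x. x = u e"], rule dfp_let[of P "%e x. e 0 = x"])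
    (auto intro: dfp_eq_tm tm_var dfun_ren)

lemmas [dintros] = dfp_not dfp_conj dfp_disj dfp_iff dfp_imp dfp_all dfp_ex dfun_var dfp_mem dfp_eq

lemma dfp_holds:
  "(\<And>i. dfun P (T i)) ==> dfp P (%e. holds E (%i. T i e) p)"
proof (induction p arbitrary: T)
  case (Imp p q)
  show ?case unfolding holds.simps by (intro dfp_imp Imp.IH Imp.prems)
next
  case (Forall p)
  define U where "U = (%e. e 0) ## (%i e. T i (%n. e (Suc n)))"
  have "dfun P (U i)" for i
    unfolding U_def by (cases i) (auto intro: dfun_var dfun_ren Forall.prems)
  then have "dfp P (%e. holds E (%i. U i e) p)" by (rule Forall.IH)
  moreover have "(%i. U i e) = (e 0 ## (%i. T i (%n. e (Suc n))))" for e
    unfolding U_def by (rule ext) (simp split: nat.split)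
  ultimately show ?case unfolding holds.simps
    by (intro dfp_all) (simp only:)
qed (simp_all add: dfp_False dfp_mem dfp_eq)

lemma dfp_subst:
  assumes "dfp P R" "\<And>i. dfun P (T i)"
  shows "dfp P (%e. R (%i. T i e))"
proof -
  obtain p U where U: "\<And>i. tm P (U i)" "\<And>e. R e = holds E (%i. U i e) p"
    using assms unfolding dfp_def by auto
  have "dfun P (%e. U i (%i. T i e))" for i
    using U(1)[of i] unfolding tm_def by (auto intro: assms dfun_const)
  then show ?thesis unfolding U(2) by (rule dfp_holds)
qed

lemma dfun_subst:
  assumes "dfun P t" "\<And>i. dfun P (T i)"
  shows "dfun P (%e. t (%i. T i e))"
proof -
  define U where "U = (%e. e 0) ## (%i e. T i (%n. e (Suc n)))"
  have "dfun P (U i)" for i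
    unfolding U_def by (cases i) (auto intro: dfun_var dfun_ren assms)
  with assms(1) have "dfp P (%e. (%e. e 0 = t (%n. e (Suc n))) (%i. U i e))"
    unfolding dfun_def[of P t] by (rule dfp_subst)
  then show ?thesis unfolding dfun_def by (simp add: U_def)
qed

text \<open>With this rule and the following ones, a new notion is shown definable for variables
  only, and the result is transferred to arbitrary definable arguments. Fixed arities let
  unification find the instances.\<close>

lemma dsub1: "dfp P (%e. R (e 0)) ==> dfun P t ==> dfp P (%e. R (t e))"
  by (drule dfp_subst[of P _ "%i. t"]) auto

lemma dsub2: "dfp P (%e. R (e 0) (e 1)) ==> dfun P t ==> dfun P u ==> dfp P (%e. R (t e) (u e))"
  by (drule dfp_subst[of P _ "%i. if i = 0 then t else u"]) auto

lemma dsub3: "dfp P (%e. R (e 0) (e 1) (e 2)) ==> dfun P t ==> dfun P u ==> dfun P v ==>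
    dfp P (%e. R (t e) (u e) (v e))"
  by (drule dfp_subst[of P _ "%i. if i = 0 then t else if i = 1 then u else v"]) auto

lemma dsub4: "dfp P (%e. R (e 0) (e 1) (e 2) (e 3)) ==> dfun P t ==> dfun P u ==> dfun P v ==>
    dfun P w ==> dfp P (%e. R (t e) (u e) (v e) (w e))"
  by (drule dfp_subst[of P _ "%i. if i = 0 then t else if i = 1 then u else if i = 2 then v else w"]) auto

lemma dsubf1: "dfun P (%e. F (e 0)) ==> dfun P t ==> dfun P (%e. F (t e))"
  by (drule dfun_subst[of P _ "%i. t"]) auto

lemma dsubf2: "dfun P (%e. F (e 0) (e 1)) ==> dfun P t ==> dfun P u ==> dfun P (%e. F (t e) (u e))"
  by (drule dfun_subst[of P _ "%i. if i = 0 then t else u"]) auto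

subsection \<open>Set comprehension\<close>

text \<open>\<open>Coll Q\<close> is the empty set if there is no set \<open>{x. Q x}\<close>.\<close>

definition isset :: "('a \<Rightarrow> bool) \<Rightarrow> bool"
  where "isset Q \<longleftrightarrow> (EX z. ALL x. x \<E> z \<longleftrightarrow> Q x)"

definition Coll :: "('a \<Rightarrow> bool) \<Rightarrow> 'a"
  where "Coll Q = (THE z. ALL x. x \<E> z \<longleftrightarrow> isset Q & Q x)"

lemma isset_param: "dfp UNIV (%e. Q (e 0)) ==> isset (%x. x \<E> a & Q x)"
proof -
  assume "dfp UNIV (%e. Q (e 0))"
  then obtain p e where p: "\<And>x y. Q ((x ## y ## (%_. a)) 0) = holds E (x ## y ## e) p"
    by (rule dfp_param2) blast
  show ?thesis using ax_separation[of a "a ## e" p] p unfolding isset_def by simp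
qed

lemma Coll_ex1: "EX! z. ALL x. x \<E> z \<longleftrightarrow> isset Q & Q x"
proof (rule ex_ex1I)
  show "EX z. ALL x. x \<E> z \<longleftrightarrow> isset Q & Q x"
  proof (cases "isset Q")
    case False
    have "isset (%x. x \<E> undefined & False)" by (rule isset_param) (rule dfp_False)
    then obtain z where "\<And>x. \<not> x \<E> z" unfolding isset_def by blast
    then show ?thesis using False by blast
  qed (simp add: isset_def)
qed (rule extensional, simp)

lemma mem_Coll: "isset Q ==> x \<E> Coll Q \<longleftrightarrow> Q x"
  using theI'[OF Coll_ex1[of Q]] unfolding Coll_def by simp

text \<open>Expresses the graph of \<open>Coll\<close> as a first-order condition, including the
  default case, which is what makes \<open>Coll\<close> definable.\<close>

lemma eq_Coll: "y = Coll Q \<longleftrightarrow> (ALL x. x \<E> y \<longleftrightarrow> (EX z. ALL x. x \<E> z \<longleftrightarrow> Q x) & Q x)"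
proof -
  have C: "ALL x. x \<E> Coll Q \<longleftrightarrow> isset Q & Q x"
    using theI'[OF Coll_ex1[of Q]] unfolding Coll_def .
  then show ?thesis unfolding isset_def[of Q, symmetric] by (auto intro: extensional)
qed

lemma dfun_Coll [dintros]:
  assumes "dfp P (%e. Q (%n. e (Suc n)) (e 0))"
  shows "dfun P (%e. Coll (Q e))"
proof -
  have "dfp P (%e. Q (%n. e (f n)) (e i))" for i f
    using dfp_ren[OF assms, of "i ## f"] by simp
  then show ?thesis unfolding dfun_def eq_Coll by (intro dintros)
qed

lemma Coll_eqI: "(\<And>x. x \<E> y \<longleftrightarrow> Q x) ==> Coll Q = y"
  using mem_Coll[of Q] unfolding isset_def by (intro extensional) blast

lemma isset_mem: "isset (%x. x \<E> a)"
  unfolding isset_def by blast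

lemma isset_sub: "isset A ==> (\<And>x. Q x ==> A x) ==> dfp UNIV (%e. Q (e 0)) ==> isset Q"
proof -
  assume "isset A" and QA: "\<And>x. Q x ==> A x" and Q: "dfp UNIV (%e. Q (e 0))"
  then have "isset (%x. x \<E> Coll A & Q x)" by (intro isset_param)
  moreover have "x \<E> Coll A & Q x \<longleftrightarrow> Q x" for x using mem_Coll[OF \<open>isset A\<close>] QA by auto
  ultimately show "isset Q" by simp
qed

lemma isset_repl: "dfun UNIV (%e. F (e 0)) ==> isset (%y. EX x. x \<E> a & y = F x)"
proof -
  assume "dfun UNIV (%e. F (e 0))"
  then have "dfp UNIV (%e. e 1 = F (e 0))"
    unfolding dfun_def by (drule_tac dfp_ren[of _ _ "1 ## (%_. 0)"]) simp
  then obtain p e where p: "\<And>x y. ((x ## y ## (%_. a)) 1 = F ((x ## y ## (%_. a)) 0)) = holds E (x ## y ## e) p"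
    by (rule dfp_param2) blast
  then have p: "holds E (x ## y ## e) p \<longleftrightarrow> y = F x" for x y by simp
  show ?thesis using ax_replacement[of e p a] unfolding isset_def p by simp
qed

text \<open>Collecting the elements of the unique witness reduces definite description to
  \<open>Coll\<close>, so that definability is inherited. Without a unique witness the value is the
  empty set.\<close>

definition the1 :: "('a \<Rightarrow> bool) \<Rightarrow> 'a"
  where "the1 Q = Coll (%u. EX x. Q x & (ALL y. Q y --> y = x) & u \<E> x)"

lemma the1_eq: "Q x ==> (\<And>y. Q y ==> y = x) ==> the1 Q = x"
  unfolding the1_def by (rule Coll_eqI) blast

lemma dfun_the1 [dintros]:
  assumes "dfp P (%e. Q (%n. e (Suc n)) (e 0))"
  shows "dfun P (%e. the1 (Q e))"
proof -
  have "dfp P (%e. Q (%n. e (f n)) (e i))" for i f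
    using dfp_ren[OF assms, of "i ## f"] by simp
  then show ?thesis unfolding the1_def by (intro dintros)
qed

lemma dfun_if [dintros]:
  assumes "dfp P R" "dfun P t" "dfun P u"
  shows "dfun P (%e. if R e then t e else u e)"
proof -
  have R: "dfp P (%e. R (%n. e (Suc n)))" using dfp_ren[OF assms(1), of Suc] .
  have "dfp P (%e. R (%n. e (Suc n)) & e 0 = t (%n. e (Suc n)) \<or>
      \<not> R (%n. e (Suc n)) & e 0 = u (%n. e (Suc n)))"
    by (rule dfp_disj[OF dfp_conj[OF R assms(2)[unfolded dfun_def]]
          dfp_conj[OF dfp_not[OF R] assms(3)[unfolded dfun_def]]])
  moreover have eq: "(y = (if R e then t e else u e)) = (R e & y = t e \<or> \<not> R e & y = u e)" for e y
    by (cases "R e") auto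
  ultimately show ?thesis unfolding dfun_def eq by blast
qed

subsection \<open>Basic operations\<close>

definition emp :: 'a where "emp = Coll (%x. False)"
definition upr :: "'a \<Rightarrow> 'a \<Rightarrow> 'a" where "upr a b = Coll (%x. x = a \<or> x = b)"
definition opair :: "'a \<Rightarrow> 'a \<Rightarrow> 'a" where "opair a b = upr (upr a a) (upr a b)"
definition un :: "'a \<Rightarrow> 'a" where "un a = Coll (%x. EX y. y \<E> a & x \<E> y)"
definition subs :: "'a \<Rightarrow> 'a \<Rightarrow> bool" where "subs a b \<longleftrightarrow> (ALL x. x \<E> a --> x \<E> b)"
definition pow :: "'a \<Rightarrow> 'a" where "pow a = Coll (%x. subs x a)"
definition suc :: "'a \<Rightarrow> 'a" where "suc a = Coll (%x. x \<E> a \<or> x = a)"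

lemma isset_False: "isset (%x. False)"
  using isset_param[of "%_. False"] by (simp add: dfp_False)

lemma isset_upr: "isset (%x. x = a \<or> x = b)"
  using ax_pairing unfolding isset_def .

lemma isset_union: "isset (%x. EX y. y \<E> a & x \<E> y)"
  using ax_union unfolding isset_def .

lemma isset_pow: "isset (%x. subs x a)"
  using ax_power[of a] unfolding isset_def subs_def .

lemma mem_emp [simp]: "\<not> x \<E> emp"
  unfolding emp_def by (simp add: mem_Coll isset_False)

lemma mem_upr [simp]: "x \<E> upr a b \<longleftrightarrow> x = a \<or> x = b"
  unfolding upr_def by (simp add: mem_Coll isset_upr)

lemma mem_un [simp]: "x \<E> un a \<longleftrightarrow> (EX y. y \<E> a & x \<E> y)"
  unfolding un_def by (simp add: mem_Coll isset_union)

lemma mem_pow [simp]: "x \<E> pow a \<longleftrightarrow> subs x a"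
  unfolding pow_def by (simp add: mem_Coll isset_pow)

lemma isset_disj: "isset A ==> isset B ==> isset (%x. A x \<or> B x)"
proof -
  assume "isset A" "isset B"
  then have "A x \<or> B x \<longleftrightarrow> x \<E> un (upr (Coll A) (Coll B))" for x
    using mem_Coll[of A] mem_Coll[of B] by auto
  then show ?thesis unfolding isset_def by blast
qed

lemma mem_suc [simp]: "x \<E> suc a \<longleftrightarrow> x \<E> a \<or> x = a"
proof -
  have "isset (%x. x \<E> a \<or> x = a)" using isset_disj[OF isset_mem isset_upr[of a a]] by simp
  then show ?thesis unfolding suc_def by (simp add: mem_Coll)
qed

lemma eq_emp: "(\<And>x. \<not> x \<E> a) ==> a = emp"
  by (rule extensional) simp

lemma upr_eq: "upr a b = upr c d \<longleftrightarrow> a = c & b = d \<or> a = d & b = c"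
proof
  assume "upr a b = upr c d"
  then have "x = a \<or> x = b \<longleftrightarrow> x = c \<or> x = d" for x using mem_upr by metis
  then show "a = c & b = d \<or> a = d & b = c" by metis
qed (auto intro: extensional)

lemma opair_eq [simp]: "opair a b = opair c d \<longleftrightarrow> a = c & b = d"
  unfolding opair_def upr_eq by auto

lemma subsI: "(\<And>x. x \<E> a ==> x \<E> b) ==> subs a b"
  unfolding subs_def by blast

lemma subs_antisym: "subs a b ==> subs b a ==> a = b"
  unfolding subs_def by (rule extensional) blast

lemma dfun_emp [dintros]: "dfun P (%e. emp)"
  unfolding emp_def by (intro dintros dfp_False)

lemma dfun_upr [dintros]: "dfun P t ==> dfun P u ==> dfun P (%e. upr (t e) (u e))"
  by (rule dsubf2) (unfold upr_def, intro dintros)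

lemma dfun_opair [dintros]: "dfun P t ==> dfun P u ==> dfun P (%e. opair (t e) (u e))"
  unfolding opair_def by (intro dintros)

lemma dfun_un [dintros]: "dfun P t ==> dfun P (%e. un (t e))"
  by (rule dsubf1) (unfold un_def, intro dintros)

lemma dfp_subs [dintros]: "dfun P t ==> dfun P u ==> dfp P (%e. subs (t e) (u e))"
  by (rule dsub2) (unfold subs_def, intro dintros)

lemma dfun_pow [dintros]: "dfun P t ==> dfun P (%e. pow (t e))"
  by (rule dsubf1) (unfold pow_def, intro dintros)

lemma dfun_suc [dintros]: "dfun P t ==> dfun P (%e. suc (t e))"
  by (rule dsubf1) (unfold suc_def, intro dintros)

lemma dfun_UNIV [simp, intro, dintros]: "dfun UNIV (%_. c)"
  by (rule dfun_const) simp

lemma isset_UN: "dfun UNIV (%e. F (e 0)) ==> isset (%y. EX x. x \<E> a & y \<E> F x)"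
proof -
  assume "dfun UNIV (%e. F (e 0))"
  then have r: "isset (%y. EX x. x \<E> a & y = F x)" by (rule isset_repl)
  have "(EX x. x \<E> a & y \<E> F x) \<longleftrightarrow> y \<E> un (Coll (%y. EX x. x \<E> a & y = F x))" for y
    by (auto simp: mem_Coll[OF r])
  then show ?thesis unfolding isset_def by blast
qed

definition times :: "'a \<Rightarrow> 'a \<Rightarrow> 'a"
  where "times a b = Coll (%p. EX x. x \<E> a & (EX y. y \<E> b & p = opair x y))"

lemma mem_times: "p \<E> times a b \<longleftrightarrow> (EX x y. x \<E> a & y \<E> b & p = opair x y)"
proof -
  have 1: "isset (%p. EX y. y \<E> b & p = opair x y)" for x
    by (rule isset_repl[of "opair x"]) (intro dintros)
  have "isset (%p. EX x. x \<E> a & p \<E> Coll (%p. EX y. y \<E> b & p = opair x y))"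
    by (rule isset_UN) (intro dintros)
  then show ?thesis unfolding times_def mem_Coll[OF 1] by (auto simp: mem_Coll)
qed

lemma opair_mem_times [simp]: "opair x y \<E> times a b \<longleftrightarrow> x \<E> a & y \<E> b"
  by (auto simp: mem_times)

lemma dfun_times [dintros]: "dfun P t ==> dfun P u ==> dfun P (%e. times (t e) (u e))"
  by (rule dsubf2) (unfold times_def, intro dintros)

definition fst' :: "'a \<Rightarrow> 'a" where "fst' p = the1 (%x. EX y. p = opair x y)"
definition snd' :: "'a \<Rightarrow> 'a" where "snd' p = the1 (%y. EX x. p = opair x y)"

lemma fst_opair [simp]: "fst' (opair x y) = x"
  unfolding fst'_def by (rule the1_eq) auto

lemma snd_opair [simp]: "snd' (opair x y) = y"
  unfolding snd'_def by (rule the1_eq) auto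

lemma dfun_fst [dintros]: "dfun P t ==> dfun P (%e. fst' (t e))"
  by (rule dsubf1) (unfold fst'_def, intro dintros)

lemma dfun_snd [dintros]: "dfun P t ==> dfun P (%e. snd' (t e))"
  by (rule dsubf1) (unfold snd'_def, intro dintros)

subsection \<open>Functions\<close>

definition isfun :: "'a \<Rightarrow> 'a \<Rightarrow> bool"
  where "isfun f A \<longleftrightarrow> (ALL p. p \<E> f --> (EX x. x \<E> A & (EX y. p = opair x y))) &
    (ALL x. x \<E> A --> (EX y. ALL z. opair x z \<E> f \<longleftrightarrow> z = y))"

definition app :: "'a \<Rightarrow> 'a \<Rightarrow> 'a"
  where "app f x = the1 (%y. opair x y \<E> f)"

definition lam :: "'a \<Rightarrow> ('a \<Rightarrow> 'a) \<Rightarrow> 'a"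
  where "lam A F = Coll (%p. EX x. x \<E> A & p = opair x (F x))"

lemma dfp_isfun [dintros]: "dfun P t ==> dfun P u ==> dfp P (%e. isfun (t e) (u e))"
  by (rule dsub2) (unfold isfun_def, intro dintros)

lemma dfun_app [dintros]: "dfun P t ==> dfun P u ==> dfun P (%e. app (t e) (u e))"
  by (rule dsubf2) (unfold app_def, intro dintros)

lemma dfun_lam [dintros]:
  assumes t: "dfun P t" and F: "dfun P (%e. F (%n. e (Suc n)) (e 0))"
  shows "dfun P (%e. lam (t e) (F e))"
proof -
  have "dfun P (%e. F (%n. e (Suc (Suc n))) (e 0))"
    using dfun_ren[OF F, of "0 ## (%n. Suc (Suc n))"] by simp
  moreover have "dfun P (%e. t (%n. e (Suc (Suc n))))"
    using dfun_ren[OF t, of "%n. Suc (Suc n)"] .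
  ultimately show ?thesis unfolding lam_def by (intro dintros)
qed

lemma app_eq: "isfun f A ==> x \<E> A ==> opair x y \<E> f \<longleftrightarrow> app f x = y"
proof -
  assume "isfun f A" "x \<E> A"
  then obtain z where z: "\<And>y. opair x y \<E> f \<longleftrightarrow> y = z" unfolding isfun_def by blast
  then have "app f x = z" unfolding app_def by (intro the1_eq) auto
  then show ?thesis using z by auto
qed

lemma isfun_mem:
  assumes "isfun f A"
  shows "p \<E> f \<longleftrightarrow> (EX x. x \<E> A & p = opair x (app f x))"
proof
  assume "p \<E> f"
  then obtain x y where "x \<E> A" "p = opair x y" using assms unfolding isfun_def by blast
  then show "EX x. x \<E> A & p = opair x (app f x)" using app_eq[OF assms] \<open>p \<E> f\<close> by auto
qed (use app_eq[OF assms] in auto)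

lemma mem_lam: "dfun UNIV (%e. F (e 0)) ==> p \<E> lam A F \<longleftrightarrow> (EX x. x \<E> A & p = opair x (F x))"
proof -
  assume F: "dfun UNIV (%e. F (e 0))"
  have "isset (%p. EX x. x \<E> A & p = opair x (F x))"
    by (rule isset_repl[of "%x. opair x (F x)"]) (intro dintros F)
  then show ?thesis unfolding lam_def by (rule mem_Coll)
qed

lemma isfun_lam: "dfun UNIV (%e. F (e 0)) ==> isfun (lam A F) A"
  unfolding isfun_def by (auto simp: mem_lam)

lemma app_lam: "dfun UNIV (%e. F (e 0)) ==> x \<E> A ==> app (lam A F) x = F x"
  using app_eq[OF isfun_lam] mem_lam by auto

lemma isfun_ext: "isfun f A ==> isfun g A ==> (\<And>x. x \<E> A ==> app f x = app g x) ==> f = g"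
  by (rule extensional) (auto simp: isfun_mem)

subsection \<open>Natural numbers\<close>

definition ind :: "'a \<Rightarrow> bool"
  where "ind w \<longleftrightarrow> emp \<E> w & (ALL y. y \<E> w --> suc y \<E> w)"

definition omega :: 'a where "omega = Coll (%x. ALL w. ind w --> x \<E> w)"

lemma dfp_ind [dintros]: "dfun P t ==> dfp P (%e. ind (t e))"
  by (rule dsub1) (unfold ind_def, intro dintros)

lemma dfun_omega [dintros]: "dfun P (%e. omega)"
  unfolding omega_def by (intro dintros)

lemma eq_suc: "(ALL v. v \<E> s \<longleftrightarrow> v \<E> y \<or> v = y) \<longleftrightarrow> s = suc y"
  using extensional[of s "suc y"] by auto

lemma mem_omega: "x \<E> omega \<longleftrightarrow> (ALL w. ind w --> x \<E> w)"
proof -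
  have e: "(ALL x. \<not> x \<E> z) \<longleftrightarrow> z = emp" for z using eq_emp[of z] by auto
  obtain w where "ind w" using ax_infinity unfolding e eq_suc ind_def by auto
  have "isset (%x. ALL w. ind w --> x \<E> w)"
    by (rule isset_sub[OF isset_mem[of w]]) (use \<open>ind w\<close> in blast, intro dintros)
  then show ?thesis unfolding omega_def by (rule mem_Coll)
qed

lemma zero_omega [simp]: "emp \<E> omega"
  unfolding mem_omega ind_def by blast

lemma suc_omega [simp]: "x \<E> omega ==> suc x \<E> omega"
  unfolding mem_omega ind_def by blast

text \<open>The predicate must be definable because \<open>omega\<close> may have nonstandard
  elements; its extension is then an inductive set of the model.\<close>

lemma omega_induct:
  assumes n: "n \<E> omega" and Q: "dfp UNIV (%e. Q (e 0))"
    and 0: "Q emp" and S: "\<And>n. n \<E> omega ==> Q n ==> Q (suc n)"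
  shows "Q n"
proof -
  have "isset (%x. x \<E> omega & Q x)" using Q by (rule isset_param)
  then have m: "x \<E> Coll (%x. x \<E> omega & Q x) \<longleftrightarrow> x \<E> omega & Q x" for x by (rule mem_Coll)
  have "ind (Coll (%x. x \<E> omega & Q x))" unfolding ind_def m using 0 S by simp
  then show ?thesis using n m unfolding mem_omega by blast
qed

lemma not_mem_self: "\<not> x \<E> x"
  using ax_regularity[of x "upr x x"] by auto

lemma not_mem_cycle: "x \<E> y ==> \<not> y \<E> x"
  using ax_regularity[of x "upr x y"] by auto

lemma suc_not_emp [simp]: "suc x \<noteq> emp"
  using mem_suc[of x x] mem_emp[of x] by metis

lemma suc_inject [simp]: "suc x = suc y \<longleftrightarrow> x = y"
proof
  assume "suc x = suc y"
  then have "x \<E> suc y" "y \<E> suc x" by (metis mem_suc)+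
  then show "x = y" using not_mem_cycle by auto
qed simp

definition trans' :: "'a \<Rightarrow> bool"
  where "trans' x \<longleftrightarrow> (ALL y. y \<E> x --> subs y x)"

lemma dfp_trans [dintros]: "dfun P t ==> dfp P (%e. trans' (t e))"
  by (rule dsub1) (unfold trans'_def, intro dintros)

lemma trans_omega_mem: "n \<E> omega ==> trans' n"
proof (rule omega_induct[of n trans'])
  show "dfp UNIV (%e. trans' (e 0))" by (intro dintros)
qed (auto simp: trans'_def subs_def)

lemma omega_trans: "n \<E> omega ==> subs n omega"
proof (rule omega_induct[of n "%n. subs n omega"])
  show "dfp UNIV (%e. subs (e 0) omega)" by (intro dintros)
qed (auto simp: subs_def)

lemma omega_mem_trans: "m \<E> n ==> n \<E> omega ==> m \<E> omega"
  using omega_trans unfolding subs_def by blast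

lemma omega_cases: "n \<E> omega ==> n = emp \<or> (EX m. m \<E> omega & n = suc m)"
  by (rule omega_induct[of n "%n. n = emp \<or> (EX m. m \<E> omega & n = suc m)"]) (intro dintros | blast)+

lemma suc_mem_suc: "n \<E> omega ==> k \<E> n ==> suc k \<E> suc n"
proof (rule omega_induct[of n "%n. ALL k. k \<E> n --> suc k \<E> suc n", rule_format])
  show "dfp UNIV (%e. ALL k. k \<E> e 0 --> suc k \<E> suc (e 0))" by (intro dintros)
qed auto

lemma suc_mem_sucD: "trans' n ==> suc k \<E> suc n ==> k \<E> n"
  unfolding trans'_def subs_def by auto

text \<open>Functions are represented by sets \<open>f\<close> via \<open>app\<close>, so that no totality condition is needed.\<close>

lemma omega_rec:
  assumes g: "dfun UNIV (%e. g (e 0))" and h: "dfun UNIV (%e. h (e 0))"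
  obtains F where "dfun UNIV (%e. F (e 0) (e 1))" "\<And>x. F x emp = g x"
    "\<And>x n. n \<E> omega ==> F x (suc n) = h (F x n)"
proof -
  \<comment> \<open>Approximations are sets, so the definition of \<open>F\<close> can quantify over
    them and \<open>F\<close> becomes definable.\<close>
  define appr where "appr x n f \<longleftrightarrow> app f emp = g x & (ALL k. k \<E> n --> app f (suc k) = h (app f k))" for x n f
  define F where "F x n = the1 (%y. EX f. appr x n f & y = app f n)" for x n
  note gh = dsubf1[OF g] dsubf1[OF h]
  have dappr: "dfp UNIV (%e. appr (e 0) (e 1) (e 2))"
    unfolding appr_def by (intro dintros gh)
  note dappr = dsub3[OF dappr]
  have uniq: "app f k = app f' k" if "appr x n f" "appr x n' f'" "n \<E> omega" "n' \<E> omega"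
    "k \<E> omega" "k \<E> suc n" "k \<E> suc n'" for x n n' f f' k
  proof -
    have "k \<E> suc n --> k \<E> suc n' --> app f k = app f' k"
    proof (rule omega_induct[OF \<open>k \<E> omega\<close>, of "%k. k \<E> suc n --> k \<E> suc n' --> app f k = app f' k"])
      show "dfp UNIV (%e. e 0 \<E> suc n --> e 0 \<E> suc n' --> app f (e 0) = app f' (e 0))"
        by (intro dintros)
      show "emp \<E> suc n --> emp \<E> suc n' --> app f emp = app f' emp"
        using that unfolding appr_def by simp
      fix k assume "k \<E> omega" and IH: "k \<E> suc n --> k \<E> suc n' --> app f k = app f' k"
      show "suc k \<E> suc n --> suc k \<E> suc n' --> app f (suc k) = app f' (suc k)"
      proof (intro impI)
        assume "suc k \<E> suc n" "suc k \<E> suc n'"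
        then have "k \<E> n" "k \<E> n'" using suc_mem_sucD that trans_omega_mem by blast+
        then show "app f (suc k) = app f' (suc k)" using that(1,2) IH unfolding appr_def by simp
      qed
    qed
    then show ?thesis using that by blast
  qed
  have F: "F x n = app f n" if "appr x n f" "n \<E> omega" for x n f
    unfolding F_def
  proof (rule the1_eq)
    show "EX f'. appr x n f' & app f n = app f' n" using that by blast
    fix y assume "EX f'. appr x n f' & y = app f' n"
    then obtain f' where f': "appr x n f'" "y = app f' n" by blast
    have "n \<E> suc n" by simp
    then show "y = app f n" using f' that uniq[of x n f' n f n] by blast
  qed
  have ex: "EX f. appr x n f" if "n \<E> omega" for x n
  proof (rule omega_induct[OF that, of "%n. EX f. appr x n f"])
    show "dfp UNIV (%e. EX f. appr x (e 0) f)" by (intro dintros dappr)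
    have "app (lam (suc emp) (%_. g x)) emp = g x" by (rule app_lam) auto
    then show "EX f. appr x emp f" unfolding appr_def by auto
    fix n assume n: "n \<E> omega" and "EX f. appr x n f"
    then obtain f where f: "appr x n f" by blast
    define G where "G k = (if k = suc n then h (app f n) else app f k)" for k
    have G: "dfun UNIV (%e. G (e 0))" unfolding G_def by (intro dintros gh)
    have app: "app (lam (suc (suc n)) G) k = G k" if "k \<E> suc (suc n)" for k
      using G that by (rule app_lam)
    have 0: "emp \<E> suc n"
      using n by (rule omega_induct[of n "%n. emp \<E> suc n"]) (intro dintros | simp)+
    have "appr x (suc n) (lam (suc (suc n)) G)" unfolding appr_def
    proof (intro conjI allI impI)
      show "app (lam (suc (suc n)) G) emp = g x"
      proof -
        have "app (lam (suc (suc n)) G) emp = G emp" by (rule app) (use 0 in simp)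
        then show ?thesis using f suc_not_emp[of n] unfolding G_def appr_def by metis
      qed
      fix k assume k: "k \<E> suc n"
      have ne: "k \<noteq> suc n" using k not_mem_self by blast
      have "suc k \<E> suc (suc n)" using k suc_mem_suc[of "suc n"] n by simp
      then have "app (lam (suc (suc n)) G) (suc k) = G (suc k)" by (rule app)
      moreover have "app (lam (suc (suc n)) G) k = G k" by (rule app) (use k in simp)
      moreover have "G (suc k) = h (G k)"
        using k f ne unfolding G_def appr_def by auto
      ultimately show "app (lam (suc (suc n)) G) (suc k) = h (app (lam (suc (suc n)) G) k)" by simp
    qed
    then show "EX f. appr x (suc n) f" by blast
  qed
  show thesis
  proof
    show "dfun UNIV (%e. F (e 0) (e 1))" unfolding F_def by (intro dintros dappr)
    show "F x emp = g x" for x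
    proof -
      obtain f where "appr x emp f" using ex[of emp] by auto
      then show ?thesis using F[of x emp f] unfolding appr_def by simp
    qed
    show "F x (suc n) = h (F x n)" if n: "n \<E> omega" for x n
    proof -
      obtain f where f: "appr x (suc n) f" using ex[of "suc n"] n by auto
      then have "appr x n f" unfolding appr_def by simp
      then have "F x n = app f n" using n by (rule F)
      moreover have "F x (suc n) = app f (suc n)" using f n by (intro F) simp_all
      ultimately show ?thesis using f unfolding appr_def by simp
    qed
  qed
qed

subsection \<open>Transitive closure and recursion\<close>

definition TC :: "'a \<Rightarrow> 'a"
  where "TC x = Coll (%z. ALL t. trans' t --> subs x t --> z \<E> t)"

lemma dfun_TC [dintros]: "dfun P t ==> dfun P (%e. TC (t e))"
  by (rule dsubf1) (unfold TC_def, intro dintros)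

text \<open>The transitive set is the union of the iterates of \<open>un\<close> at \<open>x\<close>
  along \<open>omega\<close>; an element of an element of one iterate lies in the next.\<close>

lemma ex_trans: "EX t. trans' t & subs x t"
proof -
  obtain F where F: "dfun UNIV (%e. F (e 0) (e 1))" and F0: "\<And>x. F x emp = x"
    and FS: "\<And>x n. n \<E> omega ==> F x (suc n) = un (F x n)"
    by (rule omega_rec[of "%x. x" un]) (intro dintros, intro dintros, blast)
  have "isset (%y. EX n. n \<E> omega & y \<E> F x n)"
    by (rule isset_UN) (intro dintros dsubf2[OF F])
  then obtain t where t: "\<And>y. y \<E> t \<longleftrightarrow> (EX n. n \<E> omega & y \<E> F x n)" unfolding isset_def by blast
  have "trans' t" unfolding trans'_def
  proof (intro allI impI subsI)
    fix y z assume "y \<E> t" "z \<E> y"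
    then obtain n where n: "n \<E> omega" "y \<E> F x n" unfolding t by blast
    then have "z \<E> F x (suc n)" using \<open>z \<E> y\<close> FS by auto
    then show "z \<E> t" unfolding t using n suc_omega by blast
  qed
  moreover have "subs x t" unfolding subs_def t using F0 zero_omega by metis
  ultimately show ?thesis by blast
qed

lemma mem_TC: "z \<E> TC x \<longleftrightarrow> (ALL t. trans' t --> subs x t --> z \<E> t)"
proof -
  obtain t where t: "trans' t" "subs x t" using ex_trans by blast
  have "isset (%z. ALL t. trans' t --> subs x t --> z \<E> t)"
    by (rule isset_sub[OF isset_mem[of t]]) (use t in blast, intro dintros)
  then show ?thesis unfolding TC_def by (rule mem_Coll)
qed

lemma TC_trans: "trans' (TC x)"
proof -
  have "z \<E> TC x" if y: "y \<E> TC x" and z: "z \<E> y" for y z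
    unfolding mem_TC
  proof (intro allI impI)
    fix t assume t: "trans' t" "subs x t"
    then have "y \<E> t" using y unfolding mem_TC by blast
    then show "z \<E> t" using z t(1) unfolding trans'_def subs_def by blast
  qed
  then show ?thesis unfolding trans'_def subs_def by blast
qed

lemma TC_mem: "y \<E> x ==> y \<E> TC x"
  unfolding mem_TC subs_def by blast

lemma TC_step: "z \<E> y ==> y \<E> TC x ==> z \<E> TC x"
  using TC_trans unfolding trans'_def subs_def by blast

lemma TC_least: "trans' t ==> subs x t ==> subs (TC x) t"
  unfolding subs_def[of "TC x"] mem_TC by blast

lemma TC_mono: "y \<E> TC x ==> z \<E> TC y ==> z \<E> TC x"
  using TC_least[OF TC_trans[of x], of y] TC_step unfolding subs_def by blast

text \<open>Regularity speaks about sets, but the counterexamples to \<open>Q\<close> may form a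
  proper class. Restricted to \<open>x\<close> and its transitive closure they form a set, and a
  minimal one there is minimal outright.\<close>

lemma eps_induct:
  assumes Q: "dfp UNIV (%e. Q (e 0))" and S: "\<And>x. (\<And>y. y \<E> x ==> Q y) ==> Q x"
  shows "Q x"
proof (rule ccontr)
  assume "\<not> Q x"
  have "isset (%y. y \<E> un (upr (upr x x) (TC x)) & \<not> Q y)" by (rule isset_param) (intro dintros Q)
  then obtain s where "ALL y. y \<E> s \<longleftrightarrow> y \<E> un (upr (upr x x) (TC x)) & \<not> Q y"
    unfolding isset_def by blast
  then have s: "y \<E> s \<longleftrightarrow> (y = x \<or> y \<E> TC x) & \<not> Q y" for y by auto
  have "x \<E> s" using s \<open>\<not> Q x\<close> by simp
  then obtain y where y: "y \<E> s" "\<And>z. z \<E> y ==> \<not> z \<E> s" using ax_regularity by blast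
  have "Q z" if "z \<E> y" for z
    using that y(1) y(2)[OF that] TC_mem TC_step unfolding s by blast
  then have "Q y" by (rule S)
  then show False using y(1) s by blast
qed

lemma TC_cases: "z \<E> TC x ==> z \<E> x \<or> (EX y. y \<E> x & z \<E> TC y)"
proof -
  have "isset (%z. z \<E> TC x & (z \<E> x \<or> (EX y. y \<E> x & z \<E> TC y)))"
    by (rule isset_param) (intro dintros)
  then obtain t where t: "\<And>z. z \<E> t \<longleftrightarrow> z \<E> TC x & (z \<E> x \<or> (EX y. y \<E> x & z \<E> TC y))"
    unfolding isset_def by blast
  have "trans' t" unfolding trans'_def
  proof (intro allI impI subsI)
    fix y z assume "y \<E> t" "z \<E> y"
    then have "z \<E> TC x" "y \<E> x \<or> (EX w. w \<E> x & y \<E> TC w)" using TC_step[of z y x] t by simp_all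
    then show "z \<E> t" unfolding t using \<open>z \<E> y\<close> TC_mem[of z y] TC_step[of z y] by blast
  qed
  moreover have "subs x t" unfolding subs_def t using TC_mem by blast
  ultimately have "z \<E> TC x ==> z \<E> t" using mem_TC[of z x] by simp
  then show "z \<E> TC x ==> ?thesis" using t by simp
qed

lemma TC_induct:
  assumes Q: "dfp UNIV (%e. Q (e 0))" and S: "\<And>x. (\<And>y. y \<E> TC x ==> Q y) ==> Q x"
  shows "Q x"
proof -
  have "ALL y. y \<E> TC x --> Q y"
  proof (rule eps_induct[of "%x. ALL y. y \<E> TC x --> Q y"])
    show "dfp UNIV (%e. ALL y. y \<E> TC (e 0) --> Q y)" by (intro dintros dsub1[OF Q])
    fix x assume IH: "\<And>y. y \<E> x ==> ALL z. z \<E> TC y --> Q z"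
    show "ALL y. y \<E> TC x --> Q y"
    proof (intro allI impI)
      fix y assume "y \<E> TC x"
      then consider "y \<E> x" | w where "w \<E> x" "y \<E> TC w" using TC_cases[of y x] by blast
      then show "Q y"
      proof cases
        case 1
        show ?thesis by (rule S) (use IH[OF 1] in simp)
      next
        case 2
        then show ?thesis using IH by simp
      qed
    qed
  qed
  then have "\<And>y. y \<E> TC x ==> Q y" by blast
  then show ?thesis by (rule S)
qed

text \<open>\<open>G\<close> receives the earlier values as the set \<open>lam (TC x) F\<close>. As
  for recursion on \<open>omega\<close>, \<open>F\<close> is glued from set approximations, which
  agree wherever two of them are defined by the recursion.\<close>

lemma TC_rec:
  assumes G: "dfun UNIV (%e. G (e 0) (e 1))"
  obtains F where "dfun UNIV (%e. F (e 0))" "\<And>x. F x = G x (lam (TC x) F)"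
proof -
  note dG = dsubf2[OF G]
  define appr where "appr f x \<longleftrightarrow> (ALL y. y = x \<or> y \<E> TC x --> app f y = G y (lam (TC y) (app f)))" for f x
  have "dfp UNIV (%e. appr (e 0) (e 1))" unfolding appr_def by (intro dintros dG)
  note dappr = dsub2[OF this]
  define F where "F x = the1 (%v. EX f. appr f x & v = app f x)" for x
  have dF: "dfun UNIV (%e. F (e 0))" unfolding F_def by (intro dintros dappr)
  have dapp: "dfun UNIV (%e. app f (e 0))" for f by (intro dintros)
  have lam_cong: "lam A H = lam A H'" if "\<And>y. y \<E> A ==> H y = H' y" for A H H'
    unfolding lam_def using that by metis
  have uniq: "app f y = app f' y" if "appr f x" "appr f' x'" "y = x \<or> y \<E> TC x" "y = x' \<or> y \<E> TC x'" for f f' x x' y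
  proof -
    let ?Q = "%y. (y = x \<or> y \<E> TC x) --> (y = x' \<or> y \<E> TC x') --> app f y = app f' y"
    have "?Q y"
    proof (rule TC_induct[of ?Q])
      show "dfp UNIV (%e. ?Q (e 0))" by (intro dintros)
      fix y assume IH: "\<And>z. z \<E> TC y ==> ?Q z"
      show "?Q y"
      proof (intro impI)
        assume y: "y = x \<or> y \<E> TC x" "y = x' \<or> y \<E> TC x'"
        have "lam (TC y) (app f) = lam (TC y) (app f')"
          by (rule lam_cong) (use IH y TC_mono in blast)
        then show "app f y = app f' y" using that(1,2) y unfolding appr_def by metis
      qed
    qed
    then show ?thesis using that by blast
  qed
  have F: "F y = app f y" if "appr f x" "y = x \<or> y \<E> TC x" for f x y
    unfolding F_def
  proof (rule the1_eq)
    have "appr f y" using that TC_mono unfolding appr_def by blast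
    then show "EX f'. appr f' y & app f y = app f' y" by blast
    fix v assume "EX f'. appr f' y & v = app f' y"
    then show "v = app f y" using uniq that by blast
  qed
  have ex: "EX f. appr f x" for x
  proof (rule TC_induct[of "%x. EX f. appr f x"])
    show "dfp UNIV (%e. EX f. appr f (e 0))" by (intro dintros dappr)
    fix x assume IH: "\<And>y. y \<E> TC x ==> EX f. appr f y"
    \<comment> \<open>The approximation at \<open>x\<close> collects the values already determined
      on \<open>TC x\<close> and adds the one at \<open>x\<close>; as \<open>x\<close> is not in
      \<open>TC x\<close>, the new value does not overwrite an old one.\<close>
    define H where "H y = (if y = x then G x (lam (TC x) F) else F y)" for y
    have dH: "dfun UNIV (%e. H (e 0))"
      unfolding H_def by (intro dintros dG dsubf1[OF dF])
    let ?A = "un (upr (upr x x) (TC x))"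
    have app: "app (lam ?A H) y = H y" if "y = x \<or> y \<E> TC x" for y
      by (rule app_lam[OF dH]) (use that in auto)
    have not: "\<not> x \<E> TC x" for x
    proof (rule TC_induct[of "%x. \<not> x \<E> TC x"])
      show "dfp UNIV (%e. \<not> e 0 \<E> TC (e 0))" by (intro dintros)
    qed blast
    have HF: "H y = F y" if "y \<E> TC x" for y using that not[of x] unfolding H_def by auto
    have "appr (lam ?A H) x" unfolding appr_def
    proof (intro allI impI)
      fix y assume y: "y = x \<or> y \<E> TC x"
      have l: "lam (TC y) (app (lam ?A H)) = lam (TC y) F"
      proof (rule lam_cong)
        fix z assume "z \<E> TC y"
        then have "z \<E> TC x" using y TC_mono by blast
        then show "app (lam ?A H) z = F z" using app HF by simp
      qed
      show "app (lam ?A H) y = G y (lam (TC y) (app (lam ?A H)))"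
      proof (cases "y = x")
        case True
        then show ?thesis using app[OF y] l unfolding H_def by simp
      next
        case False
        then have "y \<E> TC x" using y by blast
        then obtain f where f: "appr f y" using IH by blast
        have "lam (TC y) F = lam (TC y) (app f)"
          by (rule lam_cong) (use F[OF f] in blast)
        then have "F y = G y (lam (TC y) F)"
          using f F[OF f, of y] unfolding appr_def by metis
        then show ?thesis using app[OF y] l HF[OF \<open>y \<E> TC x\<close>] by simp
      qed
    qed
    then show "EX f. appr f x" by blast
  qed
  show thesis
  proof (rule that[OF dF])
    fix x obtain f where f: "appr f x" using ex by blast
    have "lam (TC x) F = lam (TC x) (app f)"
      by (rule lam_cong) (use F[OF f] in blast)
    then show "F x = G x (lam (TC x) F)"
      using f F[OF f, of x] unfolding appr_def by metis
  qed
qed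

subsection \<open>Meaning of the basic formulas\<close>

lemma holds_sub [simp]: "holds E e (sub_fm x y) \<longleftrightarrow> subs (e x) (e y)"
  unfolding sub_fm_def subs_def by simp

lemma holds_empty [simp]: "holds E e (empty_fm x) \<longleftrightarrow> e x = emp"
  unfolding empty_fm_def using eq_emp by auto

lemma holds_upair [simp]: "holds E e (upair_fm z x y) \<longleftrightarrow> e z = upr (e x) (e y)"
  unfolding upair_fm_def by (auto intro: extensional)

lemma holds_opair [simp]: "holds E e (opair_fm z x y) \<longleftrightarrow> e z = opair (e x) (e y)"
  unfolding opair_fm_def opair_def by simp

lemma holds_succ [simp]: "holds E e (succ_fm y x) \<longleftrightarrow> e y = suc (e x)"
  unfolding succ_fm_def using eq_suc by simp

lemma holds_inrel [simp]: "holds E e (inrel_fm r x y) \<longleftrightarrow> opair (e x) (e y) \<E> e r"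
  unfolding inrel_fm_def by simp

lemma holds_function_on [simp]: "holds E e (function_on_fm f A) \<longleftrightarrow> isfun (e f) (e A)"
  unfolding function_on_fm_def isfun_def by (simp add: numeral_eq_Suc)

lemma holds_function [simp]: "holds E e (function_fm f A B) \<longleftrightarrow>
    isfun (e f) (e A) & (ALL x. x \<E> e A --> app (e f) x \<E> e B)"
  unfolding function_fm_def using app_eq by auto

lemma holds_inductive [simp]: "holds E e (inductive_fm w) \<longleftrightarrow> ind (e w)"
  unfolding inductive_fm_def ind_def by auto

lemma omega_ind: "ind omega"
  unfolding ind_def by simp

lemma holds_omega [simp]: "holds E e (omega_fm w) \<longleftrightarrow> e w = omega"
proof -
  have "ind x & (ALL y. ind y --> subs x y) \<longleftrightarrow> x = omega" for x
  proof
    show "x = omega" if "ind x & (ALL y. ind y --> subs x y)"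
      using that omega_ind mem_omega by (intro subs_antisym) (auto simp: subs_def)
  qed (auto simp: omega_ind subs_def mem_omega)
  then show ?thesis unfolding omega_fm_def by simp
qed

lemma holds_transitive [simp]: "holds E e (transitive_fm x) \<longleftrightarrow> trans' (e x)"
  unfolding transitive_fm_def trans'_def by simp

lemma ax_choice:
  assumes "\<And>x. x \<E> b ==> x \<noteq> emp"
  obtains f where "isfun f b" "\<And>x. x \<E> b ==> app f x \<E> x"
proof -
  have "holds E (%_. b) choice_ax" by (rule model) (simp add: ZFC_def)
  then have "ALL b. (ALL x. x \<E> b --> x \<noteq> emp) -->
      (EX f. isfun f b & (ALL x. x \<E> b --> (EX y. y \<E> x & opair x y \<E> f)))"
    unfolding choice_ax_def by simp
  then obtain f where "isfun f b" "ALL x. x \<E> b --> (EX y. y \<E> x & opair x y \<E> f)"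
    using assms by blast
  then show thesis using app_eq[of f b] by (intro that) auto
qed

subsection \<open>Ordinals\<close>

definition ord :: "'a \<Rightarrow> bool"
  where "ord x \<longleftrightarrow> trans' x & (ALL y. y \<E> x --> trans' y)"

lemma holds_ordinal [simp]: "holds E e (ordinal_fm x) \<longleftrightarrow> ord (e x)"
  unfolding ordinal_fm_def ord_def by simp

lemma dfp_ord [dintros]: "dfun P t ==> dfp P (%e. ord (t e))"
  by (rule dsub1) (unfold ord_def, intro dintros)

lemma ord_mem: "ord x ==> y \<E> x ==> ord y"
  unfolding ord_def trans'_def subs_def by blast

lemma ord_mem_trans: "ord z ==> x \<E> y ==> y \<E> z ==> x \<E> z"
  unfolding ord_def trans'_def subs_def by blast

text \<open>A double induction: if two ordinals are incomparable while the smaller pairs are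
  comparable, then each is included in the other.\<close>

lemma ord_linear: "ord x ==> ord y ==> x \<E> y \<or> x = y \<or> y \<E> x"
proof -
  let ?L = "%x y. ord x --> ord y --> x \<E> y \<or> x = y \<or> y \<E> x"
  have "ALL y. ?L x y"
  proof (rule eps_induct[of "%x. ALL y. ?L x y"])
    show "dfp UNIV (%e. ALL y. ?L (e 0) y)" by (intro dintros)
    fix x assume IHx: "\<And>z. z \<E> x ==> ALL y. ?L z y"
    have "?L x y" for y
    proof (rule eps_induct[of "%y. ?L x y"])
      show "dfp UNIV (%e. ?L x (e 0))" by (intro dintros)
      fix y assume IHy: "\<And>z. z \<E> y ==> ?L x z"
      show "?L x y"
      proof (intro impI, rule ccontr)
        assume o: "ord x" "ord y" and n: "\<not> (x \<E> y \<or> x = y \<or> y \<E> x)"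
        have "subs x y" 
        proof (rule subsI)
          fix z assume "z \<E> x"
          then show "z \<E> y" using IHx[of z] o n ord_mem[of x z] ord_mem_trans[of x y z] by blast
        qed
        moreover have "subs y x"
        proof (rule subsI)
          fix z assume "z \<E> y"
          then show "z \<E> x" using IHy[of z] o n ord_mem[of y z] ord_mem_trans[of y x z] by blast
        qed
        ultimately show False using n subs_antisym by blast
      qed
    qed
    then show "ALL y. ?L x y" by blast
  qed
  then show "ord x ==> ord y ==> x \<E> y \<or> x = y \<or> y \<E> x" by blast
qed

lemma ord_subs: "ord x ==> ord y ==> subs x y \<longleftrightarrow> x \<E> y \<or> x = y"
  using ord_linear[of x y] not_mem_self[of y] ord_mem_trans[of y _ x] unfolding subs_def by blast

lemma ord_emp [simp]: "ord emp"
  unfolding ord_def trans'_def by simp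

lemma ordI: "(\<And>y z. y \<E> x ==> z \<E> y ==> z \<E> x) ==> (\<And>y. y \<E> x ==> ord y) ==> ord x"
  unfolding ord_def[of x] trans'_def[of x] subs_def by (simp add: ord_def)

lemma ord_suc [simp]:
  assumes "ord x"
  shows "ord (suc x)"
proof (rule ordI)
  show "z \<E> suc x" if "y \<E> suc x" "z \<E> y" for y z
    using that ord_mem_trans[OF assms, of z y] by auto
  show "ord y" if "y \<E> suc x" for y using that assms ord_mem[OF assms] by auto
qed

lemma ord_un:
  assumes "\<And>x. x \<E> a ==> ord x"
  shows "ord (un a)"
proof (rule ordI)
  fix y z assume "y \<E> un a" "z \<E> y"
  then obtain x where "x \<E> a" "y \<E> x" by auto
  then have "z \<E> x" using ord_mem_trans[OF assms \<open>z \<E> y\<close>] by blast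
  then show "z \<E> un a" using \<open>x \<E> a\<close> by auto
next
  fix y assume "y \<E> un a"
  then show "ord y" using ord_mem assms by auto
qed

lemma ord_omega [simp]: "ord omega"
  unfolding ord_def using trans_omega_mem omega_trans unfolding trans'_def[of omega] by blast

lemma ord_omega_mem: "n \<E> omega ==> ord n"
  using ord_mem ord_omega by blast

text \<open>Built from \<open>the1\<close>, so that the least ordinal with a property definable
  without parameters is itself definable without parameters. Parameters are eliminated through
  this.\<close>

definition least :: "('a \<Rightarrow> bool) \<Rightarrow> 'a"
  where "least Q = the1 (%x. ord x & Q x & (ALL y. y \<E> x --> \<not> Q y))"

lemma dfun_least [dintros]:
  assumes "dfp P (%e. Q (%n. e (Suc n)) (e 0))"
  shows "dfun P (%e. least (Q e))"
proof -
  have "dfp P (%e. Q (%n. e (f n)) (e i))" for i f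
    using dfp_ren[OF assms, of "i ## f"] by simp
  then show ?thesis unfolding least_def by (intro dintros)
qed

lemma least:
  assumes Q: "dfp UNIV (%e. Q (e 0))" and "ord x" "Q x"
  shows "ord (least Q)" "Q (least Q)" "\<And>y. y \<E> least Q ==> \<not> Q y" "subs (least Q) x"
proof -
  have "EX x. ord x & Q x & (ALL y. y \<E> x --> \<not> Q y)"
  proof (rule ccontr)
    assume n: "\<not> ?thesis"
    have "ord x --> \<not> Q x"
    proof (rule eps_induct[of "%x. ord x --> \<not> Q x"])
      show "dfp UNIV (%e. ord (e 0) --> \<not> Q (e 0))" by (intro dintros Q)
    qed (use n ord_mem in blast)
    then show False using assms by blast
  qed
  then obtain y where y: "ord y" "Q y" "\<And>z. z \<E> y ==> \<not> Q z" by blast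
  have e: "least Q = y" unfolding least_def
  proof (rule the1_eq)
    fix z assume "ord z & Q z & (ALL y. y \<E> z --> \<not> Q y)"
    then show "z = y" using ord_linear[of z y] y by blast
  qed (use y in blast)
  show "ord (least Q)" "Q (least Q)" "\<And>y. y \<E> least Q ==> \<not> Q y" unfolding e using y by auto
  show "subs (least Q) x" unfolding e using ord_linear[of x y] y assms ord_subs[of y x] by blast
qed

lemma ord_bound:
  assumes F: "dfun UNIV (%e. F (e 0))" and o: "\<And>x. x \<E> a ==> ord (F x)"
  obtains b where "ord b" "\<And>x. x \<E> a ==> F x \<E> b"
proof -
  have r: "isset (%y. EX x. x \<E> a & y = suc (F x))"
    by (rule isset_repl[of "%x. suc (F x)"]) (intro dintros F)
  let ?b = "un (Coll (%y. EX x. x \<E> a & y = suc (F x)))"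
  show thesis
  proof (rule that[of ?b])
    show "ord ?b" by (rule ord_un) (use o in \<open>auto simp: mem_Coll[OF r]\<close>)
    show "F x \<E> ?b" if "x \<E> a" for x using that by (auto simp: mem_Coll[OF r])
  qed
qed

subsection \<open>Rank and the cumulative hierarchy\<close>

definition isrk :: "'a \<Rightarrow> 'a \<Rightarrow> bool"
  where "isrk x b \<longleftrightarrow> (EX T f. trans' T & x \<E> T & isfun f T &
    (ALL y. y \<E> T --> (ALL v. opair y v \<E> f -->
      (ALL u. u \<E> v \<longleftrightarrow> (EX z. z \<E> y & (EX w. opair z w \<E> f & (u \<E> w \<or> u = w)))))) &
    opair x b \<E> f)"

definition rk :: "'a \<Rightarrow> 'a"
  where "rk x = the1 (isrk x)"

lemma dfp_isrk [dintros]: "dfun P t ==> dfun P u ==> dfp P (%e. isrk (t e) (u e))"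
  by (rule dsub2) (unfold isrk_def, intro dintros)

lemma dfun_rk [dintros]: "dfun P t ==> dfun P (%e. rk (t e))"
  by (rule dsubf1) (unfold rk_def, intro dintros)

lemma holds_rank: "holds E e (rank_fm x b) \<longleftrightarrow> isrk (e x) (e b)"
  unfolding rank_fm_def isrk_def by (simp add: numeral_eq_Suc)

text \<open>The recursion yields a rank function \<open>F\<close> on all sets. Every witness in
  \<open>isrk\<close> agrees with \<open>F\<close> by induction, and conversely the restriction of
  \<open>F\<close> to \<open>x\<close> and \<open>TC x\<close> is a witness.\<close>

lemma isrk_rec: "EX F. ALL x. (ALL b. isrk x b \<longleftrightarrow> b = F x) &
    (ALL u. u \<E> F x \<longleftrightarrow> (EX z. z \<E> x & (u \<E> F z \<or> u = F z)))"
proof -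
  let ?G = "%x f. Coll (%u. EX z. z \<E> x & u \<E> suc (app f z))"
  obtain F where F: "dfun UNIV (%e. F (e 0))" "\<And>x. F x = ?G x (lam (TC x) F)"
    by (rule TC_rec[of ?G]) (intro dintros, blast)
  have F2: "u \<E> F x \<longleftrightarrow> (EX z. z \<E> x & (u \<E> F z \<or> u = F z))" for u x
  proof -
    have "isset (%u. EX z. z \<E> x & u \<E> suc (app (lam (TC x) F) z))"
      by (rule isset_UN) (intro dintros)
    then have "u \<E> F x \<longleftrightarrow> (EX z. z \<E> x & u \<E> suc (app (lam (TC x) F) z))"
      using F(2)[of x] mem_Coll by simp
    moreover have "app (lam (TC x) F) z = F z" if "z \<E> x" for z
      by (rule app_lam[OF F(1)]) (rule TC_mem[OF that])
    ultimately show ?thesis by auto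
  qed
  have "isrk x b \<longleftrightarrow> b = F x" for x b
  proof
    assume "isrk x b"
    then obtain T f where T: "trans' T" "x \<E> T" "isfun f T" "opair x b \<E> f"
      and f: "\<And>y v u. y \<E> T ==> opair y v \<E> f ==>
        u \<E> v \<longleftrightarrow> (EX z. z \<E> y & (EX w. opair z w \<E> f & (u \<E> w \<or> u = w)))"
      unfolding isrk_def by blast
    have "y \<E> T --> app f y = F y" for y
    proof (rule eps_induct[of "%y. y \<E> T --> app f y = F y"])
      show "dfp UNIV (%e. e 0 \<E> T --> app f (e 0) = F (e 0))" by (intro dintros dsubf1[OF F(1)])
      fix y assume IH: "\<And>z. z \<E> y ==> z \<E> T --> app f z = F z"
      show "y \<E> T --> app f y = F y"
      proof
        assume y: "y \<E> T"
        then have z: "z \<E> T" if "z \<E> y" for z using that T(1) unfolding trans'_def subs_def by blast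
        have "u \<E> app f y \<longleftrightarrow> (EX z. z \<E> y & (EX w. opair z w \<E> f & (u \<E> w \<or> u = w)))" for u
          using f[OF y] app_eq[OF T(3) y] by blast
        also have "\<dots> u \<longleftrightarrow> (EX z. z \<E> y & (u \<E> F z \<or> u = F z))" for u
          using z IH app_eq[OF T(3)] by metis
        finally show "app f y = F y" unfolding F2[symmetric] by (rule extensional)
      qed
    qed
    then show "b = F x" using T app_eq[OF T(3,2)] by simp
  next
    assume b: "b = F x"
    let ?T = "un (upr (upr x x) (TC x))"
    have T: "y \<E> ?T \<longleftrightarrow> y = x \<or> y \<E> TC x" for y by auto
    have l: "opair y v \<E> lam ?T F \<longleftrightarrow> y \<E> ?T & v = F y" for y v
      unfolding mem_lam[OF F(1)] by auto
    have 1: "trans' ?T" unfolding trans'_def subs_def T using TC_mem TC_step by blast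
    show "isrk x b" unfolding isrk_def
    proof (rule exI[of _ ?T], rule exI[of _ "lam ?T F"], intro conjI 1 isfun_lam[OF F(1)] allI impI)
      show "x \<E> ?T" unfolding T by simp
      then show "opair x b \<E> lam ?T F" unfolding l using b by simp
      fix y v u assume y: "y \<E> ?T" and "opair y v \<E> lam ?T F"
      then have v: "v = F y" unfolding l by simp
      have z: "z \<E> ?T" if "z \<E> y" for z using 1 y that unfolding trans'_def subs_def by blast
      show "u \<E> v \<longleftrightarrow> (EX z. z \<E> y & (EX w. opair z w \<E> lam ?T F & (u \<E> w \<or> u = w)))"
        unfolding v l F2[of u y] using z by blast
    qed
  qed
  then show ?thesis using F2 by blast
qed

lemma isrk_iff: "isrk x b \<longleftrightarrow> b = rk x"
proof -
  obtain F where F: "\<And>x b. isrk x b \<longleftrightarrow> b = F x" using isrk_rec by blast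
  then have "rk x = F x" unfolding rk_def by (intro the1_eq) simp_all
  then show ?thesis using F by simp
qed

lemma mem_rk: "u \<E> rk x \<longleftrightarrow> (EX z. z \<E> x & (u \<E> rk z \<or> u = rk z))"
proof -
  obtain F where F: "\<And>x b. isrk x b \<longleftrightarrow> b = F x"
    and F2: "\<And>x u. u \<E> F x \<longleftrightarrow> (EX z. z \<E> x & (u \<E> F z \<or> u = F z))" using isrk_rec by blast
  have "F x = rk x" for x using F isrk_iff by blast
  then show ?thesis using F2[of u x] by simp
qed

lemma ord_rk [simp]: "ord (rk x)"
proof (rule eps_induct[of "%x. ord (rk x)"])
  show "dfp UNIV (%e. ord (rk (e 0)))" by (intro dintros)
  fix x assume IH: "\<And>y. y \<E> x ==> ord (rk y)"
  show "ord (rk x)" unfolding ord_def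
  proof
    show "trans' (rk x)" unfolding trans'_def subs_def
    proof (intro allI impI)
      fix y z assume "y \<E> rk x" "z \<E> y"
      then show "z \<E> rk x" using IH unfolding mem_rk[of _ x] by (metis ord_mem_trans)
    qed
    show "ALL y. y \<E> rk x --> trans' y"
      using IH ord_mem unfolding mem_rk[of _ x] ord_def by blast
  qed
qed

lemma rk_mem: "y \<E> x ==> rk y \<E> rk x"
  unfolding mem_rk[of _ x] by blast

lemma rk_ord: "ord x ==> rk x = x"
proof -
  have "ord x --> rk x = x"
  proof (rule eps_induct[of "%x. ord x --> rk x = x"])
    show "dfp UNIV (%e. ord (e 0) --> rk (e 0) = e 0)" by (intro dintros)
    fix x assume IH: "\<And>y. y \<E> x ==> ord y --> rk y = y"
    show "ord x --> rk x = x"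
    proof
      assume o: "ord x"
      then have e: "rk z = z" if "z \<E> x" for z using that IH ord_mem by blast
      show "rk x = x"
        by (rule extensional) (metis e mem_rk o ord_mem_trans)
    qed
  qed
  then show "ord x ==> rk x = x" by blast
qed

definition V :: "'a \<Rightarrow> 'a"
  where "V a = Coll (%x. rk x \<E> a)"

lemma dfun_V [dintros]: "dfun P t ==> dfun P (%e. V (t e))"
  by (rule dsubf1) (unfold V_def, intro dintros)

text \<open>That the comprehension in \<open>V a\<close> is a set is the content: by induction,
  everything of rank below \<open>a\<close> lies in the union of the power sets of
  \<open>V b\<close> for \<open>b\<close> in \<open>a\<close>.\<close>

lemma mem_V: "ord a ==> x \<E> V a \<longleftrightarrow> rk x \<E> a"
proof -
  have "ord a --> (ALL x. x \<E> V a \<longleftrightarrow> rk x \<E> a)" for a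
  proof (rule eps_induct[of "%a. ord a --> (ALL x. x \<E> V a \<longleftrightarrow> rk x \<E> a)"])
    show "dfp UNIV (%e. ord (e 0) --> (ALL x. x \<E> V (e 0) \<longleftrightarrow> rk x \<E> e 0))" by (intro dintros)
    fix a assume IH: "\<And>b. b \<E> a ==> ord b --> (ALL x. x \<E> V b \<longleftrightarrow> rk x \<E> b)"
    show "ord a --> (ALL x. x \<E> V a \<longleftrightarrow> rk x \<E> a)"
    proof (intro impI allI)
      fix x assume "ord a"
      then have IH: "x \<E> V b \<longleftrightarrow> rk x \<E> b" if "b \<E> a" for b x using that IH ord_mem by blast
      have "isset (%x. EX b. b \<E> a & x \<E> pow (V b))"
        by (rule isset_UN) (intro dintros)
      then have "isset (%x. rk x \<E> a)"
      proof (rule isset_sub)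
        fix x assume "rk x \<E> a"
        moreover have "subs x (V (rk x))" unfolding subs_def using IH[OF \<open>rk x \<E> a\<close>] rk_mem by blast
        ultimately show "EX b. b \<E> a & x \<E> pow (V b)" by auto
      qed (intro dintros)
      then show "x \<E> V a \<longleftrightarrow> rk x \<E> a" unfolding V_def by (rule mem_Coll)
    qed
  qed
  then show "ord a ==> x \<E> V a \<longleftrightarrow> rk x \<E> a" by blast
qed

lemma holds_Vset: "ord (e z) ==> holds E e (Vset_fm v z) \<longleftrightarrow> e v = V (e z)"
proof -
  have "(ALL x. x \<E> y \<longleftrightarrow> rk x \<E> a) \<longleftrightarrow> y = V a" if "ord a" for y a
    using mem_V[OF that] by (auto intro: extensional)
  then show "ord (e z) ==> ?thesis"
    unfolding Vset_fm_def by (simp add: holds_rank isrk_iff)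
qed

lemma V_mono: "ord b ==> a \<E> b ==> x \<E> V a ==> x \<E> V b"
  using mem_V ord_mem ord_mem_trans by metis

lemma V_rk: "x \<E> V (suc (rk x))"
  by (simp add: mem_V)

subsection \<open>Countable sets\<close>

definition cntby :: "'a \<Rightarrow> 'a \<Rightarrow> bool"
  where "cntby x f \<longleftrightarrow> isfun f x & (ALL y. y \<E> x --> app f y \<E> omega) &
    (ALL y. y \<E> x --> (ALL z. z \<E> x --> app f y = app f z --> y = z))"

definition cnt :: "'a \<Rightarrow> bool"
  where "cnt x \<longleftrightarrow> (EX f. cntby x f)"

lemma dfp_cntby [dintros]: "dfun P t ==> dfun P u ==> dfp P (%e. cntby (t e) (u e))"
  by (rule dsub2) (unfold cntby_def, intro dintros)

lemma dfp_cnt [dintros]: "dfun P t ==> dfp P (%e. cnt (t e))"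
  by (rule dsub1) (unfold cnt_def, intro dintros)

lemma cntby_inj: "cntby x f ==> y \<E> x ==> z \<E> x ==> app f y = app f z ==> y = z"
  unfolding cntby_def by blast

lemma cntby_omega: "cntby x f ==> y \<E> x ==> app f y \<E> omega"
  unfolding cntby_def by blast

lemma holds_countable [simp]: "holds E e (countable_fm x) \<longleftrightarrow> cnt (e x)"
proof -
  have "(isfun f X & (ALL x. x \<E> X --> app f x \<E> omega)) &
     (ALL x. x \<E> X --> (ALL y. y \<E> X --> (ALL z. opair x z \<E> f & opair y z \<E> f --> x = y))) \<longleftrightarrow> cntby X f" for f X
  proof (cases "isfun f X")
    case True
    have "(ALL z. opair x z \<E> f & opair y z \<E> f --> x = y) \<longleftrightarrow> (app f x = app f y --> x = y)"
      if "x \<E> X" "y \<E> X" for x y using app_eq[OF True] that by auto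
    then show ?thesis unfolding cntby_def by simp
  qed (simp add: cntby_def)
  then show ?thesis unfolding countable_fm_def cnt_def by (simp add: numeral_eq_Suc)
qed

lemma cntI:
  assumes F: "dfun UNIV (%e. F (e 0))" and "\<And>y. y \<E> x ==> F y \<E> omega"
    and "\<And>y z. y \<E> x ==> z \<E> x ==> F y = F z ==> y = z"
  shows "cnt x"
  unfolding cnt_def cntby_def
  by (rule exI[of _ "lam x F"]) (use assms isfun_lam[OF F] app_lam[OF F] in auto)

text \<open>Every element is sent to the least index of a preimage, so no choice is
  involved.\<close>

lemma cnt_image:
  assumes "cnt a" and F: "dfun UNIV (%e. F (e 0))" and x: "\<And>y. y \<E> x ==> EX z. z \<E> a & y = F z"
  shows "cnt x"
proof -
  obtain f where f: "cntby a f" using \<open>cnt a\<close> unfolding cnt_def by blast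
  let ?Q = "%y n. EX z. z \<E> a & app f z = n & y = F z"
  have Q: "dfp UNIV (%e. ?Q y (e 0))" for y by (intro dintros dsubf1[OF F])
  have l: "?Q y (least (?Q y))" if y: "y \<E> x" for y
  proof -
    obtain z where "z \<E> a" "y = F z" using x[OF y] by blast
    then show ?thesis using f ord_omega_mem by (intro least(2)[OF Q, of "app f z"]) (auto simp: cntby_def)
  qed
  show ?thesis
  proof (rule cntI[of "%y. least (?Q y)"])
    show "dfun UNIV (%e. least (?Q (e 0)))" by (intro dintros dsubf1[OF F])
    show "least (?Q y) \<E> omega" if "y \<E> x" for y
      using l[OF that] cntby_omega[OF f] by metis
    show "y = z" if "y \<E> x" "z \<E> x" "least (?Q y) = least (?Q z)" for y z
      using l[OF that(1)] l[OF that(2)] that(3) cntby_inj[OF f] by metis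
  qed
qed

lemma cnt_subset: "cnt a ==> (\<And>y. y \<E> x ==> y \<E> a) ==> cnt x"
  by (rule cnt_image[of a "%x. x"]) (auto intro: dintros)

lemma cnt_omega: "cnt omega"
  by (rule cntI[of "%x. x"]) (auto intro: dintros)

lemma cnt_upr: "cnt (upr a b)"
  by (rule cntI[of "%x. if x = a then emp else suc emp"]) (intro dintros, auto split: if_splits simp: suc_not_emp[symmetric])

section \<open>A pairing function on the natural numbers\<close>

definition pairing :: "('a \<Rightarrow> 'a \<Rightarrow> 'a) \<Rightarrow> bool"
  where "pairing p \<longleftrightarrow> dfun UNIV (%e. p (e 0) (e 1)) &
    (ALL m n. m \<E> omega --> n \<E> omega --> p m n \<E> omega) &
    (ALL m n m' n'. m \<E> omega --> n \<E> omega --> m' \<E> omega --> n' \<E> omega -->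
      p m n = p m' n' --> m = m' & n = n')"

lemma pairingD:
  assumes "pairing p"
  shows "dfun UNIV (%e. p (e 0) (e 1))"
    "\<And>m n. m \<E> omega ==> n \<E> omega ==> p m n \<E> omega"
    "\<And>m n m' n'. m \<E> omega ==> n \<E> omega ==> m' \<E> omega ==> n' \<E> omega ==>
      p m n = p m' n' ==> m = m' & n = n'"
  using assms unfolding pairing_def by blast+

text \<open>The function is 2^m (2n + 1): \<open>d\<close> doubles, and \<open>q n\<close> starts
  from \<open>suc (d n)\<close> and doubles at each step. The exponent is determined because a
  double is never the successor of a double (\<open>dodd\<close>).\<close>

lemma ex_pairing: "EX p. pairing p"
proof -
  obtain D where D: "dfun UNIV (%e. D (e 0) (e 1))" and D0: "\<And>x. D x emp = x"
    and DS: "\<And>x n. n \<E> omega ==> D x (suc n) = suc (suc (D x n))"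
    by (rule omega_rec[of "%x. x" "%x. suc (suc x)"]) (intro dintros, intro dintros, blast)
  define d where "d n = D emp n" for n
  have dd: "dfun UNIV (%e. d (e 0))" unfolding d_def by (intro dsubf2[OF D] dintros)
  note dd1 = dsubf1[OF dd]
  have d0: "d emp = emp" and dS: "\<And>n. n \<E> omega ==> d (suc n) = suc (suc (d n))"
    unfolding d_def using D0 DS by auto
  have dw: "d n \<E> omega" if "n \<E> omega" for n
    by (rule omega_induct[OF that]) (intro dintros dd1, auto simp: d0 dS)
  have dinj: "ALL m. m \<E> omega --> d n = d m --> n = m" if "n \<E> omega" for n
  proof (rule omega_induct[OF that])
    show "dfp UNIV (%e. ALL m. m \<E> omega --> d (e 0) = d m --> e 0 = m)" by (intro dintros dd1)
    show "ALL m. m \<E> omega --> d emp = d m --> emp = m"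
      using omega_cases d0 dS suc_not_emp by metis
    show "ALL m. m \<E> omega --> d (suc n) = d m --> suc n = m"
      if "n \<E> omega" "ALL m. m \<E> omega --> d n = d m --> n = m" for n
      using that omega_cases d0 dS suc_not_emp suc_inject by metis
  qed
  have dodd: "ALL m. m \<E> omega --> d n \<noteq> suc (d m)" if "n \<E> omega" for n
  proof (rule omega_induct[OF that])
    show "dfp UNIV (%e. ALL m. m \<E> omega --> d (e 0) \<noteq> suc (d m))" by (intro dintros dd1)
    show "ALL m. m \<E> omega --> d emp \<noteq> suc (d m)" using d0 suc_not_emp by metis
    show "ALL m. m \<E> omega --> d (suc n) \<noteq> suc (d m)"
      if "n \<E> omega" "ALL m. m \<E> omega --> d n \<noteq> suc (d m)" for n
      using that omega_cases d0 dS suc_not_emp suc_inject by metis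
  qed
  obtain q where q: "dfun UNIV (%e. q (e 0) (e 1))" and q0: "\<And>x. q x emp = suc (d x)"
    and qS: "\<And>x n. n \<E> omega ==> q x (suc n) = d (q x n)"
    by (rule omega_rec[of "%x. suc (d x)" d]) (intro dintros dd1, intro dintros dd1, blast)
  have qw: "q n m \<E> omega" if "m \<E> omega" "n \<E> omega" for m n
    by (rule omega_induct[OF that(1)]) (intro dintros dsubf2[OF q], auto simp: q0 qS dw that)
  have qinj: "ALL n m' n'. n \<E> omega --> m' \<E> omega --> n' \<E> omega --> q n m = q n' m' --> m = m' & n = n'"
    if "m \<E> omega" for m
  proof (rule omega_induct[OF that])
    show "dfp UNIV (%e. ALL n m' n'. n \<E> omega --> m' \<E> omega --> n' \<E> omega -->
        q n (e 0) = q n' m' --> e 0 = m' & n = n')" by (intro dintros dsubf2[OF q])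
    show "ALL n m' n'. n \<E> omega --> m' \<E> omega --> n' \<E> omega --> q n emp = q n' m' --> emp = m' & n = n'"
    proof (intro allI impI)
      fix n m' n' assume a: "n \<E> omega" "m' \<E> omega" "n' \<E> omega" "q n emp = q n' m'"
      show "emp = m' & n = n'"
      proof (cases "m' = emp")
        case True
        then show ?thesis using a q0 dinj by simp
      next
        case False
        then obtain k where "k \<E> omega" "m' = suc k" using a omega_cases by blast
        then have "d (q n' k) = suc (d n)" using a q0 qS by simp
        then show ?thesis using dodd qw[of k n'] a \<open>k \<E> omega\<close> by blast
      qed
    qed
    fix m assume m: "m \<E> omega" and IH: "ALL n m' n'. n \<E> omega --> m' \<E> omega --> n' \<E> omega --> q n m = q n' m' --> m = m' & n = n'"
    show "ALL n m' n'. n \<E> omega --> m' \<E> omega --> n' \<E> omega --> q n (suc m) = q n' m' --> suc m = m' & n = n'"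
    proof (intro allI impI)
      fix n m' n' assume a: "n \<E> omega" "m' \<E> omega" "n' \<E> omega" "q n (suc m) = q n' m'"
      have s: "q n (suc m) = d (q n m)" using m qS by simp
      show "suc m = m' & n = n'"
      proof (cases "m' = emp")
        case True
        then have "d (q n m) = suc (d n')" using a s q0 by simp
        then show ?thesis using dodd[of "q n m"] qw[of m n] a m by blast
      next
        case False
        then obtain k where k: "k \<E> omega" "m' = suc k" using a omega_cases by blast
        then have "d (q n m) = d (q n' k)" using a s qS by simp
        then have "q n m = q n' k" using dinj qw m k a by blast
        then show ?thesis using IH a k by blast
      qed
    qed
  qed
  have "dfun UNIV (%e. q (e 1) (e 0))" by (intro dintros dsubf2[OF q])
  then have "pairing (%m n. q n m)" unfolding pairing_def using qw qinj by blast
  then show ?thesis by (rule exI[of pairing])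
qed

lemma cnt_times: "cnt a ==> cnt b ==> cnt (times a b)"
proof -
  assume "cnt a" "cnt b"
  then obtain f g where f: "cntby a f" and g: "cntby b g" unfolding cnt_def by blast
  obtain p where "pairing p" using ex_pairing by blast
  note p = pairingD[OF this]
  show ?thesis
  proof (rule cntI[of "%x. p (app f (fst' x)) (app g (snd' x))"])
    show "dfun UNIV (%e. p (app f (fst' (e 0))) (app g (snd' (e 0))))"
      by (intro dintros dsubf2[OF p(1)])
    show "p (app f (fst' y)) (app g (snd' y)) \<E> omega" if "y \<E> times a b" for y
      using that p(2) f g unfolding mem_times cntby_def by auto
    fix y z assume y: "y \<E> times a b" and z: "z \<E> times a b"
      and e: "p (app f (fst' y)) (app g (snd' y)) = p (app f (fst' z)) (app g (snd' z))"
    obtain y1 y2 z1 z2 where m: "y = opair y1 y2" "z = opair z1 z2" "y1 \<E> a" "z1 \<E> a" "y2 \<E> b" "z2 \<E> b"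
      using y z unfolding mem_times by blast
    then have "app f y1 = app f z1 & app g y2 = app g z2"
      using p(3)[of "app f y1" "app g y2" "app f z1" "app g z2"] e cntby_omega[OF f] cntby_omega[OF g] by simp
    then show "y = z" using m cntby_inj[OF f] cntby_inj[OF g] by metis
  qed
qed

text \<open>Choice enters here: \<open>J x\<close> is the set of all injections of \<open>x\<close>
  into \<open>omega\<close>, and one is selected for each member of \<open>a\<close>
  simultaneously.\<close>

lemma cnt_un:
  assumes "cnt a" and c: "\<And>x. x \<E> a ==> cnt x"
  shows "cnt (un a)"
proof -
  obtain f where f: "cntby a f" using \<open>cnt a\<close> unfolding cnt_def by blast
  obtain p where "pairing p" using ex_pairing by blast
  note p = pairingD[OF this]
  define J where "J x = Coll (cntby x)" for x
  have dJ: "dfun UNIV (%e. J (e 0))" unfolding J_def by (intro dintros)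
  have J: "h \<E> J x \<longleftrightarrow> cntby x h" for h x
  proof -
    have "isset (cntby x)"
    proof (rule isset_sub[OF isset_mem[of "pow (times x omega)"]])
      fix h assume "cntby x h"
      then show "h \<E> pow (times x omega)"
        unfolding cntby_def by (auto simp: subs_def isfun_mem)
    qed (intro dintros)
    then show ?thesis unfolding J_def by (rule mem_Coll)
  qed
  have "isset (%y. EX x. x \<E> a & y = J x)" by (rule isset_repl[OF dJ])
  then obtain K where K: "\<And>y. y \<E> K \<longleftrightarrow> (EX x. x \<E> a & y = J x)" unfolding isset_def by blast
  have "y \<noteq> emp" if "y \<E> K" for y
    using that c J mem_emp unfolding K cnt_def by metis
  then obtain g where g: "\<And>y. y \<E> K ==> app g y \<E> y" using ax_choice[of K] by metis
  have G: "cntby x (app g (J x))" if "x \<E> a" for x using g[of "J x"] that J K by blast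
  let ?Q = "%y n. EX x. x \<E> a & app f x = n & y \<E> x"
  \<comment> \<open>Among the members of \<open>a\<close> that contain \<open>y\<close>, the one
    with the least index under \<open>f\<close>. The code of \<open>y\<close> pairs this index with
    the place of \<open>y\<close> in that member.\<close>
  define X where "X y = the1 (%x. x \<E> a & app f x = least (?Q y))" for y
  have dX: "dfun UNIV (%e. X (e 0))" unfolding X_def by (intro dintros)
  have X: "X y \<E> a" "y \<E> X y" if y: "y \<E> un a" for y
  proof -
    obtain x where "x \<E> a" "y \<E> x" using y by auto
    then have "?Q y (least (?Q y))"
      using f ord_omega_mem by (intro least(2)[of "?Q y" "app f x"]) (intro dintros, auto simp: cntby_def)
    then obtain z where z: "z \<E> a" "app f z = least (?Q y)" "y \<E> z" by blast
    then have "X y = z" unfolding X_def using cntby_inj[OF f] by (intro the1_eq) auto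
    then show "X y \<E> a" "y \<E> X y" using z by auto
  qed
  show ?thesis
  proof (rule cntI[of "%y. p (app f (X y)) (app (app g (J (X y))) y)"])
    show "dfun UNIV (%e. p (app f (X (e 0))) (app (app g (J (X (e 0)))) (e 0)))"
      by (intro dsubf2[OF p(1)] dintros dsubf1[OF dX] dsubf1[OF dJ])
    show "p (app f (X y)) (app (app g (J (X y))) y) \<E> omega" if "y \<E> un a" for y
      using p(2) cntby_omega[OF f X(1)[OF that]] cntby_omega[OF G[OF X(1)[OF that]] X(2)[OF that]] by blast
    fix y z assume y: "y \<E> un a" and z: "z \<E> un a"
      and e: "p (app f (X y)) (app (app g (J (X y))) y) = p (app f (X z)) (app (app g (J (X z))) z)"
    have "app f (X y) = app f (X z) & app (app g (J (X y))) y = app (app g (J (X z))) z"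
      using cntby_omega[OF f X(1)[OF y]] cntby_omega[OF G[OF X(1)[OF y]] X(2)[OF y]]
        cntby_omega[OF f X(1)[OF z]] cntby_omega[OF G[OF X(1)[OF z]] X(2)[OF z]] e by (intro p(3))
    moreover from this have "X y = X z" using cntby_inj[OF f] X(1) y z by blast
    ultimately show "y = z" using cntby_inj[OF G[OF X(1)[OF y]] X(2)[OF y], of z] X(2)[OF z] by simp
  qed
qed

lemma cnt_UN:
  assumes "cnt a" and F: "dfun UNIV (%e. F (e 0))" and c: "\<And>x. x \<E> a ==> cnt (F x)"
    and y: "\<And>y. y \<E> b ==> EX x. x \<E> a & y \<E> F x"
  shows "cnt b"
proof -
  have "isset (%y. EX x. x \<E> a & y = F x)" using F by (rule isset_repl)
  then obtain K where K: "\<And>y. y \<E> K \<longleftrightarrow> (EX x. x \<E> a & y = F x)" unfolding isset_def by blast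
  have "cnt K" by (rule cnt_image[OF \<open>cnt a\<close> F]) (simp add: K)
  then have "cnt (un K)" by (rule cnt_un) (use c K in auto)
  then show ?thesis
  proof (rule cnt_subset)
    fix z assume "z \<E> b"
    then obtain x where "x \<E> a" "z \<E> F x" using y by blast
    then show "z \<E> un K" using K[of "F x"] by auto
  qed
qed

text \<open>Internal formulas are built from natural numbers by pairing alone, so such a set bounds
  them all. It is obtained by adding all pairs of elements, \<open>omega\<close> times.\<close>

lemma ex_countable_pair_closed:
  obtains h where "cnt h" "\<And>n. n \<E> omega ==> n \<E> h" "\<And>x y. x \<E> h ==> y \<E> h ==> opair x y \<E> h"
proof -
  obtain F where F: "dfun UNIV (%e. F (e 0) (e 1))" and F0: "\<And>x. F x emp = x"
    and FS: "\<And>x n. n \<E> omega ==> F x (suc n) = un (upr (F x n) (times (F x n) (F x n)))"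
    by (rule omega_rec[of "%x. x" "%x. un (upr x (times x x))"]) (intro dintros, intro dintros, blast)
  define G where "G n = F omega n" for n
  have dG: "dfun UNIV (%e. G (e 0))" unfolding G_def by (intro dsubf2[OF F] dintros)
  have G0: "G emp = omega" and GS: "\<And>n. n \<E> omega ==> G (suc n) = un (upr (G n) (times (G n) (G n)))"
    unfolding G_def using F0 FS by auto
  have c: "cnt (G n)" if "n \<E> omega" for n
  proof (rule omega_induct[OF that])
    show "dfp UNIV (%e. cnt (G (e 0)))" by (intro dintros dG)
    show "cnt (G emp)" using G0 cnt_omega by simp
    show "cnt (G (suc n))" if "n \<E> omega" "cnt (G n)" for n
      unfolding GS[OF that(1)] by (rule cnt_un[OF cnt_upr]) (use that cnt_times in auto)
  qed
  have mono: "ALL m. m \<E> n --> subs (G m) (G n)" if "n \<E> omega" for n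
  proof (rule omega_induct[OF that])
    show "dfp UNIV (%e. ALL m. m \<E> e 0 --> subs (G m) (G (e 0)))" by (intro dintros dsubf1[OF dG])
    show "ALL m. m \<E> suc n --> subs (G m) (G (suc n))"
      if "n \<E> omega" "ALL m. m \<E> n --> subs (G m) (G n)" for n
      using that GS unfolding subs_def by auto
  qed simp
  have "isset (%x. EX n. n \<E> omega & x \<E> G n)" by (rule isset_UN[OF dG])
  then obtain h where h: "\<And>x. x \<E> h \<longleftrightarrow> (EX n. n \<E> omega & x \<E> G n)" unfolding isset_def by blast
  show thesis
  proof (rule that[of h])
    show "cnt h" by (rule cnt_UN[OF cnt_omega dG c]) (use h in auto)
    show "n \<E> h" if "n \<E> omega" for n unfolding h using that G0 zero_omega by metis
    fix x y assume "x \<E> h" "y \<E> h"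
    then obtain m n where mn: "m \<E> omega" "n \<E> omega" "x \<E> G m" "y \<E> G n" unfolding h by blast
    have "EX k. k \<E> omega & x \<E> G k & y \<E> G k"
      using ord_linear[OF ord_omega_mem ord_omega_mem, of m n] mn mono unfolding subs_def by blast
    then obtain k where k: "k \<E> omega" "x \<E> G k" "y \<E> G k" by blast
    then have "opair x y \<E> G (suc k)" using GS by auto
    then show "opair x y \<E> h" unfolding h using k suc_omega by blast
  qed
qed

subsection \<open>Reflection\<close>

text \<open>A collection principle: \<open>S e a b\<close> is read as "\<open>b\<close> is a large
  enough bound for \<open>e\<close>", and one bound is found for all environments in
  \<open>V a\<close>. The induction on the number \<open>k\<close> of relevant variables absorbs one
  of them by taking a supremum over \<open>V a\<close>; monotonicity in \<open>b\<close> lets this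
  supremum serve every value. Since the absorbed variable ranges over \<open>V a\<close>, the
  relation has to carry \<open>a\<close> as an argument.\<close>

lemma collect:
  assumes "dfp UNIV (%e. S (%n. e (Suc (Suc n))) (e 1) (e 0))"
    and "\<And>e e' a b. (\<And>i. i < k ==> e i = e' i) ==> S e a b = S e' a b"
    and "\<And>e a. ord a ==> EX b. ord b & S e a b"
    and "\<And>e a b c. S e a b ==> ord c ==> subs b c ==> S e a c"
  shows "EX h. dfun UNIV (%e. h (e 0)) &
    (ALL a. ord a --> ord (h a) & (ALL e. (ALL i. e i \<E> V a) --> S e a (h a)))"
  using assms
proof (induction k arbitrary: S)
  case 0
  have T: "dfun UNIV (((%e. e 0) ## (%e. e 1) ## (%i e. emp)) i)" for i
    by (auto intro!: dintros split: nat.split)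
  have d: "dfp UNIV (%e. S (%n. emp) (e 1) (e 0))"
    using dfp_subst[OF "0.prems"(1), of "(%e. e 0) ## (%e. e 1) ## (%i e. emp)", OF T] by simp
  show ?case
  proof (rule exI[of _ "%a. least (S (%_. emp) a)"], intro conjI allI impI)
    show "dfun UNIV (%e. least (S (%_. emp) (e 0)))"
      by (intro dintros) (use d in simp)
    fix a assume a: "ord a"
    obtain b where b: "ord b" "S (%_. emp) a b" using "0.prems"(3)[OF a] by blast
    have d': "dfp UNIV (%e. S (%n. emp) a (e 0))"
      by (rule dsub2[OF dsub2[of _ "%x y. S (%n. emp) y x", OF d]]) (intro dintros)+
    show "ord (least (S (%_. emp) a))" using least(1)[OF d' b] .
    show "S e a (least (S (%_. emp) a))" for e
      using least(2)[OF d' b] "0.prems"(2)[of e "%_. emp"] by simp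
  qed
next
  case (Suc k)
  define S' where "S' e a b \<longleftrightarrow> (ALL x. x \<E> V a --> S (x ## e) a b)" for e a b
  have "EX h. dfun UNIV (%e. h (e 0)) &
    (ALL a. ord a --> ord (h a) & (ALL e. (ALL i. e i \<E> V a) --> S' e a (h a)))"
  proof (rule Suc.IH)
    have f: "(%n. e ((1 ## 2 ## 0 ## (%n. n + 3)) (Suc (Suc n)))) = (e 0 ## (%n. e (Suc (Suc (Suc n)))))"
      for e :: "nat \<Rightarrow> 'a" by (rule ext) (simp add: numeral_eq_Suc split: nat.split)
    have "dfp UNIV (%e. S (e 0 ## (%n. e (Suc (Suc (Suc n))))) (e 2) (e 1))"
      using dfp_ren[OF Suc.prems(1), of "1 ## 2 ## 0 ## (%n. n + 3)"] unfolding f by simp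
    then show "dfp UNIV (%e. S' (%n. e (Suc (Suc n))) (e 1) (e 0))"
      unfolding S'_def by (intro dintros) (simp add: numeral_eq_Suc)
    show "S' e a b = S' e' a b" if "\<And>i. i < k ==> e i = e' i" for e e' a b
    proof -
      have "S (x ## e) a b = S (x ## e') a b" for x
        by (rule Suc.prems(2)) (use that in \<open>auto split: nat.splits\<close>)
      then show ?thesis unfolding S'_def by simp
    qed
    show "S' e a c" if "S' e a b" "ord c" "subs b c" for e a b c
      using that Suc.prems(4) unfolding S'_def by blast
    fix e a assume a: "ord (a :: 'a)"
    have T: "dfun UNIV (((%e. e 0) ## (%_. a) ## (%e. e 1) ## (%i _. e i)) i)" for i
      by (auto intro!: dintros split: nat.split)
    have eq: "(%n. ((%e. e 0) ## (%_. a) ## (%e. e 1) ## (%i _. e i)) (Suc (Suc n)) e') = (e' 1 ## e)" for e'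
      by (rule ext) (simp split: nat.split)
    have d: "dfp UNIV (%e'. S (e' 1 ## e) a (e' 0))"
      using dfp_subst[OF Suc.prems(1), of "(%e. e 0) ## (%_. a) ## (%e. e 1) ## (%i _. e i)", OF T] unfolding eq by simp
    have d1: "dfp UNIV (%e'. S (x ## e) a (e' 0))" for x
      by (rule dsub2[of _ "%y x. S (x ## e) a y", OF d]) (intro dintros)+
    have dl: "dfun UNIV (%e'. least (S (e' 0 ## e) a))"
      by (intro dintros) (use d in simp)
    have l: "ord (least (S (x ## e) a)) & S (x ## e) a (least (S (x ## e) a))" for x
      using Suc.prems(3)[OF a, of "x ## e"] least(1,2)[OF d1] by blast
    obtain b where b: "ord b" "\<And>x. x \<E> V a ==> least (S (x ## e) a) \<E> b"
      using ord_bound[OF dl] l by blast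
    have "S' e a b" unfolding S'_def
    proof (intro allI impI)
      fix x assume "x \<E> V a"
      then have "subs (least (S (x ## e) a)) b" using b ord_subs l by blast
      then show "S (x ## e) a b" using l b(1) Suc.prems(4) by blast
    qed
    then show "EX b. ord b & S' e a b" using b by blast
  qed
  then obtain h where h: "dfun UNIV (%e. h (e 0))"
    "\<And>a. ord a ==> ord (h a) & (ALL e. (ALL i. e i \<E> V a) --> S' e a (h a))" by blast
  have "S e a (h a)" if "ord a" "ALL i. e i \<E> V a" for e a
  proof -
    have "S' (%n. e (Suc n)) a (h a)" using h(2)[OF that(1)] that(2) by simp
    then have "S (e 0 ## (%n. e (Suc n))) a (h a)" using that unfolding S'_def by blast
    then show ?thesis by (simp only: push_shift)
  qed
  then show ?case using h by blast
qed

text \<open>Limit ordinals closed under \<open>h\<close>. Being a limit ensures that finitely many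
  elements of \<open>V z\<close> lie together in some \<open>V a\<close> with \<open>a\<close> below
  \<open>z\<close>.\<close>

definition good :: "'a \<Rightarrow> ('a \<Rightarrow> 'a) \<Rightarrow> bool"
  where "good z h \<longleftrightarrow> ord z & emp \<E> z & (ALL a. a \<E> z --> suc a \<E> z) & (ALL a. a \<E> z --> h a \<E> z)"

text \<open>The ordinal is the supremum of the iterates of \<open>g\<close> from
  \<open>suc a0\<close>. The elements of \<open>g c\<close> include \<open>suc c\<close> and
  \<open>h b\<close> for all \<open>b\<close> up to \<open>c\<close>, so each iterate serves the
  requirements of the preceding one.\<close>

lemma ex_good:
  assumes h: "dfun UNIV (%e. h (e 0))" and oh: "\<And>a. ord a ==> ord (h a)" and a0: "ord a0"
  shows "EX z. good z h & a0 \<E> z"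
proof -
  note dh = dsubf1[OF h]
  define g where "g c = un (upr (suc (suc c)) (Coll (%u. EX b. b \<E> suc c & u \<E> suc (h b))))" for c
  have dg: "dfun UNIV (%e. g (e 0))" unfolding g_def by (intro dintros dh)
  have mg: "u \<E> g c \<longleftrightarrow> u \<E> c \<or> u = c \<or> u = suc c \<or> (EX b. (b \<E> c \<or> b = c) & (u \<E> h b \<or> u = h b))" for u c
  proof -
    have "isset (%u. EX b. b \<E> suc c & u \<E> suc (h b))" by (rule isset_UN) (intro dintros dh)
    then show ?thesis unfolding g_def
      by (simp add: mem_Coll conj_disj_distribR ex_disj_distrib)
  qed
  have og: "ord (g c)" if c: "ord c" for c
  proof (rule ordI)
    have b: "ord (h b)" if "b \<E> c \<or> b = c" for b using that c ord_mem oh by blast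
    show "ord y" if "y \<E> g c" for y
    proof -
      consider "y \<E> c" | "y = c" | "y = suc c" | b where "b \<E> c \<or> b = c" "y \<E> h b \<or> y = h b"
        using \<open>y \<E> g c\<close> unfolding mg by blast
      then show ?thesis using c ord_mem[OF c] ord_mem[OF b] b by cases auto
    qed
    fix y z assume y: "y \<E> g c" and z: "z \<E> y"
    consider "y \<E> c" | "y = c" | "y = suc c" | b where "b \<E> c \<or> b = c" "y \<E> h b \<or> y = h b"
      using y unfolding mg by blast
    then show "z \<E> g c"
    proof cases
      case 1
      then have "z \<E> c" using z c ord_mem_trans by blast
      then show ?thesis unfolding mg by blast
    next
      case 2
      then show ?thesis using z unfolding mg by blast
    next
      case 3
      then have "z \<E> c \<or> z = c" using z by simp
      then show ?thesis unfolding mg by blast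
    next
      case 4
      then have "z \<E> h b" using z b[OF 4(1)] ord_mem_trans by blast
      then show ?thesis using 4(1) unfolding mg by blast
    qed
  qed
  obtain F where F: "dfun UNIV (%e. F (e 0) (e 1))" and F0: "\<And>x. F x emp = suc x"
    and FS: "\<And>x n. n \<E> omega ==> F x (suc n) = g (F x n)"
    by (rule omega_rec[of suc g]) (intro dintros, rule dg, blast)
  have oF: "ord (F a0 n)" if "n \<E> omega" for n
  proof (rule omega_induct[OF that])
    show "dfp UNIV (%e. ord (F a0 (e 0)))" by (intro dintros dsubf2[OF F])
  qed (simp_all add: F0 FS og a0)
  have "isset (%x. EX n. n \<E> omega & x \<E> F a0 n)"
    by (rule isset_UN) (intro dintros dsubf2[OF F])
  then obtain z where z: "\<And>x. x \<E> z \<longleftrightarrow> (EX n. n \<E> omega & x \<E> F a0 n)" unfolding isset_def by blast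
  have oz: "ord z"
  proof (rule ordI)
    show "ord y" if "y \<E> z" for y using that oF ord_mem unfolding z by blast
    show "w \<E> z" if "y \<E> z" "w \<E> y" for y w
      using that oF ord_mem_trans unfolding z by blast
  qed
  have a0z: "a0 \<E> z" unfolding z using F0 zero_omega mem_suc by metis
  have "emp \<E> z"
    using ord_linear[OF ord_emp oz] a0z by auto
  moreover have "suc a \<E> z & h a \<E> z" if "a \<E> z" for a
  proof -
    obtain n where n: "n \<E> omega" "a \<E> F a0 n" using \<open>a \<E> z\<close> unfolding z by blast
    then have oa: "ord a" using oF ord_mem by blast
    have "subs (suc a) (F a0 n)" unfolding subs_def
      using n oF ord_mem_trans by auto
    then have "suc a \<E> F a0 n \<or> suc a = F a0 n" using ord_subs[of "suc a"] oa oF n by simp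
    then have "suc a \<E> g (F a0 n)" unfolding mg by blast
    moreover have "h a \<E> g (F a0 n)" unfolding mg using n by blast
    ultimately show ?thesis unfolding z FS[OF n(1), symmetric] using suc_omega[OF n(1)] by blast
  qed
  ultimately show ?thesis using oz a0z unfolding good_def by blast
qed

text \<open>The condition that \<open>a\<close> contain \<open>emp\<close> puts \<open>emp\<close>
  into \<open>V a\<close>, where it can stand in for irrelevant coordinates.\<close>

lemma good_bound:
  fixes k :: nat
  assumes g: "good z h" and e: "\<And>i. e i \<E> V z"
  shows "EX a. a \<E> z & emp \<E> a & (ALL i<k. e i \<E> V a)"
proof (induction k)
  case 0
  have "suc emp \<E> z" using g unfolding good_def by blast
  then show ?case by (intro exI[of _ "suc emp"]) simp
next
  case (Suc k)
  then obtain a where a: "a \<E> z" "emp \<E> a" "ALL i<k. e i \<E> V a" by blast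
  let ?b = "suc (rk (e k))"
  have z: "ord z" using g unfolding good_def by blast
  have b: "?b \<E> z" using e[of k] g z unfolding good_def by (simp add: mem_V)
  have oa: "ord a" using z a ord_mem by blast
  consider "a \<E> ?b" | "a = ?b" | "?b \<E> a" using ord_linear[OF oa, of ?b] by auto
  then show ?case
  proof cases
    case 1
    have "e i \<E> V ?b" if "i < Suc k" for i
      using that a(3) V_rk[of "e k"] V_mono[of ?b a "e i"] 1 by (cases "i = k") auto
    moreover have "emp \<E> ?b" using ord_mem_trans[of ?b emp a] 1 a(2) by simp
    ultimately show ?thesis using b by blast
  next
    case 2
    have "e i \<E> V a" if "i < Suc k" for i
      using that a(3) V_rk[of "e k"] 2 by (cases "i = k") auto
    then show ?thesis using a by blast
  next
    case 3
    have "e i \<E> V a" if "i < Suc k" for i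
      using that a(3) V_mono[OF oa 3 V_rk] by (cases "i = k") auto
    then show ?thesis using a by blast
  qed
qed

text \<open>For ordinals the union of two is their maximum, and \<open>z\<close> contains everything
  below its elements. Thus one closure function can serve two requirements.\<close>

lemma good_max:
  assumes "good z (%a. un (upr (h a) (h' a)))" "\<And>a. ord a ==> ord (h a)" "\<And>a. ord a ==> ord (h' a)"
  shows "good z h" "good z h'"
proof -
  have z: "ord z" using assms(1) unfolding good_def by blast
  have "h a \<E> z & h' a \<E> z" if a: "a \<E> z" for a
  proof -
    have o: "ord a" using z a ord_mem by blast
    let ?m = "un (upr (h a) (h' a))"
    have m: "?m \<E> z" using assms(1) a unfolding good_def by blast
    have om: "ord ?m" using ord_mem[OF z m] .
    have "subs (h a) ?m" "subs (h' a) ?m" unfolding subs_def by auto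
    then have "h a \<E> ?m \<or> h a = ?m" "h' a \<E> ?m \<or> h' a = ?m" using ord_subs om assms(2,3) o by blast+
    then show ?thesis using m z ord_mem_trans by metis
  qed
  then show "good z h" "good z h'" using assms(1) unfolding good_def by blast+
qed

text \<open>A closure function is recorded instead of a single level, because the parts of a formula
  must be reflected by the same level.\<close>

definition reflects :: "('a \<Rightarrow> 'a) \<Rightarrow> fm \<Rightarrow> bool"
  where "reflects h p \<longleftrightarrow> dfun UNIV (%e. h (e 0)) & (ALL a. ord a --> ord (h a)) &
    (ALL z. good z h --> (ALL e. (ALL i. e i \<E> V z) --> holdsR (%x. x \<E> V z) E e p = holds E e p))"

lemma reflectsD:
  assumes "reflects h p"
  shows "dfun UNIV (%e. h (e 0))" "\<And>a. ord a ==> ord (h a)"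
    "\<And>z (e :: nat \<Rightarrow> 'a). good z h ==> ALL i. e i \<E> V z ==> holdsR (%x. x \<E> V z) E e p = holds E e p"
  using assms unfolding reflects_def by simp_all

text \<open>Only the quantifier needs work: \<open>collect\<close> bounds the rank of some
  counterexample for all environments in \<open>V a\<close>, so a level closed under this bound
  contains a counterexample whenever there is one at all.\<close>

lemma ex_reflects: "EX h. reflects h p"
proof (induction p)
  case (Imp p q)
  then obtain h h' where "reflects h p" "reflects h' q" by blast
  note h = reflectsD[OF \<open>reflects h p\<close>] and h' = reflectsD[OF \<open>reflects h' q\<close>]
  show ?case unfolding reflects_def
  proof (rule exI[of _ "%a. un (upr (h a) (h' a))"], intro conjI allI impI)
    show "dfun UNIV (%e. un (upr (h (e 0)) (h' (e 0))))" by (intro dintros h h')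
    show "ord (un (upr (h a) (h' a)))" if "ord a" for a by (rule ord_un) (use that h h' in auto)
    fix z and e :: "nat \<Rightarrow> 'a"
    assume g: "good z (%a. un (upr (h a) (h' a)))" and e: "ALL i. e i \<E> V z"
    show "holdsR (%x. x \<E> V z) E e (p \<^bold>\<longrightarrow> q) = holds E e (p \<^bold>\<longrightarrow> q)"
      using h(3)[OF good_max(1)[OF g h(2) h'(2)] e] h'(3)[OF good_max(2)[OF g h(2) h'(2)] e] by simp
  qed
next
  case (Forall p)
  then obtain h where "reflects h p" by blast
  note h = reflectsD[OF this]
  obtain k where k: "\<And>i. i \<in> fv p ==> i < k" using finite_fv[of p] by (metis finite_nat_set_iff_bounded)
  define S where "S e (a :: 'a) b \<longleftrightarrow> (EX x. \<not> holds E (x ## e) p) --> (EX x. rk x \<E> b & \<not> holds E (x ## e) p)" for e a b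
  have "EX h. dfun UNIV (%e. h (e 0)) &
    (ALL a. ord a --> ord (h a) & (ALL e. (ALL i. e i \<E> V a) --> S e a (h a)))"
  proof (rule collect[where k = k])
    have T: "dfun UNIV (((%e. e 0) ## (%i e. e (i + j))) i)" for i j
      by (auto intro!: dintros split: nat.split)
    have f: "(%i. ((%e. e 0) ## (%i e. e (i + j))) i e) = (e 0 ## (%i. e (i + j)))" for j and e :: "nat \<Rightarrow> 'a"
      by (rule ext) (simp split: nat.split)
    have "dfp UNIV (%e. holds E (e 0 ## (%i. e (i + 3))) p)"
      using dfp_holds[of UNIV "(%e. e 0) ## (%i e. e (i + 3))", OF T] unfolding f .
    then show "dfp UNIV (%e. S (%n. e (Suc (Suc n))) (e 1) (e 0))"
      unfolding S_def by (intro dintros) (simp_all add: numeral_eq_Suc)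
    show "S e a b = S e' a b" if "\<And>i. i < k ==> e i = e' i" for e e' a b
    proof -
      have "holds E (x ## e) p = holds E (x ## e') p" for x
        by (rule holds_cong) (use that k in \<open>force split: nat.splits\<close>)
      then show ?thesis unfolding S_def by simp
    qed
    show "EX b. ord b & S e a b" for e a
    proof (cases "EX x. \<not> holds E (x ## e) p")
      case True
      then obtain x where "\<not> holds E (x ## e) p" by blast
      then have "S e a (suc (rk x))" unfolding S_def by auto
      then show ?thesis using ord_suc[OF ord_rk[of x]] by blast
    next
      case False
      then show ?thesis unfolding S_def by (intro exI[of _ emp]) simp
    qed
    show "S e a c" if "S e a b" "subs b c" for e a b c
      using that unfolding S_def subs_def by blast
  qed
  then obtain h' where h': "dfun UNIV (%e. h' (e 0))" "\<And>a. ord a ==> ord (h' a)"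
    "\<And>a e. ord a ==> ALL i. e i \<E> V a ==> S e a (h' a)" by blast
  show ?case unfolding reflects_def
  proof (rule exI[of _ "%a. un (upr (h a) (h' a))"], intro conjI allI impI)
    show "dfun UNIV (%e. un (upr (h (e 0)) (h' (e 0))))" by (intro dintros h h')
    show "ord (un (upr (h a) (h' a)))" if "ord a" for a by (rule ord_un) (use that h h' in auto)
    fix z and e :: "nat \<Rightarrow> 'a"
    assume g: "good z (%a. un (upr (h a) (h' a)))" and e: "ALL i. e i \<E> V z"
    note gs = good_max[OF g h(2) h'(2)]
    have z: "ord z" using g unfolding good_def by blast
    have IH: "holdsR (%x. x \<E> V z) E (x ## e) p = holds E (x ## e) p" if "x \<E> V z" for x
      by (rule h(3)[OF gs(1)]) (use e that in \<open>auto split: nat.split\<close>)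
    have "EX x. x \<E> V z & \<not> holds E (x ## e) p" if n: "\<not> holds E (y ## e) p" for y
    proof -
      obtain a where a: "a \<E> z" "emp \<E> a" "ALL i<k. e i \<E> V a" using good_bound[OF g] e by blast
      have oa: "ord a" using z a ord_mem by blast
      \<comment> \<open>An infinite environment in \<open>V z\<close> need not lie in any single
        \<open>V a\<close> below. Only the first \<open>k\<close> coordinates affect the truth of
        \<open>p\<close>; the others are reset to \<open>emp\<close>.\<close>
      define e' where "e' i = (if i < k then e i else emp)" for i
      have "ALL i. e' i \<E> V a" using a rk_ord[OF ord_emp] unfolding e'_def by (simp add: mem_V[OF oa])
      then have S: "S e' a (h' a)" by (rule h'(3)[OF oa])
      have ee: "holds E (x ## e) p = holds E (x ## e') p" for x
        by (rule holds_cong) (use k in \<open>force simp: e'_def split: nat.splits\<close>)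
      obtain x where x: "rk x \<E> h' a" "\<not> holds E (x ## e') p" using S n unfolding S_def ee by blast
      have "h' a \<E> z" using gs(2) a(1) unfolding good_def by blast
      then have "rk x \<E> z" using x(1) z ord_mem_trans by blast
      then have "x \<E> V z" using mem_V[OF z] by blast
      then show ?thesis using x(2) unfolding ee by blast
    qed
    then show "holdsR (%x. x \<E> V z) E e (\<^bold>\<forall> p) = holds E e (\<^bold>\<forall> p)" using IH by auto
  qed
qed (rule exI[of _ "%a. emp"], simp add: reflects_def dfun_emp)+

theorem reflection:
  assumes "ord a"
  obtains z where "ord z" "a \<E> z"
    "\<And>e :: nat \<Rightarrow> 'a. (\<And>i. e i \<E> V z) ==> holdsR (%x. x \<E> V z) E e p = holds E e p"
proof -
  obtain h where "reflects h p" using ex_reflects by blast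
  note h = reflectsD[OF this]
  obtain z where z: "good z h" "a \<E> z" using ex_good[OF h(1,2) assms] by blast
  then have "ord z" unfolding good_def by blast
  then show thesis using that[OF _ z(2)] h(3)[OF z(1)] by blast
qed

subsection \<open>Formulas and satisfaction inside the model\<close>

text \<open>These are the standard natural numbers; \<open>omega\<close> may have further
  elements.\<close>

primrec num :: "nat \<Rightarrow> 'a" where
  "num 0 = emp"
| "num (Suc n) = suc (num n)"

lemma num_omega [simp]: "num n \<E> omega"
  by (induction n) simp_all

lemma num_mem: "i < n ==> num i \<E> num n"
  by (induction n) (auto simp: less_Suc_eq)

lemma num_eq [simp]: "num i = num j \<longleftrightarrow> i = j"
proof (induction i arbitrary: j)
  case 0
  then show ?case by (cases j) (simp_all add: suc_not_emp[symmetric])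
next
  case (Suc i)
  then show ?case by (cases j) simp_all
qed

lemma dfun_num [dintros]: "dfun P (%e. num n)"
  by (induction n) (simp_all add: dfun_emp dfun_suc)

lemma holds_numeral [simp]: "holds E e (numeral_fm k x) \<longleftrightarrow> e x = num k"
  by (induction k arbitrary: e x) simp_all

definition tg :: "nat \<Rightarrow> 'a \<Rightarrow> 'a"
  where "tg k u = opair (num k) u"

lemma tg_eq [simp]: "tg k u = tg l v \<longleftrightarrow> k = l & u = v"
  unfolding tg_def by simp

lemma dfun_tg [dintros]: "dfun P t ==> dfun P (%e. tg k (t e))"
  unfolding tg_def by (intro dintros)

lemma holds_tag [simp]: "holds E e (tag_fm k c u) \<longleftrightarrow> e c = tg k (e u)"
  unfolding tag_fm_def tg_def by simp

lemma holds_tag2 [simp]: "holds E e (tag2_fm k c u v) \<longleftrightarrow> e c = tg k (opair (e u) (e v))"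
  unfolding tag2_fm_def by simp

definition fclosed :: "'a \<Rightarrow> 'a \<Rightarrow> bool"
  where "fclosed w F \<longleftrightarrow> (ALL n. n \<E> w -->
    (ALL i. i \<E> n --> (ALL j. j \<E> n -->
      (ALL c. c = tg 0 (opair i j) \<or> c = tg 1 (opair i j) --> opair n c \<E> F))) &
    (ALL p q c. opair n p \<E> F & opair n q \<E> F & c = tg 2 (opair p q) --> opair n c \<E> F) &
    (ALL m p c. m = suc n & opair m p \<E> F & c = tg 3 p --> opair n c \<E> F))"

definition isform :: "'a \<Rightarrow> 'a \<Rightarrow> 'a \<Rightarrow> bool"
  where "isform w n c \<longleftrightarrow> n \<E> w & (ALL F. fclosed w F --> opair n c \<E> F)"

lemma dfp_fclosed [dintros]: "dfun P t ==> dfun P u ==> dfp P (%e. fclosed (t e) (u e))"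
  by (rule dsub2) (unfold fclosed_def, intro dintros)

lemma dfp_isform [dintros]:
  "dfun P t ==> dfun P u ==> dfun P v ==> dfp P (%e. isform (t e) (u e) (v e))"
  by (rule dsub3) (unfold isform_def, intro dintros)

lemma holds_formula_closed [simp]: "holds E e (formula_closed_fm w F) \<longleftrightarrow> fclosed (e w) (e F)"
  unfolding formula_closed_fm_def fclosed_def by (simp add: numeral_eq_Suc)

lemma holds_formula [simp]: "holds E e (formula_fm w n c) \<longleftrightarrow> isform (e w) (e n) (e c)"
  unfolding formula_fm_def isform_def by simp

definition snocs :: "'a \<Rightarrow> 'a \<Rightarrow> 'a \<Rightarrow> 'a"
  where "snocs s n x = un (upr s (upr (opair n x) (opair n x)))"

lemma mem_snocs [simp]: "z \<E> snocs s n x \<longleftrightarrow> z \<E> s \<or> z = opair n x"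
  unfolding snocs_def by auto

lemma dfun_snocs [dintros]:
  "dfun P t ==> dfun P u ==> dfun P v ==> dfun P (%e. snocs (t e) (u e) (v e))"
  unfolding snocs_def by (intro dintros)

lemma holds_snoc [simp]: "holds E e (snoc_fm t s n x) \<longleftrightarrow> e t = snocs (e s) (e n) (e x)"
  unfolding snoc_fm_def by (auto intro: extensional)

definition mapsto :: "'a \<Rightarrow> 'a \<Rightarrow> 'a \<Rightarrow> bool"
  where "mapsto s n A \<longleftrightarrow> isfun s n & (ALL x. x \<E> n --> app s x \<E> A)"

lemma dfp_mapsto [dintros]:
  "dfun P t ==> dfun P u ==> dfun P v ==> dfp P (%e. mapsto (t e) (u e) (v e))"
  by (rule dsub3) (unfold mapsto_def, intro dintros)

lemma isfun_snocs:
  assumes s: "isfun s n" and n: "\<not> n \<E> n"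
  shows "isfun (snocs s n a) (suc n)" "app (snocs s n a) n = a" "\<And>x. x \<E> n ==> app (snocs s n a) x = app s x"
proof -
  have dom: "x \<E> n" if "opair x y \<E> s" for x y using s that unfolding isfun_def by (metis opair_eq)
  have "(opair x z \<E> s \<or> x = n & z = a) \<longleftrightarrow> z = (if x = n then a else app s x)" if "x \<E> n \<or> x = n" for x z
    using that app_eq[OF s, of x z] dom[of x z] n by auto
  then show 1: "isfun (snocs s n a) (suc n)"
    unfolding isfun_def[of _ "suc n"] using s unfolding isfun_def[of s] by auto
  show "app (snocs s n a) n = a" using app_eq[OF 1, of n a] by simp
  show "app (snocs s n a) x = app s x" if "x \<E> n" for x
    using app_eq[OF 1, of x "app s x"] app_eq[OF s that, of "app s x"] that by simp
qed

lemma mapsto_snocs: "mapsto s n A ==> a \<E> A ==> mapsto (snocs s n a) (suc n) A"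
  using isfun_snocs[OF _ not_mem_self, of s n] unfolding mapsto_def by auto

lemma mapsto_emp: "mapsto emp emp A"
  unfolding mapsto_def isfun_def by simp

lemma isfun_dom: "isfun s n ==> isfun s m ==> n = m"
proof (rule extensional)
  assume a: "isfun s n" "isfun s m"
  have "x \<E> k \<longleftrightarrow> (EX y. opair x y \<E> s)" if "isfun s k" for x k
    using that unfolding isfun_def by (metis opair_eq)
  then show "x \<E> n \<longleftrightarrow> x \<E> m" for x using a by simp
qed

section \<open>Satisfaction relations inside the model\<close>

definition satrel :: "'a \<Rightarrow> 'a \<Rightarrow> 'a \<Rightarrow> bool"
  where "satrel w A S \<longleftrightarrow> (ALL n. n \<E> w --> (ALL s. mapsto s n A -->
    (ALL i. i \<E> n --> (ALL j. j \<E> n --> (ALL c. c = tg 0 (opair i j) -->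
      (opair c s \<E> S \<longleftrightarrow> (EX x y. opair i x \<E> s & opair j y \<E> s & x \<E> y))))) &
    (ALL i. i \<E> n --> (ALL j. j \<E> n --> (ALL c. c = tg 1 (opair i j) -->
      (opair c s \<E> S \<longleftrightarrow> (EX x y. opair i x \<E> s & opair j y \<E> s & x = y))))) &
    (ALL p q c. isform w n p & isform w n q & c = tg 2 (opair p q) -->
      (opair c s \<E> S \<longleftrightarrow> \<not> (opair p s \<E> S & opair q s \<E> S))) &
    (ALL m p c. m = suc n & isform w m p & c = tg 3 p -->
      (opair c s \<E> S \<longleftrightarrow> (ALL a. a \<E> A --> (EX t. t = snocs s n a & opair p t \<E> S))))))"

lemma dfp_satrel [dintros]:
  "dfun P t ==> dfun P u ==> dfun P v ==> dfp P (%e. satrel (t e) (u e) (v e))"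
  by (rule dsub3) (unfold satrel_def, intro dintros)

lemma holds_satrel [simp]: "holds E e (sat_relation_fm w A S) \<longleftrightarrow> satrel (e w) (e A) (e S)"
  unfolding sat_relation_fm_def satrel_def mapsto_def by (simp add: numeral_eq_Suc)

definition satf :: "'a \<Rightarrow> 'a \<Rightarrow> 'a \<Rightarrow> 'a \<Rightarrow> bool"
  where "satf w A c s \<longleftrightarrow> (EX S. satrel w A S & opair c s \<E> S)"

lemma dfp_satf [dintros]:
  "dfun P t ==> dfun P u ==> dfun P v ==> dfun P y ==> dfp P (%e. satf (t e) (u e) (v e) (y e))"
  by (rule dsub4) (unfold satf_def, intro dintros)

lemma holds_sat [simp]: "holds E e (sat_fm w A c s) \<longleftrightarrow> satf (e w) (e A) (e c) (e s)"
  unfolding sat_fm_def satf_def by simp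

lemma isform_atom: "n \<E> omega ==> i \<E> n ==> j \<E> n ==> isform omega n (tg 0 (opair i j))"
  "n \<E> omega ==> i \<E> n ==> j \<E> n ==> isform omega n (tg 1 (opair i j))"
  unfolding isform_def fclosed_def by blast+

lemma isform_nand: "isform omega n p ==> isform omega n q ==> isform omega n (tg 2 (opair p q))"
  unfolding isform_def fclosed_def by blast

lemma isform_all: "n \<E> omega ==> isform omega (suc n) p ==> isform omega n (tg 3 p)"
  unfolding isform_def fclosed_def by blast

text \<open>\<open>isform\<close> demands membership in every closed relation, so a single closed
  relation, here \<open>times omega h\<close>, already bounds all formulas.\<close>

lemma ex_countable_forms:
  obtains h where "cnt h" "\<And>n c. isform omega n c ==> c \<E> h"
proof -
  obtain h where h: "cnt h" "\<And>n. n \<E> omega ==> n \<E> h" "\<And>x y. x \<E> h ==> y \<E> h ==> opair x y \<E> h"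
    by (rule ex_countable_pair_closed) blast
  have tg: "tg k x \<E> h" if "x \<E> h" for k x unfolding tg_def using h that num_omega by blast
  have w: "i \<E> h" if "i \<E> n" "n \<E> omega" for i n using that h(2) omega_mem_trans by blast
  have "fclosed omega (times omega h)"
    unfolding fclosed_def using tg h(3) w by auto
  then have "c \<E> h" if "isform omega n c" for n c
    using that opair_mem_times unfolding isform_def by blast
  then show thesis using that h(1) by blast
qed

text \<open>Without such a relation \<open>satf\<close> would be false throughout. The set
  \<open>F c\<close> of assignments satisfying \<open>c\<close> is obtained by recursion, since
  subformulas lie in the transitive closure of a code.\<close>

lemma ex_satrel: "EX S. satrel omega A S"
proof -
  obtain h where h: "\<And>n c. isform omega n c ==> c \<E> h" by (rule ex_countable_forms) blast
  let ?P = "pow (times omega A)"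
  \<comment> \<open>The Tarski clauses as one condition, in which \<open>f\<close> supplies the
    assignments that satisfy the subformulas. The universal clause recovers the context length as
    the domain of \<open>s\<close>.\<close>
  define Cl where "Cl c f s \<longleftrightarrow>
    (EX i j x y. c = tg 0 (opair i j) & opair i x \<E> s & opair j y \<E> s & x \<E> y) \<or>
    (EX i j x y. c = tg 1 (opair i j) & opair i x \<E> s & opair j y \<E> s & x = y) \<or>
    (EX p q. c = tg 2 (opair p q) & \<not> (s \<E> app f p & s \<E> app f q)) \<or>
    (EX p n. c = tg 3 p & isfun s n & (ALL a. a \<E> A --> snocs s n a \<E> app f p))" for c f s
  have dCl: "dfp UNIV (%e. Cl (e 0) (e 1) (e 2))" unfolding Cl_def by (intro dintros)
  have dC: "dfun UNIV (%e. Coll (%s. s \<E> ?P & Cl (e 0) (e 1) s))"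
    by (intro dintros dsub3[OF dCl])
  obtain F where F: "dfun UNIV (%e. F (e 0))"
    "\<And>c. F c = Coll (%s. s \<E> ?P & Cl c (lam (TC c) F) s)"
    by (rule TC_rec[OF dC]) blast
  have mF: "s \<E> F c \<longleftrightarrow> s \<E> ?P & Cl c (lam (TC c) F) s" for s c
  proof -
    have "isset (%s. s \<E> ?P & Cl c (lam (TC c) F) s)"
      by (rule isset_param) (intro dsub3[OF dCl] dintros)
    then show ?thesis unfolding F(2)[of c] by (rule mem_Coll)
  qed
  have TCo: "x \<E> TC (opair x y)" "y \<E> TC (opair x y)" for x y
  proof -
    have *: "upr x y \<E> TC (opair x y)" by (rule TC_mem) (simp add: opair_def)
    show "x \<E> TC (opair x y)" "y \<E> TC (opair x y)" by (rule TC_step[OF _ *], simp)+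
  qed
  have TCt: "x \<E> TC (tg k x)" for k x unfolding tg_def by (rule TCo)
  have ap: "app (lam (TC c) F) x = F x" if "x \<E> TC c" for x c
    using F(1) that by (rule app_lam)
  have ap2: "app (lam (TC (tg 2 (opair p q))) F) p = F p" "app (lam (TC (tg 2 (opair p q))) F) q = F q"
    "app (lam (TC (tg 3 p)) F) p = F p" for p q
    using ap TCt TC_mono[OF TCt] TCo by blast+
  \<comment> \<open>\<open>F\<close> is defined on all sets; bounding the codes by \<open>h\<close>
    turns satisfaction into a set.\<close>
  have "isset (%u. u \<E> times h ?P & snd' u \<E> F (fst' u))"
    by (rule isset_param) (intro dintros dsubf1[OF F(1)])
  then obtain S where S: "\<And>u. u \<E> S \<longleftrightarrow> u \<E> times h ?P & snd' u \<E> F (fst' u)" unfolding isset_def by blast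
  have mS: "opair c s \<E> S \<longleftrightarrow> Cl c (lam (TC c) F) s" if "isform omega n c" "mapsto s m A" "m \<E> omega" for c s n m
  proof -
    have "s \<E> ?P" using that omega_mem_trans unfolding mapsto_def by (auto simp: subs_def isfun_mem)
    then show ?thesis unfolding S using h[OF that(1)] mF by auto
  qed
  have SF: "opair c s \<E> S \<longleftrightarrow> s \<E> F c" if "isform omega n c" "mapsto s m A" "m \<E> omega" for c s n m
  proof -
    have "s \<E> ?P" using that omega_mem_trans unfolding mapsto_def by (auto simp: subs_def isfun_mem)
    then show ?thesis unfolding S using h[OF that(1)] by auto
  qed
  have "satrel omega A S" unfolding satrel_def
  proof (intro allI impI conjI)
    fix n s assume n: "n \<E> omega" and s: "mapsto s n A"
    fix c i j assume ij: "i \<E> n" "j \<E> n"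
    show "opair c s \<E> S \<longleftrightarrow> (EX x y. opair i x \<E> s & opair j y \<E> s & x \<E> y)" if "c = tg 0 (opair i j)"
      unfolding that mS[OF isform_atom(1)[OF n ij] s n] by (auto simp: Cl_def)
    show "opair c s \<E> S \<longleftrightarrow> (EX x y. opair i x \<E> s & opair j y \<E> s & x = y)" if "c = tg 1 (opair i j)"
      unfolding that mS[OF isform_atom(2)[OF n ij] s n] by (auto simp: Cl_def)
  next
    fix n s assume n: "n \<E> omega" and s: "mapsto s n A"
    fix p q c assume a: "isform omega n p & isform omega n q & c = tg 2 (opair p q)"
    then have pq: "isform omega n p" "isform omega n q" and c: "c = tg 2 (opair p q)" by blast+
    show "opair c s \<E> S \<longleftrightarrow> \<not> (opair p s \<E> S & opair q s \<E> S)"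
      unfolding c mS[OF isform_nand[OF pq] s n] SF[OF pq(1) s n] SF[OF pq(2) s n]
      by (auto simp: Cl_def ap2)
  next
    fix n s assume n: "n \<E> omega" and s: "mapsto s n A"
    fix m p c assume "m = suc n & isform omega m p & c = tg 3 p"
    then have p: "isform omega (suc n) p" and c: "c = tg 3 p" by blast+
    have fs: "isfun s k \<longleftrightarrow> k = n" for k using s isfun_dom unfolding mapsto_def by blast
    have "opair c s \<E> S \<longleftrightarrow> (ALL a. a \<E> A --> snocs s n a \<E> F p)"
      unfolding c mS[OF isform_all[OF n p] s n] by (auto simp: Cl_def ap2 fs)
    then show "opair c s \<E> S \<longleftrightarrow> (ALL a. a \<E> A --> (EX t. t = snocs s n a & opair p t \<E> S))"
      using SF[OF p mapsto_snocs[OF s] suc_omega[OF n]] by simp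
  qed
  then show ?thesis by blast
qed

text \<open>
  \<open>cd n r p\<close> is the formula of the model that corresponds to \<open>p\<close> in the context of length \<open>n\<close>,
  where \<open>r\<close> translates indices into levels.
\<close>

primrec cd :: "nat \<Rightarrow> (nat \<Rightarrow> nat) \<Rightarrow> fm \<Rightarrow> 'a" where
  "cd n r \<^bold>\<bottom> = (let t = tg 3 (tg 1 (opair (num n) (num n))) in tg 2 (opair t t))"
| "cd n r (i \<^bold>\<in> j) = tg 0 (opair (num (r i)) (num (r j)))"
| "cd n r (i \<^bold>= j) = tg 1 (opair (num (r i)) (num (r j)))"
| "cd n r (p \<^bold>\<longrightarrow> q) = tg 2 (opair (cd n r p) (tg 2 (opair (cd n r q) (cd n r q))))"
| "cd n r (\<^bold>\<forall> p) = tg 3 (cd (Suc n) (case_nat n r) p)"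

text \<open>The valid formula that every value equals itself. Internal formulas have no falsity, so
  \<open>cd\<close> uses the NAND of this formula with itself; likewise an implication is the NAND
  of \<open>p\<close> with the NAND of \<open>q\<close> and \<open>q\<close>.\<close>

lemma isform_true: "isform omega (num n) (tg 3 (tg 1 (opair (num n) (num n))))"
  by (rule isform_all[OF num_omega isform_atom(2)]) simp_all

lemma isform_cd: "(\<And>i. r i < n) ==> isform omega (num n) (cd n r p)"
proof (induction p arbitrary: n r)
  case Fls
  show ?case unfolding cd.simps Let_def by (intro isform_nand isform_true)
next
  case (Mem i j)
  show ?case unfolding cd.simps by (intro isform_atom num_omega num_mem Mem)
next
  case (Equ i j)
  show ?case unfolding cd.simps by (intro isform_atom num_omega num_mem Equ)
next
  case (Imp p q)
  show ?case unfolding cd.simps by (intro isform_nand Imp.IH Imp.prems)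
next
  case (Forall p)
  have "isform omega (num (Suc n)) (cd (Suc n) (case_nat n r) p)"
    by (rule Forall.IH) (use Forall.prems in \<open>auto split: nat.split intro: less_SucI\<close>)
  then show ?case unfolding cd.simps by (intro isform_all) simp_all
qed

lemma satrel_clauses:
  assumes "satrel w A S" "n \<E> w" "mapsto s n A"
  shows satrel_mem: "i \<E> n ==> j \<E> n ==> opair (tg 0 (opair i j)) s \<E> S \<longleftrightarrow>
      (EX x y. opair i x \<E> s & opair j y \<E> s & x \<E> y)"
    and satrel_equ: "i \<E> n ==> j \<E> n ==> opair (tg 1 (opair i j)) s \<E> S \<longleftrightarrow>
      (EX x y. opair i x \<E> s & opair j y \<E> s & x = y)"
    and satrel_nand: "isform w n p ==> isform w n q ==>
      opair (tg 2 (opair p q)) s \<E> S \<longleftrightarrow> \<not> (opair p s \<E> S & opair q s \<E> S)"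
    and satrel_all: "isform w (suc n) p ==>
      opair (tg 3 p) s \<E> S \<longleftrightarrow> (ALL a. a \<E> A --> opair p (snocs s n a) \<E> S)"
proof -
  note C = assms(1)[unfolded satrel_def, THEN spec, THEN mp, OF assms(2), THEN spec, THEN mp, OF assms(3)]
  note 1 = C[THEN conjunct1, THEN spec, THEN mp, THEN spec, THEN mp, THEN spec, THEN mp, OF _ _ refl]
  note 2 = C[THEN conjunct2, THEN conjunct1, THEN spec, THEN mp, THEN spec, THEN mp, THEN spec, THEN mp, OF _ _ refl]
  note 3 = C[THEN conjunct2, THEN conjunct2, THEN conjunct1, THEN spec, THEN spec, THEN spec, THEN mp]
  note 4 = C[THEN conjunct2, THEN conjunct2, THEN conjunct2, THEN spec, THEN spec, THEN spec, THEN mp]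
  show "i \<E> n ==> j \<E> n ==> opair (tg 0 (opair i j)) s \<E> S \<longleftrightarrow>
      (EX x y. opair i x \<E> s & opair j y \<E> s & x \<E> y)" by (rule 1)
  show "i \<E> n ==> j \<E> n ==> opair (tg 1 (opair i j)) s \<E> S \<longleftrightarrow>
      (EX x y. opair i x \<E> s & opair j y \<E> s & x = y)" by (rule 2)
  show "isform w n p ==> isform w n q ==>
      opair (tg 2 (opair p q)) s \<E> S \<longleftrightarrow> \<not> (opair p s \<E> S & opair q s \<E> S)" by (rule 3) simp
  show "opair (tg 3 p) s \<E> S \<longleftrightarrow> (ALL a. a \<E> A --> opair p (snocs s n a) \<E> S)" if "isform w (suc n) p"
    using 4[of "suc n" p "tg 3 p"] that by simp
qed

text \<open>Index 0 under a quantifier is translated to level \<open>n\<close>, the very position at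
  which \<open>snocs\<close> appends the new value; this reconciles de Bruijn indices with
  levels.\<close>

lemma satrel_cd:
  assumes S: "satrel omega A S" and "\<And>i. r i < n" "mapsto s (num n) A"
  shows "opair (cd n r p) s \<E> S \<longleftrightarrow> holdsR (%x. x \<E> A) E (%i. app s (num (r i))) p"
  using assms(2,3)
proof (induction p arbitrary: n r s)
  note nand = satrel_nand[OF S num_omega]
  have all: "opair (tg 3 p) s \<E> S \<longleftrightarrow> (ALL a. a \<E> A --> opair p (snocs s (num n) a) \<E> S)"
    if "isform omega (num (Suc n)) p" "mapsto s (num n) A" for n p s
    using satrel_all[OF S num_omega that(2)] that(1) by simp
  have mem: "opair (tg 0 (opair (num i) (num j))) s \<E> S \<longleftrightarrow> app s (num i) \<E> app s (num j)"
    and eq: "opair (tg 1 (opair (num i) (num j))) s \<E> S \<longleftrightarrow> app s (num i) = app s (num j)"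
    if "i < n" "j < n" "mapsto s (num n) A" for n i j s
  proof -
    have f: "isfun s (num n)" using that unfolding mapsto_def by blast
    note s = app_eq[OF f num_mem[OF that(1)]] app_eq[OF f num_mem[OF that(2)]]
    show "opair (tg 0 (opair (num i) (num j))) s \<E> S \<longleftrightarrow> app s (num i) \<E> app s (num j)"
      "opair (tg 1 (opair (num i) (num j))) s \<E> S \<longleftrightarrow> app s (num i) = app s (num j)"
      unfolding satrel_mem[OF S num_omega that(3) num_mem[OF that(1)] num_mem[OF that(2)]]
        satrel_equ[OF S num_omega that(3) num_mem[OF that(1)] num_mem[OF that(2)]] s by auto
  qed
  {
    case Fls
    let ?t = "tg 1 (opair (num n) (num n))"
    have "opair ?t (snocs s (num n) a) \<E> S" if "a \<E> A" for a
      using eq[of n "Suc n" n] mapsto_snocs[OF Fls(2) that] by simp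
    moreover have "isform omega (num (Suc n)) ?t" by (intro isform_atom num_omega num_mem) simp_all
    ultimately have "opair (tg 3 ?t) s \<E> S" using all Fls(2) by blast
    then show ?case using nand[OF Fls(2) isform_true isform_true] by (simp add: Let_def)
  next
    case (Mem i j)
    show ?case using mem[OF Mem(1) Mem(1) Mem(2)] by simp
  next
    case (Equ i j)
    show ?case using eq[OF Equ(1) Equ(1) Equ(2)] by simp
  next
    case (Imp p q)
    note f = isform_cd[of r n, OF Imp.prems(1)]
    show ?case unfolding cd.simps nand[OF Imp.prems(2) f isform_nand[OF f f]] nand[OF Imp.prems(2) f f]
      using Imp.IH(1)[OF Imp.prems] Imp.IH(2)[OF Imp.prems] by simp
  next
    case (Forall p)
    have r: "case_nat n r i < Suc n" for i using Forall.prems(1) by (auto split: nat.split intro: less_SucI)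
    have "opair (cd (Suc n) (case_nat n r) p) (snocs s (num n) a) \<E> S \<longleftrightarrow>
        holdsR (%x. x \<E> A) E (a ## (%i. app s (num (r i)))) p" if a: "a \<E> A" for a
    proof -
      have f: "isfun s (num n)" using Forall.prems(2) unfolding mapsto_def by blast
      have "(%i. app (snocs s (num n) a) (num (case_nat n r i))) = (a ## (%i. app s (num (r i))))"
        by (rule ext) (simp add: isfun_snocs[OF f not_mem_self] num_mem Forall.prems(1) split: nat.split)
      moreover have "mapsto (snocs s (num n) a) (num (Suc n)) A"
        using mapsto_snocs[OF Forall.prems(2) a] by simp
      ultimately show ?thesis using Forall.IH[OF r, of "snocs s (num n) a"] by simp
    qed
    then show ?case unfolding cd.simps all[OF isform_cd[OF r] Forall.prems(2)] by simp
  }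
qed

section \<open>The class of hereditarily nontypical sets\<close>

text \<open>All satisfaction relations agree on codes of standard formulas, and
  \<open>ex_satrel\<close> provides one.\<close>

lemma satf_cd:
  assumes "\<And>i. r i < n" "mapsto s (num n) A"
  shows "satf omega A (cd n r p) s \<longleftrightarrow> holdsR (%x. x \<E> A) E (%i. app s (num (r i))) p"
proof -
  have "opair (cd n r p) s \<E> S \<longleftrightarrow> holdsR (%x. x \<E> A) E (%i. app s (num (r i))) p"
    if "satrel omega A S" for S
    using satrel_cd[of A S r n s p] that assms by blast
  then show ?thesis using ex_satrel[of A] unfolding satf_def by blast
qed

definition Dset :: "'a \<Rightarrow> 'a \<Rightarrow> 'a"
  where "Dset A c = Coll (%x. x \<E> A & satf omega A c (snocs emp emp x))"

lemma dfun_Dset [dintros]: "dfun P t ==> dfun P u ==> dfun P (%e. Dset (t e) (u e))"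
  by (rule dsubf2) (unfold Dset_def, intro dintros)

lemma mem_Dset: "x \<E> Dset A c \<longleftrightarrow> x \<E> A & satf omega A c (snocs emp emp x)"
proof -
  have "isset (%x. x \<E> A & satf omega A c (snocs emp emp x))"
    by (rule isset_param) (intro dintros)
  then show ?thesis unfolding Dset_def by (rule mem_Coll)
qed

lemma holds_defined_set [simp]:
  "e w = omega ==> holds E e (defined_set_fm w A c X) \<longleftrightarrow> e X = Dset (e A) (e c)"
proof -
  assume w: "e w = omega"
  have "(ALL x. x \<E> X \<longleftrightarrow> x \<E> A & satf omega A c (snocs emp emp x)) \<longleftrightarrow> X = Dset A c" for X A c
    using mem_Dset by (auto intro: extensional)
  then show ?thesis unfolding defined_set_fm_def by (simp add: numeral_eq_Suc w)
qed

definition N :: "'a \<Rightarrow> 'a \<Rightarrow> bool"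
  where "N z a \<longleftrightarrow> a \<E> V z & (EX c. isform omega (num 1) c & a \<E> Dset (V z) c & cnt (Dset (V z) c))"

definition NT :: "'a \<Rightarrow> bool"
  where "NT a \<longleftrightarrow> (EX z. ord z & omega \<E> z & N z a)"

lemma dfp_N [dintros]: "dfun P t ==> dfun P u ==> dfp P (%e. N (t e) (u e))"
  by (rule dsub2) (unfold N_def, intro dintros)

lemma dfp_NT [dintros]: "dfun P t ==> dfp P (%e. NT (t e))"
  by (rule dsub1) (unfold NT_def, intro dintros)

lemma holds_NT: "holds E e (NT_fm a) \<longleftrightarrow> NT (e a)"
  unfolding NT_fm_def NT_def N_def
  by (simp add: holds_Vset numeral_eq_Suc cong: conj_cong)

text \<open>The transitive closure of the singleton of \<open>x\<close> is split into
  \<open>x\<close> and the elements of \<open>TC x\<close>, as justified by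
  \<open>TC_sing\<close>.\<close>

definition hered :: "('a \<Rightarrow> bool) \<Rightarrow> 'a \<Rightarrow> bool"
  where "hered C x \<longleftrightarrow> C x & (ALL y. y \<E> TC x --> C y)"

lemma holds_tc: "holds E e (tc_fm T X) \<longleftrightarrow> e T = TC (e X)"
proof -
  have "trans' t & subs x t & (ALL u. trans' u & subs x u --> subs t u) \<longleftrightarrow> t = TC x" for t x
  proof
    assume a: "trans' t & subs x t & (ALL u. trans' u & subs x u --> subs t u)"
    have "subs x (TC x)" using TC_mem unfolding subs_def by blast
    then show "t = TC x" using a TC_trans TC_least[of t x] by (intro subs_antisym) blast+
  next
    assume "t = TC x"
    then show "trans' t & subs x t & (ALL u. trans' u & subs x u --> subs t u)"
      using TC_trans[of x] TC_mem[of _ x] TC_least[of _ x] by (auto simp: subs_def[of x])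
  qed
  then show ?thesis unfolding tc_fm_def by simp
qed

lemma TC_sing: "y \<E> TC (upr x x) \<longleftrightarrow> y = x \<or> y \<E> TC x"
  using TC_cases[of y "upr x x"] TC_mem[of x "upr x x"] TC_mono[of x "upr x x" y] by auto

lemma holds_hereditarily:
  assumes "\<And>e i. holds E e (C i) \<longleftrightarrow> D (e i)"
  shows "holds E e (hereditarily_fm C x) \<longleftrightarrow> hered D (e x)"
  unfolding hereditarily_fm_def hered_def
  by (simp add: holds_tc assms TC_sing numeral_eq_Suc) blast

definition HNT :: "'a \<Rightarrow> bool"
  where "HNT = hered NT"

lemma holds_HNT: "holds E e (HNT_fm x) \<longleftrightarrow> HNT (e x)"
  unfolding HNT_fm_def HNT_def by (rule holds_hereditarily[OF holds_NT])

lemma dfp_HNT [dintros]: "dfun P t ==> dfp P (%e. HNT (t e))"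
  by (rule dsub1) (unfold HNT_def hered_def, intro dintros)

lemma HNT_NT: "HNT x ==> NT x"
  unfolding HNT_def hered_def by blast

lemma HNT_trans: "HNT x ==> y \<E> x ==> HNT y"
  unfolding HNT_def hered_def using TC_mem TC_mono by blast

lemma HNTI: "NT x ==> (\<And>y. y \<E> x ==> HNT y) ==> HNT x"
  unfolding HNT_def hered_def using TC_cases[of _ x] by blast

subsection \<open>Countable ordinal definable sets\<close>

text \<open>Stated for predicates, so that its definability in the parameters of \<open>Q\<close>
  follows from that of \<open>Q\<close>.\<close>

definition cset :: "('a \<Rightarrow> bool) \<Rightarrow> bool"
  where "cset Q \<longleftrightarrow> (EX X. (ALL x. x \<E> X \<longleftrightarrow> Q x) & cnt X)"

text \<open>The defining formula is reflected to a level that includes the set it defines. Its code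
  then defines the same set inside that level, as \<open>NT\<close> requires.\<close>

lemma NT_definable:
  assumes Q: "dfp {} (%e. Q (e 0))" and c: "cset Q" and x: "Q x"
  shows "NT x"
proof -
  obtain p where p: "\<And>e. Q (e 0) = holds E e p" using dfp_empty[OF Q] by blast
  obtain X where X: "\<And>x. x \<E> X \<longleftrightarrow> Q x" "cnt X" using c unfolding cset_def by blast
  \<comment> \<open>The pair forces two ranks below \<open>z\<close>: that of \<open>omega\<close>,
    since \<open>NT\<close> demands a level beyond it, and that of \<open>X\<close>, so that
    \<open>V z\<close> includes \<open>X\<close>.\<close>
  obtain z where z: "ord z" "rk (upr omega X) \<E> z"
    and r: "\<And>e :: nat \<Rightarrow> 'a. (\<And>i. e i \<E> V z) ==> holdsR (%x. x \<E> V z) E e p = holds E e p"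
    using reflection[OF ord_rk] by blast
  have w: "omega \<E> z" using rk_mem[of omega "upr omega X"] z ord_mem_trans rk_ord[OF ord_omega] by fastforce
  have "rk X \<E> z" using rk_mem[of X "upr omega X"] z ord_mem_trans by fastforce
  then have XV: "y \<E> V z" if "y \<E> X" for y
    using that rk_mem z ord_mem_trans by (simp add: mem_V) blast
  \<comment> \<open>All variables are read at level 0, which amounts to a constant environment. This
    preserves truth because \<open>p\<close> depends on the value at index 0 alone.\<close>
  let ?c = "cd 1 (%_. 0) p"
  have "satf omega (V z) ?c (snocs emp emp y) \<longleftrightarrow> Q y" if y: "y \<E> V z" for y
  proof -
    let ?s = "snocs emp emp y"
    have "mapsto ?s (num 1) (V z)" using mapsto_snocs[OF mapsto_emp y] by simp
    then have "satf omega (V z) ?c ?s \<longleftrightarrow> holdsR (%x. x \<E> V z) E (%i. app ?s (num 0)) p"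
      by (intro satf_cd) simp_all
    also have "app ?s (num 0) = y" using isfun_snocs(2)[of emp emp y] by (simp add: isfun_def)
    also have "holdsR (%x. x \<E> V z) E (%i. y) p = holds E (%i. y) p" by (rule r) (rule y)
    finally show ?thesis using p[of "%i. y"] by simp
  qed
  then have "Dset (V z) ?c = X" using XV X(1) by (intro extensional) (auto simp: mem_Dset)
  moreover have "isform omega (num 1) ?c" by (rule isform_cd) simp
  ultimately have "N z x" unfolding N_def using X XV x by auto
  then show ?thesis unfolding NT_def using z(1) w by blast
qed

text \<open>
  A counterexample with the least possible ordinal parameter is definable without parameters.
\<close>

lemma NT_definable1:
  assumes Q: "dfp {} (%e. Q (e 0) (e 1))" and o: "ord a" and c: "cset (%x. Q x a)" and x: "Q x a"
  shows "NT x"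
proof (rule ccontr)
  assume "\<not> NT x"
  note dQ = dsub2[OF Q]
  define bad where "bad a \<longleftrightarrow> cset (%x. Q x a) & (EX x. Q x a & \<not> NT x)" for a
  have d: "dfp {} (%e. bad (e 0))" unfolding bad_def cset_def by (intro dintros dQ)
  have "bad a" unfolding bad_def using c x \<open>\<not> NT x\<close> by blast
  from least(2)[OF dfp_weaken[OF d] o this] have b: "bad (least bad)" .
  have "NT y" if "Q y (least bad)" for y
  proof (rule NT_definable[of "%y. Q y (least bad)"])
    show "dfp {} (%e. Q (e 0) (least bad))" by (intro dQ dintros dsub1[OF d])
    show "cset (%y. Q y (least bad))" using b unfolding bad_def by blast
  qed (rule that)
  then show False using b unfolding bad_def by blast
qed

text \<open>Only the first parameter is minimized, while the second stays existentially quantified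
  in \<open>bad\<close>. With the first one definable, \<open>NT_definable1\<close> takes care of
  the second; no coding of pairs of ordinals by ordinals is involved.\<close>

lemma NT_definable2:
  assumes Q: "dfp {} (%e. Q (e 0) (e 1) (e 2))" and o: "ord a" "ord b"
    and c: "cset (%x. Q x a b)" and x: "Q x a b"
  shows "NT x"
proof (rule ccontr)
  assume "\<not> NT x"
  note dQ = dsub3[OF Q]
  define bad where "bad a \<longleftrightarrow> (EX b. ord b & cset (%x. Q x a b) & (EX x. Q x a b & \<not> NT x))" for a
  have d: "dfp {} (%e. bad (e 0))" unfolding bad_def cset_def by (intro dintros dQ)
  have "bad a" unfolding bad_def using c x o(2) \<open>\<not> NT x\<close> by blast
  from least(2)[OF dfp_weaken[OF d] o(1) this] have "bad (least bad)" .
  then obtain b y where b: "ord b" "cset (%x. Q x (least bad) b)" "Q y (least bad) b" "\<not> NT y"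
    unfolding bad_def by blast
  have "NT y"
  proof (rule NT_definable1[of "%y. Q y (least bad)", OF _ b(1-3)])
    show "dfp {} (%e. Q (e 0) (least bad) (e 1))" by (intro dQ dintros dsub1[OF d])
  qed
  then show False using b(4) by blast
qed

text \<open>The union is indexed by internal formulas, nonstandard ones included, which form an
  internally countable collection.\<close>

lemma cset_N: "ord z ==> cset (N z)"
proof -
  assume z: "ord z"
  have "isset (%x. x \<E> V z & N z x)" by (rule isset_param) (intro dintros)
  then obtain X where X: "\<And>x. x \<E> X \<longleftrightarrow> N z x" unfolding isset_def N_def by blast
  obtain h where h: "cnt h" "\<And>n c. isform omega n c ==> c \<E> h" by (rule ex_countable_forms) blast
  \<comment> \<open>Indices whose defined set is uncountable contribute the empty set, so that every
    summand is countable.\<close>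
  let ?F = "%c. if cnt (Dset (V z) c) then Dset (V z) c else emp"
  have "cnt X"
  proof (rule cnt_UN[OF h(1), of ?F])
    show "dfun UNIV (%e. ?F (e 0))" by (intro dintros)
    show "cnt (?F c)" for c using cnt_subset[OF cnt_omega, of emp] by simp
    show "EX c. c \<E> h & y \<E> ?F c" if y: "y \<E> X" for y
    proof -
      obtain c where "isform omega (num 1) c" "y \<E> Dset (V z) c" "cnt (Dset (V z) c)"
        using y unfolding X N_def by blast
      then show ?thesis using h(2)[of "num 1" c] by (intro exI[of _ c]) simp
    qed
  qed
  then show ?thesis unfolding cset_def using X by blast
qed

lemma cset_image2:
  assumes F: "dfun UNIV (%e. F (e 0) (e 1))" and "cset Q" "cset R"
  shows "cset (%x. EX u v. Q u & R v & x = F u v)"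
proof -
  obtain X Y where X: "\<And>x. x \<E> X \<longleftrightarrow> Q x" "cnt X" and Y: "\<And>x. x \<E> Y \<longleftrightarrow> R x" "cnt Y"
    using assms unfolding cset_def by blast
  let ?F = "%p. F (fst' p) (snd' p)"
  have dF: "dfun UNIV (%e. ?F (e 0))" by (intro dsubf2[OF F] dintros)
  have "isset (%x. EX p. p \<E> times X Y & x = ?F p)" using dF by (rule isset_repl)
  then obtain Z where Z: "\<And>x. x \<E> Z \<longleftrightarrow> (EX p. p \<E> times X Y & x = ?F p)" unfolding isset_def by blast
  have "cnt Z" by (rule cnt_image[OF cnt_times[OF X(2) Y(2)] dF]) (simp add: Z)
  moreover have "x \<E> Z \<longleftrightarrow> (EX u v. Q u & R v & x = F u v)" for x
  proof
    assume "EX u v. Q u & R v & x = F u v"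
    then obtain u v where "Q u" "R v" "x = F u v" by blast
    then show "x \<E> Z" unfolding Z using X Y by (intro exI[of _ "opair u v"]) simp
  next
    assume "x \<E> Z"
    then obtain u v where "u \<E> X" "v \<E> Y" "x = F u v" unfolding Z mem_times by auto
    then show "EX u v. Q u & R v & x = F u v" using X Y by blast
  qed
  ultimately show ?thesis unfolding cset_def by blast
qed

section \<open>Closure under functions definable without parameters\<close>

lemma NT_fun2:
  assumes F: "dfun {} (%e. F (e 0) (e 1))" and "NT a" "NT b"
  shows "NT (F a b)"
proof -
  obtain z w where z: "ord z" "N z a" and w: "ord w" "N w b" using assms unfolding NT_def by blast
  show ?thesis
  proof (rule NT_definable2[of "%x z w. EX u v. N z u & N w v & x = F u v", OF _ z(1) w(1)])
    show "dfp {} (%e. EX u v. N (e 1) u & N (e 2) v & e 0 = F u v)" by (intro dintros dsubf2[OF F])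
    show "cset (%x. EX u v. N z u & N w v & x = F u v)"
      by (rule cset_image2[OF dfun_weaken[OF F] cset_N[OF z(1)] cset_N[OF w(1)]])
  qed (use z w in blast)
qed

lemma NT_ord: "ord a ==> NT a"
proof (rule NT_definable1[of "%x y. x = y"])
  show "dfp {} (%e. e 0 = e 1)" by (intro dintros)
  show "cset (%x. x = a)" unfolding cset_def by (rule exI[of _ "upr a a"]) (simp add: cnt_upr)
qed simp_all

text \<open>Finitely many sets are packed as \<open>opair (e 0) (opair (e 1) ...)\<close>, and the
  components are recovered by definable functions. This reduces functions of several arguments to
  functions of one.\<close>

primrec dec :: "nat \<Rightarrow> 'a \<Rightarrow> 'a" where
  "dec 0 t = fst' t"
| "dec (Suc i) t = dec i (snd' t)"

lemma dfun_dec: "dfun P t ==> dfun P (%e. dec i (t e))"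
  by (induction i arbitrary: t) (simp_all add: dfun_fst dfun_snd)

lemma NT_code: "(\<And>i. i < k ==> NT (e i)) ==> EX t. NT t & (ALL i<k. dec i t = e i)"
proof (induction k arbitrary: e)
  case 0
  then show ?case using NT_ord[OF ord_emp] by auto
next
  case (Suc k)
  obtain t where t: "NT t" "ALL i<k. dec i t = e (Suc i)" using Suc.IH[of "%i. e (Suc i)"] Suc.prems by auto
  have "NT (opair (e 0) t)"
    by (rule NT_fun2[of opair]) (use t Suc.prems in \<open>auto intro!: dintros\<close>)
  moreover have "dec i (opair (e 0) t) = e i" if "i < Suc k" for i
    using that t by (cases i) auto
  ultimately show ?case by blast
qed

text \<open>The formula for the graph of \<open>F\<close> mentions finitely many variables, so
  \<open>e\<close> may be replaced by the decoding of one set \<open>t\<close> in \<open>NT\<close>.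
  \<open>NT_fun2\<close> is then applied to \<open>t\<close> with a dummy second argument.\<close>

theorem NT_closed:
  assumes F: "dfun {} F" and e: "\<And>i. NT (e i)"
  shows "NT (F e)"
proof -
  obtain p where p: "\<And>e. (e 0 = F (%n. e (Suc n))) = holds E e p"
    using dfp_empty[OF F[unfolded dfun_def]] by blast
  obtain k where k: "\<And>i. i \<in> fv p ==> i < k" using finite_fv[of p] by (metis finite_nat_set_iff_bounded)
  obtain t where t: "NT t" "ALL i<k. dec i t = e i" using NT_code[of k e] e by blast
  let ?e = "%i. dec i t"
  have "holds E (F e ## e) p" using p[of "F e ## e"] by simp
  moreover have "holds E (F e ## e) p = holds E (F e ## ?e) p"
    by (rule holds_cong) (use k t in \<open>force split: nat.splits\<close>)
  ultimately have "F e = F ?e" using p[of "F e ## ?e"] by simp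
  moreover have "NT (F ?e)"
  proof (rule NT_fun2[of "%t u. F (%i. dec i t)", OF _ t(1) t(1)])
    show "dfun {} (%e. F (%i. dec i (e 0)))"
      by (rule dfun_subst[OF F, of "%i e. dec i (e 0)"]) (intro dfun_dec dfun_var)
  qed
  ultimately show ?thesis by simp
qed

corollary HNT_closed:
  assumes "dfun {} F" "\<And>i. HNT (e i)" "\<And>x. x \<E> F e ==> HNT x"
  shows "HNT (F e)"
proof (rule HNTI)
  show "NT (F e)" by (rule NT_closed[OF assms(1) HNT_NT[OF assms(2)]])
qed (rule assms(3))

lemma HNT_ord: "ord a ==> HNT a"
proof -
  have "ord a --> HNT a"
  proof (rule eps_induct[of "%a. ord a --> HNT a"])
    show "dfp UNIV (%e. ord (e 0) --> HNT (e 0))" by (intro dintros)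
  qed (use HNTI NT_ord ord_mem in blast)
  then show "ord a ==> HNT a" by blast
qed

subsection \<open>The axioms of ZF\<close>

lemma holds_relativize: "holds E e (relativize HNT_fm p) = holdsR HNT E e p"
  by (induction p arbitrary: e) (simp_all add: holds_HNT)

lemma dfp_holdsR: "(\<And>i. dfun P (T i)) ==> dfp P (%e. holdsR HNT E (%i. T i e) p)"
  unfolding holds_relativize[symmetric] by (rule dfp_holds)

text \<open>The axioms hold only for parameters in \<open>HNT\<close>, while \<open>e\<close> is
  arbitrary here. The closure is a sentence, so it can be evaluated at an environment that does lie
  in \<open>HNT\<close>.\<close>

lemma holdsR_universal_closure:
  assumes q: "\<And>e. (\<And>i. HNT (e i)) ==> holdsR HNT E e q" and p: "p \<in> universal_closures q"
  shows "holdsR HNT E e p"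
proof -
  obtain n where n: "p = (Forall ^^ n) q" "fv p = {}" using p unfolding universal_closures_def by auto
  have "holdsR HNT E e ((Forall ^^ n) q)" if "\<And>i. HNT (e i)" for e using that
  proof (induction n arbitrary: e)
    case (Suc n)
    have "holdsR HNT E (x ## e) ((Forall ^^ n) q)" if "HNT x" for x
      by (rule Suc.IH) (use that Suc.prems in \<open>auto split: nat.split\<close>)
    then show ?case by simp
  qed (simp add: q)
  from this[of "%_. emp"] have "holdsR HNT E (%_. emp) p" using HNT_ord[OF ord_emp] n(1) by simp
  moreover have "holdsR HNT E e p = holdsR HNT E (%_. emp) p" by (rule holdsR_cong) (simp add: n(2))
  ultimately show ?thesis by simp
qed

text \<open>Truth in \<open>HNT\<close> of a fixed formula is definable in the model by its
  relativization. The required set is therefore the value, at \<open>a\<close> and the parameters,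
  of a function definable without parameters, and its elements are in \<open>HNT\<close> because
  those of \<open>a\<close> are.\<close>

lemma HNT_separation:
  assumes e: "\<And>i. HNT (e i)"
  shows "holdsR HNT E e (separation_fm p)"
proof -
  let ?F = "%e. Coll (%x. x \<E> e 0 & holdsR HNT E (x ## (%i. e (Suc i))) p)"
  have "dfun P (((%e. e 0) ## (%i e. e (Suc (Suc i)))) i)" for i P
    by (auto intro!: dintros split: nat.split)
  from dfp_holdsR[of _ "(%e. e 0) ## (%i e. e (Suc (Suc i)))", OF this]
  have d: "dfp P (%e. holdsR HNT E (%i. ((%e. e 0) ## (%i e. e (Suc (Suc i)))) i e) p)" for P .
  have eq: "(%i. ((%e. e 0) ## (%i e. e (Suc (Suc i)))) i e) = (e 0 ## (%i. e (Suc (Suc i))))" for e :: "nat \<Rightarrow> 'a"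
    by (rule ext) (simp split: nat.split)
  have dF: "dfun {} ?F" by (intro dintros) (rule d[unfolded eq])
  have "EX b. HNT b & (ALL x. HNT x --> (x \<E> b \<longleftrightarrow> x \<E> a & holdsR HNT E (x ## e) p))" if a: "HNT a" for a
  proof (intro exI conjI allI impI)
    \<comment> \<open>Definability appears a second time with \<open>e\<close> as fixed parameters:
      this version gives the existence of the set, the previous one its membership in
      \<open>NT\<close>.\<close>
    have "dfun UNIV (((%e. e 0) ## (%i _. e i)) i)" for i
      by (auto intro!: dintros split: nat.split)
    from dfp_holdsR[of _ "(%e. e 0) ## (%i _. e i)", OF this]
    have d': "dfp UNIV (%e'. holdsR HNT E (%i. ((%e. e 0) ## (%i _. e i)) i e') p)" .
    have eq': "(%i. ((%e. e 0) ## (%i _. e i)) i e') = (e' 0 ## e)" for e' :: "nat \<Rightarrow> 'a"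
      by (rule ext) (simp split: nat.split)
    have "isset (%x. x \<E> a & holdsR HNT E (x ## e) p)"
      by (rule isset_param) (rule d'[unfolded eq'])
    then have m: "x \<E> ?F (a ## e) \<longleftrightarrow> x \<E> a & holdsR HNT E (x ## e) p" for x
      by (simp add: mem_Coll)
    show "HNT (?F (a ## e))"
    proof (rule HNT_closed[OF dF])
      show "HNT ((a ## e) i)" for i using a e by (simp split: nat.split)
      show "HNT x" if "x \<E> ?F (a ## e)" for x using that a HNT_trans unfolding m by blast
    qed
    show "x \<E> ?F (a ## e) \<longleftrightarrow> x \<E> a & holdsR HNT E (x ## e) p" for x by (rule m)
  qed
  moreover have "holdsR HNT E (x ## b ## a ## e) (ren (case_nat 0 (%k. k + 3)) p) = holdsR HNT E (x ## e) p" for x b a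
    unfolding holdsR_ren
    by (rule arg_cong[where f = "%e. holdsR HNT E e p"], rule ext) (simp add: numeral_eq_Suc split: nat.split)
  ultimately show ?thesis unfolding separation_fm_def by simp
qed

text \<open>Replacement in the surrounding model provides the image as a set. It is cut down to
  values in \<open>HNT\<close>, so heredity is immediate and only membership in \<open>NT\<close>
  calls for the closure theorem.\<close>

lemma HNT_replacement:
  assumes e: "\<And>i. HNT (e i)"
  shows "holdsR HNT E e (replacement_fm p)"
proof -
  let ?F = "%e. Coll (%y. HNT y & (EX x. x \<E> e 0 & holdsR HNT E (x ## y ## (%i. e (Suc i))) p))"
  let ?T = "(%e. e 0) ## (%e. e (Suc 0)) ## (%i e. e (Suc (Suc (Suc i))))"
  have T: "dfun P (?T i)" for i P by (auto intro!: dintros split: nat.split)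
  have eq: "(%i. ?T i e) = (e 0 ## e (Suc 0) ## (%i. e (Suc (Suc (Suc i)))))" for e :: "nat \<Rightarrow> 'a"
    by (rule ext) (simp split: nat.split)
  have d: "dfp P (%e. holdsR HNT E (e 0 ## e (Suc 0) ## (%i. e (Suc (Suc (Suc i))))) p)" for P
    using dfp_holdsR[of P ?T, OF T] unfolding eq .
  have dF: "dfun {} ?F" by (intro dintros) (rule d)
  have "EX b. HNT b & (ALL y. HNT y --> (y \<E> b \<longleftrightarrow> (EX x. HNT x & x \<E> a & holdsR HNT E (x ## y ## e) p)))"
    if f: "ALL x. HNT x --> (ALL y. HNT y --> (ALL z. HNT z -->
      holdsR HNT E (x ## y ## e) p & holdsR HNT E (x ## z ## e) p --> y = z))" and a: "HNT a" for a
  proof (intro exI conjI allI impI)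
    let ?U = "(%e. e (Suc 0)) ## (%e. e 0) ## (%i _. e i)"
    have U: "dfun UNIV (?U i)" for i by (auto intro!: dintros split: nat.split)
    have eq': "(%i. ?U i e') = (e' (Suc 0) ## e' 0 ## e)" for e' :: "nat \<Rightarrow> 'a"
      by (rule ext) (simp split: nat.split)
    have d': "dfp UNIV (%e'. holdsR HNT E (e' (Suc 0) ## e' 0 ## e) p)"
      using dfp_holdsR[of UNIV ?U, OF U] unfolding eq' .
    note d'' = dsub2[of UNIV "%y x. holdsR HNT E (x ## y ## e) p", unfolded One_nat_def, OF d']
    \<comment> \<open>The formula is functional only between members of \<open>HNT\<close>, hence
      the restriction on \<open>y\<close>; where there is no value, \<open>the1\<close> supplies a
      harmless default.\<close>
    let ?G = "%x. the1 (%y. HNT y & holdsR HNT E (x ## y ## e) p)"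
    have "isset (%y. HNT y & (EX x. x \<E> a & holdsR HNT E (x ## y ## e) p))"
    proof (rule isset_sub)
      show "isset (%y. EX x. x \<E> a & y = ?G x)" by (rule isset_repl) (intro dintros d'')
      fix y assume "HNT y & (EX x. x \<E> a & holdsR HNT E (x ## y ## e) p)"
      then obtain x where x: "HNT y" "x \<E> a" "holdsR HNT E (x ## y ## e) p" by blast
      then have "HNT x" using a HNT_trans by blast
      then have "?G x = y" using f x by (intro the1_eq) auto
      then show "EX x. x \<E> a & y = ?G x" using x by blast
    qed (intro dintros d'')
    then have m: "y \<E> ?F (a ## e) \<longleftrightarrow> HNT y & (EX x. x \<E> a & holdsR HNT E (x ## y ## e) p)" for y
      by (simp add: mem_Coll)
    show "HNT (?F (a ## e))"
    proof (rule HNT_closed[OF dF])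
      show "HNT ((a ## e) i)" for i using a e by (simp split: nat.split)
      show "HNT x" if "x \<E> ?F (a ## e)" for x using that unfolding m by blast
    qed
    show "y \<E> ?F (a ## e) \<longleftrightarrow> (EX x. HNT x & x \<E> a & holdsR HNT E (x ## y ## e) p)" if "HNT y" for y
      unfolding m using that a HNT_trans by blast
  qed
  moreover have "holdsR HNT E (z ## y ## x ## e) (ren (case_nat 2 (case_nat 1 (%k. k + 3))) p) = holdsR HNT E (x ## y ## e) p"
    "holdsR HNT E (z ## y ## x ## e) (ren (case_nat 2 (case_nat 0 (%k. k + 3))) p) = holdsR HNT E (x ## z ## e) p"
    "holdsR HNT E (x ## y ## b ## a ## e) (ren (case_nat 0 (case_nat 1 (%k. k + 4))) p) = holdsR HNT E (x ## y ## e) p"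
    for x y z b a
    unfolding holdsR_ren
    by (rule arg_cong[where f = "%e. holdsR HNT E e p"], rule ext, simp add: numeral_eq_Suc split: nat.split)+
  ultimately show ?thesis unfolding replacement_fm_def by simp
qed

lemma HNT_upr: "HNT x ==> HNT y ==> HNT (upr x y)"
proof -
  assume x: "HNT x" "HNT y"
  have "dfun {} (%e. upr (e 0) (e 1))" by (intro dintros)
  from HNT_closed[OF this, of "x ## (%_. y)"] show ?thesis
    using x by (force split: nat.split)
qed

lemma HNT_un: "HNT x ==> HNT (un x)"
proof -
  assume x: "HNT x"
  show ?thesis
  proof (rule HNT_closed[of "%e. un (e 0)" "%_. x"])
    show "dfun {} (%e. un (e 0))" by (intro dintros)
    show "HNT y" if "y \<E> un x" for y using that x HNT_trans by auto
  qed (rule x)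
qed

lemma HNT_suc: "HNT x ==> HNT (suc x)"
proof -
  assume x: "HNT x"
  show ?thesis
  proof (rule HNT_closed[of "%e. suc (e 0)" "%_. x"])
    show "dfun {} (%e. suc (e 0))" by (intro dintros)
    show "HNT y" if "y \<E> suc x" for y using that x HNT_trans by auto
  qed (rule x)
qed

text \<open>The witness is not \<open>pow x\<close>, which may have members outside
  \<open>HNT\<close>, but its intersection with the definable class \<open>HNT\<close>.\<close>

lemma HNT_pow:
  assumes x: "HNT x"
  shows "EX z. HNT z & (ALL y. HNT y --> (y \<E> z \<longleftrightarrow> subs y x))"
proof (intro exI conjI allI impI)
  let ?F = "%x. Coll (%y. y \<E> pow x & HNT y)"
  have "isset (%y. y \<E> pow x & HNT y)" by (rule isset_param) (intro dintros)
  then have m: "y \<E> ?F x \<longleftrightarrow> subs y x & HNT y" for y by (simp add: mem_Coll)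
  show "HNT (?F x)"
  proof (rule HNT_closed[of "%e. ?F (e 0)" "%_. x"])
    show "dfun {} (%e. ?F (e 0))" by (intro dintros)
    show "HNT y" if "y \<E> ?F x" for y using that unfolding m by blast
  qed (rule x)
  show "y \<E> ?F x \<longleftrightarrow> subs y x" if "HNT y" for y using that unfolding m by blast
qed

lemma HNT_ZF:
  assumes "p \<in> ZF"
  shows "holdsR HNT E e p"
proof -
  have 1: "holdsR HNT E e extensionality_ax"
  proof -
    have "ALL x. HNT x --> (ALL y. HNT y --> (ALL z. HNT z --> (z \<E> x \<longleftrightarrow> z \<E> y)) --> x = y)"
      using HNT_trans extensional by metis
    then show ?thesis unfolding extensionality_ax_def by (simp add: numeral_eq_Suc)
  qed
  have 2: "holdsR HNT E e pairing_ax"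
  proof -
    have "EX z. HNT z & (ALL w. HNT w --> (w \<E> z \<longleftrightarrow> w = x \<or> w = y))" if "HNT x" "HNT y" for x y
      by (intro exI[of _ "upr x y"]) (simp add: HNT_upr that)
    then show ?thesis unfolding pairing_ax_def upair_fm_def by (simp add: numeral_eq_Suc)
  qed
  have 3: "holdsR HNT E e union_ax"
  proof -
    have "EX u. HNT u & (ALL w. HNT w --> (w \<E> u \<longleftrightarrow> (EX y. HNT y & y \<E> x & w \<E> y)))" if x: "HNT x" for x
    proof (intro exI[of _ "un x"] conjI allI impI)
      show "HNT (un x)" using x by (rule HNT_un)
      show "w \<E> un x \<longleftrightarrow> (EX y. HNT y & y \<E> x & w \<E> y)" for w using HNT_trans[OF x] by auto
    qed
    then show ?thesis unfolding union_ax_def by (simp add: numeral_eq_Suc)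
  qed
  have 4: "holdsR HNT E e power_set_ax"
  proof -
    have s: "(ALL z. HNT z --> z \<E> y --> z \<E> x) \<longleftrightarrow> subs y x" if "HNT y" for x y
      using HNT_trans[OF that] unfolding subs_def by blast
    have "EX u. HNT u & (ALL y. HNT y --> (y \<E> u \<longleftrightarrow> (ALL z. HNT z --> z \<E> y --> z \<E> x)))" if "HNT x" for x
    proof -
      obtain u where u: "HNT u" "\<And>y. HNT y ==> y \<E> u \<longleftrightarrow> subs y x" using HNT_pow[OF \<open>HNT x\<close>] by blast
      then show ?thesis using s by (intro exI[of _ u]) simp
    qed
    then show ?thesis unfolding power_set_ax_def sub_fm_def by (simp add: numeral_eq_Suc)
  qed
  have 5: "holdsR HNT E e infinity_ax"
  proof -
    have s: "EX s. HNT s & s \<E> omega & (ALL v. HNT v --> (v \<E> s \<longleftrightarrow> v \<E> y \<or> v = y))" if "HNT y" "y \<E> omega" for y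
      using that by (intro exI[of _ "suc y"]) (simp add: HNT_suc)
    have z: "EX z. HNT z & z \<E> omega & (ALL x. HNT x --> \<not> x \<E> z)"
      by (intro exI[of _ emp]) (simp add: HNT_ord)
    have "EX w. HNT w & (EX z. HNT z & z \<E> w & (ALL x. HNT x --> \<not> x \<E> z)) &
        (ALL y. HNT y --> y \<E> w --> (EX s. HNT s & s \<E> w & (ALL v. HNT v --> (v \<E> s \<longleftrightarrow> v \<E> y \<or> v = y))))"
      using s z HNT_ord[OF ord_omega] by (rule_tac exI[of _ omega]) simp
    then show ?thesis
      unfolding infinity_ax_def inductive_fm_def empty_fm_def succ_fm_def by (simp add: numeral_eq_Suc)
  qed
  have 6: "holdsR HNT E e regularity_ax"
  proof -
    have "ALL x. HNT x --> (EX y. HNT y & y \<E> x) --> (EX y. HNT y & y \<E> x & (ALL z. z \<E> y --> HNT z --> \<not> z \<E> x))"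
    proof (intro allI impI, elim exE conjE)
      fix x y assume x: "HNT x" "y \<E> x"
      obtain w where "w \<E> x" "\<And>z. z \<E> w ==> \<not> z \<E> x" using ax_regularity[OF x(2)] by blast
      then show "EX y. HNT y & y \<E> x & (ALL z. z \<E> y --> HNT z --> \<not> z \<E> x)"
        using HNT_trans[OF x(1)] by blast
    qed
    then show ?thesis unfolding regularity_ax_def by (simp add: numeral_eq_Suc)
  qed
  have 7: "holdsR HNT E e p" if "p \<in> universal_closures (separation_fm q)" for p q
    by (rule holdsR_universal_closure[OF HNT_separation that])
  have 8: "holdsR HNT E e p" if "p \<in> universal_closures (replacement_fm q)" for p q
    by (rule holdsR_universal_closure[OF HNT_replacement that])
  show ?thesis using assms unfolding ZF_def
    by (elim UnE UN_E insertE emptyE) (simp_all add: 1 2 3 4 5 6 7 8)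
qed

subsection \<open>Ordinal definable sets\<close>

text \<open>The formula is quantified away, so that \<open>z\<close>, \<open>n\<close> and
  \<open>s\<close> are the only parameters left. The price is that they determine a countable set
  instead of a single \<open>x\<close>.\<close>

definition defd :: "'a \<Rightarrow> 'a \<Rightarrow> 'a \<Rightarrow> 'a \<Rightarrow> bool"
  where "defd z n s x \<longleftrightarrow> x \<E> V z & (EX c. isform omega (suc n) c &
    (ALL y. y \<E> V z --> (satf omega (V z) c (snocs s n y) \<longleftrightarrow> y = x)))"

definition OD :: "'a \<Rightarrow> bool"
  where "OD x \<longleftrightarrow> (EX z n s. ord z & n \<E> omega & mapsto s n z & defd z n s x)"

lemma dfp_defd [dintros]:
  "dfun P t ==> dfun P u ==> dfun P v ==> dfun P w ==> dfp P (%e. defd (t e) (u e) (v e) (w e))"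
  by (rule dsub4) (unfold defd_def, intro dintros)

lemma holds_OD: "holds E e (OD_fm a) \<longleftrightarrow> OD (e a)"
  unfolding OD_fm_def OD_def defd_def mapsto_def
  by (simp add: holds_Vset numeral_eq_Suc cong: conj_cong) blast

text \<open>Each of the countably many internal formulas defines at most one \<open>x\<close> from
  given \<open>z\<close> and \<open>s\<close>, so the set is an image of a countable one.\<close>

lemma cset_defd: "cset (defd z n s)"
proof -
  have "isset (%x. x \<E> V z & defd z n s x)" by (rule isset_param) (intro dintros)
  then obtain X where X: "\<And>x. x \<E> X \<longleftrightarrow> defd z n s x" unfolding isset_def defd_def by blast
  obtain h where h: "cnt h" "\<And>n c. isform omega n c ==> c \<E> h" by (rule ex_countable_forms) blast
  let ?Q = "%c x. x \<E> V z & (ALL y. y \<E> V z --> (satf omega (V z) c (snocs s n y) \<longleftrightarrow> y = x))"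
  have "cnt X"
  proof (rule cnt_image[OF h(1), of "%c. the1 (?Q c)"])
    show "dfun UNIV (%e. the1 (?Q (e 0)))" by (intro dintros)
    fix x assume "x \<E> X"
    then obtain c where c: "isform omega (suc n) c" "?Q c x" unfolding X defd_def by blast
    then have "the1 (?Q c) = x" by (intro the1_eq) auto
    then show "EX c. c \<E> h & x = the1 (?Q c)" using h(2) c(1) by blast
  qed
  then show ?thesis unfolding cset_def using X by blast
qed

text \<open>
  For fixed \<open>z\<close> and \<open>n\<close>, the lexicographically least sequence \<open>s\<close> of length \<open>n\<close> such that a set outside
  of \<open>NT\<close> is definable from \<open>s\<close> in \<open>V z\<close> is definable from \<open>z\<close> and \<open>n\<close>.
\<close>

definition bad :: "'a \<Rightarrow> 'a \<Rightarrow> 'a \<Rightarrow> bool"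
  where "bad z n s \<longleftrightarrow> mapsto s n z & (EX x. defd z n s x & \<not> NT x)"

definition agree :: "'a \<Rightarrow> 'a \<Rightarrow> 'a \<Rightarrow> bool"
  where "agree s t j \<longleftrightarrow> (ALL k. k \<E> j --> app s k = app t k)"

text \<open>Here \<open>u\<close> is the initial segment of length \<open>i\<close> of the
  lexicographically least bad sequence: each value is the least one among bad sequences with the
  same earlier values. Initial segments are what the induction on the length needs.\<close>

definition lex :: "'a \<Rightarrow> 'a \<Rightarrow> 'a \<Rightarrow> 'a \<Rightarrow> bool"
  where "lex z n i u \<longleftrightarrow> mapsto u i z & (EX s. bad z n s & agree s u i) &
    (ALL j. j \<E> i --> (ALL s. bad z n s & agree s u j --> subs (app u j) (app s j)))"

lemma dfp_bad [dintros]: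
  "dfun P t ==> dfun P u ==> dfun P v ==> dfp P (%e. bad (t e) (u e) (v e))"
  by (rule dsub3) (unfold bad_def, intro dintros)

lemma dfp_agree [dintros]:
  "dfun P t ==> dfun P u ==> dfun P v ==> dfp P (%e. agree (t e) (u e) (v e))"
  by (rule dsub3) (unfold agree_def, intro dintros)

lemma dfp_lex [dintros]:
  "dfun P t ==> dfun P u ==> dfun P v ==> dfun P w ==> dfp P (%e. lex (t e) (u e) (v e) (w e))"
  by (rule dsub4) (unfold lex_def, intro dintros)

text \<open>The length may be nonstandard, so the sequence is built by induction inside the model. A
  segment is extended by the least value that some bad sequence continuing it takes at the next
  position.\<close>

lemma ex_lex:
  assumes z: "ord z" and n: "n \<E> omega" and s: "bad z n s" and i: "i \<E> omega"
  shows "subs i n --> (EX u. lex z n i u)"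
proof (rule omega_induct[OF i, of "%i. subs i n --> (EX u. lex z n i u)"])
  show "dfp UNIV (%e. subs (e 0) n --> (EX u. lex z n (e 0) u))" by (intro dintros)
  have "lex z n emp emp" unfolding lex_def using s mapsto_emp by (auto simp: agree_def)
  then show "subs emp n --> (EX u. lex z n emp u)" by blast
  fix i assume i: "i \<E> omega" and IH: "subs i n --> (EX u. lex z n i u)"
  show "subs (suc i) n --> (EX u. lex z n (suc i) u)"
  proof
    assume "subs (suc i) n"
    then have "subs i n" and i_n: "i \<E> n" unfolding subs_def by auto
    then obtain u where u: "mapsto u i z" "EX s. bad z n s & agree s u i"
      "\<And>j s. j \<E> i ==> bad z n s ==> agree s u j ==> subs (app u j) (app s j)"
      using IH unfolding lex_def by blast
    let ?Q = "%b. EX s. bad z n s & agree s u i & app s i = b"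
    have dQ: "dfp UNIV (%e. ?Q (e 0))" by (intro dintros)
    have Q: "app s i \<E> z" if "bad z n s" for s using that i_n unfolding bad_def mapsto_def by blast
    then have oQ: "ord (app s i)" if "bad z n s" for s using that z ord_mem by blast
    let ?b = "least ?Q"
    obtain s where s: "bad z n s" "agree s u i" using u(2) by blast
    from least(2)[OF dQ oQ[OF s(1)]] s
    obtain t where t: "bad z n t" "agree t u i" "app t i = ?b" by blast
    have b: "subs ?b (app s i)" if "bad z n s" "agree s u i" for s
      using least(4)[OF dQ oQ[OF that(1)]] that by blast
    let ?u = "snocs u i ?b"
    have fu: "isfun u i" using u(1) unfolding mapsto_def by blast
    note sn = isfun_snocs[OF fu not_mem_self, where a = ?b]
    have ag: "agree s ?u j \<longleftrightarrow> agree s u j" if "j \<E> i \<or> j = i" for s j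
    proof -
      have "k \<E> i" if "k \<E> j" for k using that \<open>j \<E> i \<or> j = i\<close> ord_mem_trans[OF ord_omega_mem[OF i]] by blast
      then show ?thesis unfolding agree_def[of s ?u j] agree_def[of s u j] using sn(3) by simp
    qed
    have "lex z n (suc i) ?u" unfolding lex_def
    proof (intro conjI allI impI)
      have "?b \<E> z" using Q[OF t(1)] t(3) by simp
      then show "mapsto ?u (suc i) z" using u(1) by (rule mapsto_snocs[rotated])
      have "agree t ?u (suc i)" using ag[of i t] t(2,3) sn(2) unfolding agree_def by auto
      then show "EX s. bad z n s & agree s ?u (suc i)" using t(1) by blast
      fix j s assume j: "j \<E> suc i" and s: "bad z n s & agree s ?u j"
      then have s: "bad z n s" "agree s u j" using ag by auto
      show "subs (app ?u j) (app s j)"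
      proof (cases "j = i")
        case True
        then show ?thesis using b s sn(2) by simp
      next
        case False
        then have "j \<E> i" using j by simp
        then show ?thesis using u(3)[OF _ s] sn(3) by simp
      qed
    qed
    then show "EX u. lex z n (suc i) u" by blast
  qed
qed

lemma lex_bad: "lex z n n u ==> bad z n u"
proof -
  assume "lex z n n u"
  then obtain s where "mapsto u n z" "bad z n s" "agree s u n" unfolding lex_def by blast
  moreover from this have "s = u"
    unfolding agree_def by (intro isfun_ext[of s n u]) (auto simp: bad_def mapsto_def)
  ultimately show ?thesis by simp
qed

text \<open>At the first possible difference both sequences have the same past, so each is a
  competitor of the other and the two values bound one another.\<close>

lemma lex_unique:
  assumes n: "n \<E> omega" and u: "lex z n n u" and v: "lex z n n v"
  shows "u = v"
proof -
  have "j \<E> n --> app u j = app v j" for j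
  proof (rule eps_induct[of "%j. j \<E> n --> app u j = app v j"])
    show "dfp UNIV (%e. e 0 \<E> n --> app u (e 0) = app v (e 0))" by (intro dintros)
    fix j assume IH: "\<And>k. k \<E> j ==> k \<E> n --> app u k = app v k"
    show "j \<E> n --> app u j = app v j"
    proof
      assume j: "j \<E> n"
      then have "k \<E> n" if "k \<E> j" for k using that ord_mem_trans[OF ord_omega_mem[OF n]] by blast
      then have "agree u v j" "agree v u j" unfolding agree_def using IH by auto
      then show "app u j = app v j"
        using u v j lex_bad[OF u] lex_bad[OF v] unfolding lex_def by (intro subs_antisym) blast+
    qed
  qed
  then show ?thesis using lex_bad[OF u] lex_bad[OF v]
    by (intro isfun_ext[of u n v]) (auto simp: bad_def mapsto_def)
qed

theorem OD_NT: "OD x ==> NT x"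
proof (rule ccontr)
  assume "OD x" "\<not> NT x"
  then obtain z n s where z: "ord z" and n: "n \<E> omega" and s: "bad z n s" unfolding OD_def bad_def by blast
  obtain u where u: "lex z n n u" using ex_lex[OF z n s n] unfolding subs_def by blast
  obtain y where y: "defd z n u y" "\<not> NT y" using lex_bad[OF u] unfolding bad_def by blast
  have "NT y"
  \<comment> \<open>The sequence \<open>u\<close> is no longer a parameter, since \<open>lex\<close>
    determines it from \<open>z\<close> and \<open>n\<close>; the natural number \<open>n\<close>
    serves as the second ordinal parameter.\<close>
  proof (rule NT_definable2[of "%x z n. EX u. lex z n n u & defd z n u x", OF _ z ord_omega_mem[OF n]])
    show "dfp {} (%e. EX u. lex (e 1) (e 2) (e 2) u & defd (e 1) (e 2) u (e 0))" by (intro dintros)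
    have "(EX u. lex z n n u & defd z n u x) \<longleftrightarrow> defd z n u x" for x using u lex_unique[OF n u] by blast
    then show "cset (%x. EX u. lex z n n u & defd z n u x)" using cset_defd by simp
  qed (use u y in blast)
  then show False using y by blast
qed

end

lemma ZFC_sentences: "p \<in> ZFC ==> fv p = {}"
  by (auto simp: ZFC_def ZF_def universal_closures_def extensionality_ax_def pairing_ax_def union_ax_def
      power_set_ax_def infinity_ax_def regularity_ax_def choice_ax_def inductive_fm_def succ_fm_def
      empty_fm_def sub_fm_def upair_fm_def opair_fm_def inrel_fm_def function_on_fm_def BAll_def BEx_def
      Neg_def Conj_def Disj_def Iff_def Exists_def numeral_eq_Suc)

lemma ZFC_complete:
  assumes "\<And>(E :: nat \<Rightarrow> nat \<Rightarrow> bool) e. zfc_model E ==> holds E e q"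
  shows "ZFC \<turnstile> q"
proof (rule completeness)
  show "{extensionality_ax, pairing_ax, infinity_ax} \<subseteq> ZFC" unfolding ZFC_def ZF_def by blast
  show "holds E e q" if "\<And>p e. p \<in> ZFC ==> holds E e p" for E :: "nat \<Rightarrow> nat \<Rightarrow> bool" and e
    by (rule assms) (use that in \<open>unfold_locales\<close>)
qed (rule ZFC_sentences)

theorem theorem2p10:
  "proves_inner_model ZFC HNT_fm ZF \<and> (ZFC \<turnstile> subclass_fm HOD_fm HNT_fm)"
proof (unfold proves_inner_model_def, intro conjI ballI ZFC_complete)
  fix E :: "nat \<Rightarrow> nat \<Rightarrow> bool" and e assume "zfc_model E"
  then interpret zfc_model E .
  show "holds E e (\<^bold>\<forall> (HNT_fm 0 \<^bold>\<longrightarrow> BAll 0 (HNT_fm 0)))"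
    using HNT_trans by (simp add: holds_HNT)
  show "holds E e (\<^bold>\<forall> (ordinal_fm 0 \<^bold>\<longrightarrow> HNT_fm 0))"
    using HNT_ord by (simp add: holds_HNT)
  show "holds E e (relativize HNT_fm p)" if "p \<in> ZF" for p
    unfolding holds_relativize using that by (rule HNT_ZF)
  have "holds E e (HOD_fm 0) \<longleftrightarrow> hered OD (e 0)" for e
    unfolding HOD_fm_def by (rule holds_hereditarily[OF holds_OD])
  \<comment> \<open>\<open>hered\<close> is monotone in the class, so the inclusion of
    \<open>OD\<close> in \<open>NT\<close> suffices.\<close>
  then show "holds E e (subclass_fm HOD_fm HNT_fm)"
    using OD_NT unfolding subclass_fm_def by (simp add: holds_HNT HNT_def hered_def)
qed

end
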